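(* Work in the generalised semi-varying coefficient model with the notation of the context, and let $(\widetilde{\mathbf a}_k,\widetilde{\mathbf b}_k)$, $k=1,\ldots,n$, be the preliminary (LASSO-penalised local likelihood) estimators, i.e. the maximisers of $\mathcal Q_{nk}(\cdot,\cdot)$. Assume the following. (1) The kernel $K(\cdot)$ is a continuous and symmetric probability density function with compact support. (2a) $\mathsf E(Q_{i1}\mid X_i,U_i)=0$ a.s., and $u\mapsto \mathsf E(Q_{i1}^2\mid U_i=u)$ is continuous for $u\in[0,1]$. (2b) $q_2(s,y)<0$ for all $s\in\mathbb R$ and all $y$ in the range of the response variable; and there exists $M(X,U,y)>0$ such that, with $r(X,U)=\sum_{j=1}^{d_n}a_j(U)x_j$, $|q_2[r(X,U)+\delta_*,y]-q_2[r(X,U),y]|\le M(X,U,y)|\delta_*|$. (2c) There exist constants $0<\rho_1\le\rho_2<\infty$ such that, with probability approaching one, $$\rho_1\le\inf_{u\in[0,1]}\inf_{\mathbf v\in\boldsymbol\Omega_0(b)}\mathbf v^{\mathrm T}[-\ddot{\mathcal L}_n(u)]\mathbf v\le\sup_{u\in[0,1]}\sup_{\mathbf v\in\boldsymbol\Omega_0(b)}\mathbf v^{\mathrm T}[-\ddot{\mathcal L}_n(u)]\mathbf v\le\rho_2 .$$ (3) The density $f_U(\cdot)$ of $U$ has a continuous second-order derivative, and $f_U(u)$ is bounded away from zero and infinity for $u\in[0,1]$. (4) The functional coefficients $a_j(\cdot)$ have continuous second-order derivatives for $j=1,\ldots,d_n$. Then the following two statements hold. (i) Suppose that for some $m_0>2$,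 uniformly for $u\in[0,1]$, $$\max_{1\le j\le d_n}\mathsf E[|Q_{i1}x_{ij}|^{m_0}\mid U_i=u]+\max_{1\le j,k\le d_n}\mathsf E[|Q_{i2}x_{ij}x_{ik}|^{m_0}\mid U_i=u]<\infty\quad\text{a.s.}$$ and $$\max_{1\le j,k,l\le d_n}\mathsf E[|x_{ij}x_{ik}x_{il}M(X_i,U_i,y_i)|^{m_0}\mid U_i=u]<\infty\quad\text{a.s.},$$ that $d_n\propto n^{\tau_1}$ with $0\le\tau_1<\infty$, that $\frac{nh}{(nd_n^3)^{2/m_0}\log h^{-1}}\to\infty$, and that $h,\lambda_1,\lambda_2$ satisfy $h\propto n^{-\delta_1}$ with $0<\delta_1<1$, $s_{n2}h^2+\left(\frac{\log h^{-1}}{nh}\right)^{1/2}=o(\lambda_1)$, $\lambda_1\propto\lambda_2$ and $s_{n2}\lambda_1^2h^{-2}+s_{n2}^2\lambda_1=o(1)$. Then $$\max_{1\le k\le n}\|\widetilde{\mathbf a}_k-\mathbf a_{k0}\|+\max_{1\le k\le n}\|h(\widetilde{\mathbf b}_k-\mathbf b_{k0})\|=O_P(\sqrt{s_{n2}}\,\lambda_1).\qquad( * )$$ (ii) Suppose that for some constants $0<M_0,M_1<\infty$, for all $m\ge2$ and uniformly for $u\in[0,1]$, $$\max_{1\le j\le d_n}\mathsf E[|Q_{i1}x_{ij}|^{m}\mid U_i=u]+\max_{1\le j,k\le d_n}\mathsf E[|Q_{i2}x_{ij}x_{ik}|^{m}\mid U_i=u]\le\frac{M_0m!}{2}\quad\text{a.s.}$$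 and $$\max_{1\le j,k,l\le d_n}\mathsf E[|x_{ij}x_{ik}x_{il}M(X_i,U_i,y_i)|^{m}\mid U_i=u]<\frac{M_1m!}{2}\quad\text{a.s.},$$ that $d_n\propto\exp\{(nh)^{\tau_2}\}$ with $0\le\tau_2<1-\tau_3$, $0<\tau_3<1$, and that $h,\lambda_1,\lambda_2$ satisfy $h\propto n^{-\delta_1}$ with $0<\delta_1<1$, $s_{n2}h^2+\left(\frac{\log h^{-1}}{nh}\right)^{\tau_3/2}=o(\lambda_1)$, $\lambda_1\propto\lambda_2$ and $s_{n2}\lambda_1^2h^{-2}+s_{n2}^2\lambda_1=o(1)$. Then $( * )$ also holds.
   Context: Conventions: limits are as $n\to\infty$; $\alpha_n\propto\beta_n$ means $c_1\beta_n\le\alpha_n\le c_2\beta_n$ for all sufficiently large $n$, for some constants $0<c_1\le c_2<\infty$; $\|\mathbf u\|^2=\mathbf u^{\mathrm T}\mathbf u$; $\dot f,\ddot f$ denote first and second derivatives of a function $f$ of one variable. Model. $(U_i,X_i,y_i)$, $i=1,\ldots,n$, is an independent and identically distributed sample, where $X_i=(x_{i1},\ldots,x_{id_n})^{\mathrm T}$ is a vector of covariates whose dimension $d_n$ depends on $n$ with $d_n\to\infty$ (possibly larger than $n$), the index variable $U$ has support $[0,1]$, and $y$ is the response. With $m(U,X)=\mathsf E(y\mid U,X)$, the log conditional density (or log probability mass function) of $y$ given $(U,X)$ is $\ell(m(U,X),y)$ with $g(m(U,X))=\sum_{j=1}^{d_n}a_j(U)x_j$, where $\ell$ and the link $g$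 are known and the functional coefficients $a_j(\cdot)$ are unknown. There are integers $1\le s_{n1}<s_{n2}<d_n$ such that $a_j(\cdot)$ is non-constant for $1\le j\le s_{n1}$, $a_j(\cdot)\equiv c_j$ is a nonzero constant for $s_{n1}+1\le j\le s_{n2}$, and $a_j(\cdot)\equiv0$ for $s_{n2}+1\le j\le d_n$; $s_{n2}$ may diverge with $n$ but is much smaller than $n$ and $d_n$. Put $\mathbf a_{k0}=[a_1(U_k),\ldots,a_{d_n}(U_k)]^{\mathrm T}$ and $\mathbf b_{k0}=[\dot a_1(U_k),\ldots,\dot a_{d_n}(U_k)]^{\mathrm T}$. Derivatives of the log-likelihood. $q_1(s,y)=\partial\ell[g^{-1}(s),y]/\partial s$, $q_2(s,y)=\partial^2\ell[g^{-1}(s),y]/\partial s^2$, $Q_{i1}=q_1[\sum_{j=1}^{d_n}a_j(U_i)x_{ij},y_i]$, $Q_{i2}=q_2[\sum_{j=1}^{d_n}a_j(U_i)x_{ij},y_i]$. Preliminary estimator. With kernel $K$, bandwidth $h$, $K_h(\cdot)=h^{-1}K(\cdot/h)$, $\mathbf a_k=(\alpha_{1k},\ldots,\alpha_{d_nk})^{\mathrm T}$ and $\mathbf b_k=(\beta_{1k},\ldots,\beta_{d_nk})^{\mathrm T}$, let $$\mathcal L_{nk}(\mathbf a_k,\mathbf b_k)=\frac1n\sum_{i=1}^n\ell\Big(g^{-1}\Big\{\sum_{j=1}^{d_n}[\alpha_{jk}+\beta_{jk}(U_i-U_k)]x_{ij}\Big\},y_i\Big)K_h(U_i-U_k),$$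 $$\mathcal Q_{nk}(\mathbf a_k,\mathbf b_k)=\mathcal L_{nk}(\mathbf a_k,\mathbf b_k)-\lambda_1\sum_{j=1}^{d_n}|\alpha_{jk}|-\lambda_2\sum_{j=1}^{d_n}h|\beta_{jk}|,$$ where $\lambda_1,\lambda_2$ are tuning parameters. $(\widetilde{\mathbf a}_k,\widetilde{\mathbf b}_k)$ denotes the maximiser of $\mathcal Q_{nk}(\cdot,\cdot)$. Objects in the restricted eigenvalue condition. $\ddot{\mathcal L}_n(u)$ is the $2d_n\times2d_n$ matrix $$\ddot{\mathcal L}_n(u)=\begin{pmatrix}\ddot{\mathcal L}_n(u,0)&\ddot{\mathcal L}_n(u,1)\\ \ddot{\mathcal L}_n(u,1)&\ddot{\mathcal L}_n(u,2)\end{pmatrix},\qquad \ddot{\mathcal L}_n(u,l)=\frac1n\sum_{i=1}^nq_2\Big[\sum_{j=1}^{d_n}a_j(U_i)x_{ij},y_i\Big]X_iX_i^{\mathrm T}\Big(\frac{U_i-u}{h}\Big)^lK_h(U_i-u).$$ $b=\max\{\lambda_1/\lambda_2,\lambda_2/\lambda_1\}+\delta$ for any $\delta>0$, and $$\boldsymbol\Omega_0(b)=\Big\{\mathbf v=(v_{11},\ldots,v_{1d_n},v_{21},\ldots,v_{2d_n})^{\mathrm T}:\|\mathbf v\|=1,\ \sum_{j=1}^{d_n}(|v_{1j}|+|v_{2j}|)\le2(1+b)\sum_{j=1}^{s_{n2}}(|v_{1j}|+|v_{2j}|)\Big\}.$$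
   Formalization: Coefficients may vary with n, so (4) is taken uniformly: second derivatives of all a_j are bounded by one constant over n, j and u (otherwise a_1(u)=C_n u^2 with C_n large gives bias C_n h^2 and refutes the rate); moment bounds in (i) are likewise uniform in n. *)

theory Defs
  imports "HOL-Probability.Probability" "HOL-Library.Landau_Symbols"
begin

text \<open>
  Vectors of length \<open>d\<close> are functions on \<open>nat\<close> of which only the values at \<open>1, \<dots>, d\<close> matter, since
  the dimension varies with the sample size.  A vector of length \<open>2d\<close>, written
  \<open>(v\<^sub>1\<^sub>1, \<dots>, v\<^sub>1\<^sub>d, v\<^sub>2\<^sub>1, \<dots>, v\<^sub>2\<^sub>d)\<close>, is a function \<open>v\<close> with \<open>v r j\<close> for \<open>r \<in> {1, 2}\<close>, \<open>1 \<le> j \<le> d\<close>.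
  The Euclidean norm is \<open>L2_set\<close> over the index set.
\<close>

definition propto :: "(nat \<Rightarrow> real) \<Rightarrow> (nat \<Rightarrow> real) \<Rightarrow> bool" where
  "propto \<alpha> \<beta> \<longleftrightarrow>
     (\<exists>c1 c2. 0 < c1 \<and> c1 \<le> c2 \<and>
        (\<forall>\<^sub>F n in sequentially. c1 * \<beta> n \<le> \<alpha> n \<and> \<alpha> n \<le> c2 * \<beta> n))"

text \<open>\<open>Z\<^sub>n = O\<^sub>P(r\<^sub>n)\<close>, where \<open>Z\<^sub>n\<close> is a random variable on the probability space \<open>M n\<close>.\<close>

definition bigO_P :: "(nat \<Rightarrow> 'a measure) \<Rightarrow> (nat \<Rightarrow> 'a \<Rightarrow> real) \<Rightarrow> (nat \<Rightarrow> real) \<Rightarrow> bool" where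
  "bigO_P M Z r \<longleftrightarrow>
     (\<forall>\<epsilon>>0. \<exists>C>0. \<forall>\<^sub>F n in sequentially.
        measure (M n) {\<omega> \<in> space (M n). \<bar>Z n \<omega>\<bar> > C * r n} \<le> \<epsilon>)"

definition C2_unit_interval ::
  "(real \<Rightarrow> real) \<Rightarrow> (real \<Rightarrow> real) \<Rightarrow> (real \<Rightarrow> real) \<Rightarrow> bool" where
  "C2_unit_interval f f' f'' \<longleftrightarrow>
     (\<forall>u\<in>{0..1}. (f has_real_derivative f' u) (at u within {0..1})) \<and>
     (\<forall>u\<in>{0..1}. (f' has_real_derivative f'' u) (at u within {0..1})) \<and>
     continuous_on {0..1} f''"

definition cov_space :: "nat \<Rightarrow> (real \<times> (nat \<Rightarrow> real)) measure" where
  "cov_space d = borel \<Otimes>\<^sub>M (\<Pi>\<^sub>M j\<in>{1..d}. borel)"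

definition obs_space :: "nat \<Rightarrow> (real \<times> (nat \<Rightarrow> real) \<times> real) measure" where
  "obs_space d = borel \<Otimes>\<^sub>M ((\<Pi>\<^sub>M j\<in>{1..d}. borel) \<Otimes>\<^sub>M borel)"

definition cond_exp :: "'a measure \<Rightarrow> 'b measure \<Rightarrow> ('a \<Rightarrow> 'b) \<Rightarrow> ('a \<Rightarrow> real) \<Rightarrow> 'a \<Rightarrow> real" where
  "cond_exp P N V Z = real_cond_exp P (vimage_algebra (space P) V N) Z"

text \<open>
  Conditional expectation of a nonnegative variable, which may be infinite.  A bound on it holding
  almost surely with a constant is the bound on \<open>E(Z | V = u)\<close> uniformly in (almost every) \<open>u\<close>.
\<close>

definition nn_cond_exp_given ::
  "'a measure \<Rightarrow> 'b measure \<Rightarrow> ('a \<Rightarrow> 'b) \<Rightarrow> ('a \<Rightarrow> real) \<Rightarrow> 'a \<Rightarrow> ennreal" where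
  "nn_cond_exp_given P N V Z =
     nn_cond_exp P (vimage_algebra (space P) V N) (\<lambda>\<omega>. ennreal (Z \<omega>))"

definition lin_pred :: "nat \<Rightarrow> (nat \<Rightarrow> real \<Rightarrow> real) \<Rightarrow> real \<Rightarrow> (nat \<Rightarrow> real) \<Rightarrow> real" where
  "lin_pred d a u x = (\<Sum>j=1..d. a j u * x j)"

text \<open>In the following, \<open>ginv\<close> stands for the inverse of the link function.\<close>

definition q1 :: "(real \<Rightarrow> real \<Rightarrow> real) \<Rightarrow> (real \<Rightarrow> real) \<Rightarrow> real \<Rightarrow> real \<Rightarrow> real" where
  "q1 ell ginv s y = deriv (\<lambda>t. ell (ginv t) y) s"

definition q2 :: "(real \<Rightarrow> real \<Rightarrow> real) \<Rightarrow> (real \<Rightarrow> real) \<Rightarrow> real \<Rightarrow> real \<Rightarrow> real" where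
  "q2 ell ginv s y = deriv (\<lambda>t. q1 ell ginv t y) s"

definition kern :: "(real \<Rightarrow> real) \<Rightarrow> real \<Rightarrow> real \<Rightarrow> real" where
  "kern K h t = inverse h * K (t / h)"

text \<open>
  Below, \<open>U i\<close>, \<open>X i j\<close>, \<open>y i\<close> are the observed values for \<open>1 \<le> i \<le> n\<close>, \<open>1 \<le> j \<le> d\<close>.
\<close>

definition local_loglik ::
  "(real \<Rightarrow> real \<Rightarrow> real) \<Rightarrow> (real \<Rightarrow> real) \<Rightarrow> (real \<Rightarrow> real) \<Rightarrow> real \<Rightarrow> nat \<Rightarrow> nat \<Rightarrow>
   (nat \<Rightarrow> real) \<Rightarrow> (nat \<Rightarrow> nat \<Rightarrow> real) \<Rightarrow> (nat \<Rightarrow> real) \<Rightarrow> nat \<Rightarrow>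
   (nat \<Rightarrow> real) \<Rightarrow> (nat \<Rightarrow> real) \<Rightarrow> real" where
  "local_loglik ell ginv K h n d U X y k \<alpha> \<beta> =
     (1 / real n) * (\<Sum>i=1..n.
        ell (ginv (\<Sum>j=1..d. (\<alpha> j + \<beta> j * (U i - U k)) * X i j)) (y i) * kern K h (U i - U k))"

definition penalised_loglik ::
  "(real \<Rightarrow> real \<Rightarrow> real) \<Rightarrow> (real \<Rightarrow> real) \<Rightarrow> (real \<Rightarrow> real) \<Rightarrow> real \<Rightarrow> real \<Rightarrow> real \<Rightarrow> nat \<Rightarrow> nat \<Rightarrow>
   (nat \<Rightarrow> real) \<Rightarrow> (nat \<Rightarrow> nat \<Rightarrow> real) \<Rightarrow> (nat \<Rightarrow> real) \<Rightarrow> nat \<Rightarrow>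
   (nat \<Rightarrow> real) \<Rightarrow> (nat \<Rightarrow> real) \<Rightarrow> real" where
  "penalised_loglik ell ginv K h lam1 lam2 n d U X y k \<alpha> \<beta> =
     local_loglik ell ginv K h n d U X y k \<alpha> \<beta>
       - lam1 * (\<Sum>j=1..d. \<bar>\<alpha> j\<bar>) - lam2 * (\<Sum>j=1..d. h * \<bar>\<beta> j\<bar>)"

text \<open>Here \<open>Q2 i\<close> is \<open>q\<^sub>2\<close> evaluated at the true linear predictor and response of observation \<open>i\<close>.\<close>

definition hess_entry ::
  "(real \<Rightarrow> real) \<Rightarrow> real \<Rightarrow> nat \<Rightarrow> (nat \<Rightarrow> real) \<Rightarrow> (nat \<Rightarrow> nat \<Rightarrow> real) \<Rightarrow> (nat \<Rightarrow> real) \<Rightarrow>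
   real \<Rightarrow> nat \<Rightarrow> nat \<Rightarrow> nat \<Rightarrow> real" where
  "hess_entry K h n U X Q2 u l j k =
     (1 / real n) * (\<Sum>i=1..n. Q2 i * (X i j * X i k) * ((U i - u) / h) ^ l * kern K h (U i - u))"

text \<open>
  The quadratic form of minus the \<open>2 \<times> 2\<close> block matrix whose block \<open>(r, c)\<close>, \<open>r, c \<in> {1, 2}\<close>, is
  the \<open>d \<times> d\<close> matrix with superscript \<open>l = r + c - 2\<close>.
\<close>

definition neg_hess_form ::
  "(real \<Rightarrow> real) \<Rightarrow> real \<Rightarrow> nat \<Rightarrow> nat \<Rightarrow> (nat \<Rightarrow> real) \<Rightarrow> (nat \<Rightarrow> nat \<Rightarrow> real) \<Rightarrow> (nat \<Rightarrow> real) \<Rightarrow>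
   real \<Rightarrow> (nat \<Rightarrow> nat \<Rightarrow> real) \<Rightarrow> real" where
  "neg_hess_form K h n d U X Q2 u v =
     (\<Sum>r\<in>{1,2}. \<Sum>c\<in>{1,2}. \<Sum>j=1..d. \<Sum>k=1..d.
        v r j * (- hess_entry K h n U X Q2 u (r + c - 2) j k) * v c k)"

definition Omega0 :: "nat \<Rightarrow> nat \<Rightarrow> real \<Rightarrow> (nat \<Rightarrow> nat \<Rightarrow> real) set" where
  "Omega0 d s b =
     {v. L2_set (\<lambda>(r, j). v r j) ({1,2} \<times> {1..d}) = 1 \<and>
         (\<Sum>j=1..d. \<bar>v 1 j\<bar> + \<bar>v 2 j\<bar>) \<le> 2 * (1 + b) * (\<Sum>j=1..s. \<bar>v 1 j\<bar> + \<bar>v 2 j\<bar>)}"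

end

theory Submission
  imports Defs "HOL-Real_Asymp.Real_Asymp"
begin

text \<open>
  Write \<open>\<theta>\<close> for the coefficients \<open>(a\<^sub>k, h b\<^sub>k)\<close> at the centre \<open>U\<^sub>k\<close> and \<open>\<Delta>\<close> for the estimation error.
  The local likelihood is concave, so once the score at \<open>\<theta>\<close> is at most half the smaller tuning
  parameter in sup norm, comparing the penalised likelihood at \<open>\<theta> + \<Delta>\<close> and at \<open>\<theta>\<close> forces \<open>\<Delta>\<close> into the
  cone of the restricted eigenvalue condition. Concavity also lets \<open>\<Delta>\<close> be shrunk to norm \<open>R\<close>, a large
  multiple of \<open>sqrt s \<lambda>\<^sub>1\<close>; there the quadratic term beats both the penalty and the cubic remainder of
  the Taylor expansion, a contradiction.

  The score splits into a centred kernel sum and the smoothing bias. All the kernel sums have the form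
  \<open>\<Sum>\<^sub>i Z\<^sub>i w((U\<^sub>i - U\<^sub>k) / h)\<close>, and since the observations other than the \<open>k\<close>-th are independent of \<open>U\<^sub>k\<close>,
  Fubini reduces their exponential moments to those at a fixed centre. The latter are bounded by
  Bernstein's series in case (ii), and after truncation in case (i); a union bound over centres and
  coordinates then gives uniform control.
\<close>

section \<open>Exponential bounds for kernel sums at random centres\<close>

text \<open>Only the n centres U_k matter, so no covering of [0,1] is involved; the price is that
  each centre is itself one of the observations, and its own summand has to be paid for separately.
  The curvature and third-order sums are never compared with their means: the lower curvature bound
  is a hypothesis, and elsewhere it is enough that these sums stay of order n h. Only the score must
  be small compared with \<lambda>1, and only there is the conditional mean zero used. Truncation
  destroys this centring; the mean of the cut-off part is of order G^(1 - m0), and the bandwidth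
  condition makes it o(\<lambda>1). The powers of s come from the l1 geometry of the cone. An error
  of norm R of order sqrt s \<lambda>1 has l1 norm of order sqrt s R, so the cubic remainder divided
  by R^2 is of order s sqrt s R, that is s^2 \<lambda>1, while the smoothing bias adds a term of
  order s h^2 to the score.\<close>

lemma (in prob_space) nn_integral_indep_prod_le:
  fixes Z :: "'i \<Rightarrow> 'a \<Rightarrow> 'b" and G :: "'b \<Rightarrow> real \<Rightarrow> ennreal"
  assumes I: "finite I" "k \<in> I" and ind: "indep_vars (\<lambda>_. N) Z I"
    and G: "(\<lambda>(z, u). G z u) \<in> borel_measurable (N \<Otimes>\<^sub>M borel)"
    and V: "V \<in> borel_measurable N"
    and B: "\<And>i u. i \<in> I \<Longrightarrow> (\<integral>\<^sup>+\<omega>. G (Z i \<omega>) u \<partial>M) \<le> B"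
    and C: "(\<integral>\<^sup>+\<omega>. G (Z k \<omega>) (V (Z k \<omega>)) \<partial>M) \<le> C"
  shows "(\<integral>\<^sup>+\<omega>. (\<Prod>i\<in>I. G (Z i \<omega>) (V (Z k \<omega>))) \<partial>M) \<le> C * B ^ (card I - 1)"
proof -
  \<comment> \<open>All observations other than the \<open>k\<close>-th. Given \<open>Z k\<close>,
    the centre \<open>V (Z k)\<close> is a constant for them, so their factors are independent with
    integrals at most \<open>B\<close>. In the \<open>k\<close>-th factor argument and centre come
    from the same observation and the bound at fixed \<open>u\<close> does not apply; this factor is
    paid by \<open>C\<close>.\<close>
  define L where "L = I - {k}"
  have fL: "finite L" "k \<notin> L" "L \<subseteq> I" and cL: "card L = card I - 1"
    using I by (auto simp: L_def)
  have Zm: "Z i \<in> measurable M N" if "i \<in> I" for i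
    using ind that by (auto simp: indep_vars_def)
  note Zk[measurable] = Zm[OF I(2)]
  define Y where "Y = (\<lambda>\<omega>. restrict (\<lambda>i. Z i \<omega>) L)"
  have Ym[measurable]: "Y \<in> measurable M (PiM L (\<lambda>_. N))"
    unfolding Y_def using fL(3) Zm by (intro measurable_restrict) auto
  \<comment> \<open>Independence of blocks is formulated for restrictions to disjoint index sets, so
    the single variable \<open>Z k\<close> is carried as a function on \<open>{k}\<close>.\<close>
  define X where "X = (\<lambda>\<omega>. restrict (\<lambda>i. Z i \<omega>) {k})"
  have Xm[measurable]: "X \<in> measurable M (PiM {k} (\<lambda>_. N))"
    unfolding X_def using I Zm by (intro measurable_restrict) auto
  have "indep_var (PiM {k} (\<lambda>_. N)) X (PiM L (\<lambda>_. N)) Y"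
    unfolding X_def Y_def by (rule indep_var_restrict[OF ind]) (use fL I in auto)
  then have dist: "distr M (PiM {k} (\<lambda>_. N)) X \<Otimes>\<^sub>M distr M (PiM L (\<lambda>_. N)) Y
      = distr M (PiM {k} (\<lambda>_. N) \<Otimes>\<^sub>M PiM L (\<lambda>_. N)) (\<lambda>\<omega>. (X \<omega>, Y \<omega>))"
    by (simp add: indep_var_distribution_eq)
  interpret D: prob_space "distr M (PiM L (\<lambda>_. N)) Y" by (rule prob_space_distr) simp
  have Gm: "(\<lambda>x. G (f x) (g x)) \<in> borel_measurable A"
    if "f \<in> measurable A N" "g \<in> borel_measurable A" for f g and A :: "'a measure"
  proof -
    have "(\<lambda>x. (f x, g x)) \<in> measurable A (N \<Otimes>\<^sub>M borel)"
      using that by measurable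
    from measurable_compose[OF this G] show ?thesis by simp
  qed
  have Gu: "(\<lambda>x. G x u) \<in> borel_measurable N" for u
  proof -
    have "(\<lambda>x. (x, u)) \<in> measurable N (N \<Otimes>\<^sub>M borel)" by measurable
    from measurable_compose[OF this G] show ?thesis by simp
  qed
  define S where "S = PiM {k} (\<lambda>_. N) \<Otimes>\<^sub>M PiM L (\<lambda>_. N)"
  define H where "H = (\<lambda>(z, y). G (z k) (V (z k)) * (\<Prod>i\<in>L. G (y i) (V (z k))))"
  have c1: "(\<lambda>p. snd p i) \<in> measurable S N" if "i \<in> L" for i
    unfolding S_def using that by measurable
  have c0: "(\<lambda>p. fst p k) \<in> measurable S N" unfolding S_def by measurable
  have c2: "(\<lambda>p. V (fst p k)) \<in> borel_measurable S"
    by (rule measurable_compose[OF c0 V])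
  have Gm': "(\<lambda>x. G (f x) (g x)) \<in> borel_measurable S"
    if "f \<in> measurable S N" "g \<in> borel_measurable S" for f g
  proof -
    have "(\<lambda>x. (f x, g x)) \<in> measurable S (N \<Otimes>\<^sub>M borel)"
      using that by measurable
    from measurable_compose[OF this G] show ?thesis by simp
  qed
  have Hm: "H \<in> borel_measurable S"
    unfolding H_def case_prod_beta
    by (intro borel_measurable_times_ennreal borel_measurable_prod_ennreal Gm' c0 c1 c2)
  have Hm1: "(\<lambda>y. H (z, y)) \<in> borel_measurable (PiM L (\<lambda>_. N))" if "z \<in> space (PiM {k} (\<lambda>_. N))" for z
    using measurable_Pair2[OF Hm[unfolded S_def] that] .
  have Gk: "(\<lambda>z. G (z k) (V (z k))) \<in> borel_measurable (PiM {k} (\<lambda>_. N))"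
  proof -
    have "(\<lambda>z. z k) \<in> measurable (PiM {k} (\<lambda>_. N)) N" by measurable
    then have "(\<lambda>x. (x k, V (x k))) \<in> measurable (PiM {k} (\<lambda>_. N)) (N \<Otimes>\<^sub>M borel)"
      using V by measurable
    from measurable_compose[OF this G] show ?thesis by simp
  qed
  define W where "W z = G (z k) (V (z k)) * B ^ card L" for z
  have inner: "(\<integral>\<^sup>+y. H (z, y) \<partial>distr M (PiM L (\<lambda>_. N)) Y) \<le> W z"
    if "z \<in> space (PiM {k} (\<lambda>_. N))" for z
  proof -
    have "(\<integral>\<^sup>+y. H (z, y) \<partial>distr M (PiM L (\<lambda>_. N)) Y) = (\<integral>\<^sup>+\<omega>. H (z, Y \<omega>) \<partial>M)"
      by (rule nn_integral_distr) (use Hm1 that in auto)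
    also have "\<dots> = (\<integral>\<^sup>+\<omega>. G (z k) (V (z k)) * (\<Prod>i\<in>L. G (Z i \<omega>) (V (z k))) \<partial>M)"
      unfolding H_def Y_def by (auto intro!: nn_integral_cong)
    also have "\<dots> = G (z k) (V (z k)) * (\<integral>\<^sup>+\<omega>. (\<Prod>i\<in>L. G (Z i \<omega>) (V (z k))) \<partial>M)"
      by (intro nn_integral_cmult borel_measurable_prod_ennreal measurable_compose[OF Zm Gu]) (use fL in auto)
    also have "(\<integral>\<^sup>+\<omega>. (\<Prod>i\<in>L. G (Z i \<omega>) (V (z k))) \<partial>M) = (\<Prod>i\<in>L. \<integral>\<^sup>+\<omega>. G (Z i \<omega>) (V (z k)) \<partial>M)"
    proof (rule indep_vars_nn_integral[OF fL(1)])
      have "indep_vars (\<lambda>_. N) Z L" by (rule indep_vars_subset[OF ind fL(3)])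
      then show "indep_vars (\<lambda>_. borel) (\<lambda>i \<omega>. G (Z i \<omega>) (V (z k))) L"
        by (rule indep_vars_compose2[where Y="\<lambda>_ x. G x (V (z k))"]) (rule Gu)
    qed simp
    also have "\<dots> \<le> (\<Prod>i\<in>L. B)" by (rule prod_mono_ennreal) (use fL B in auto)
    also have "\<dots> = B ^ card L" by simp
    finally show ?thesis by (auto simp: W_def mult_left_mono)
  qed
  have "(\<integral>\<^sup>+\<omega>. (\<Prod>i\<in>I. G (Z i \<omega>) (V (Z k \<omega>))) \<partial>M) = (\<integral>\<^sup>+\<omega>. H (X \<omega>, Y \<omega>) \<partial>M)"
  proof (rule nn_integral_cong)
    fix \<omega>
    have "(\<Prod>i\<in>I. G (Z i \<omega>) (V (Z k \<omega>))) = G (Z k \<omega>) (V (Z k \<omega>)) * (\<Prod>i\<in>L. G (Z i \<omega>) (V (Z k \<omega>)))"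
      unfolding L_def using I by (rule prod.remove)
    then show "(\<Prod>i\<in>I. G (Z i \<omega>) (V (Z k \<omega>))) = H (X \<omega>, Y \<omega>)"
      by (simp add: H_def X_def Y_def)
  qed
  \<comment> \<open>Independence makes the joint law of the two blocks a product, so
    \<open>Y\<close> may be integrated out at a frozen value of \<open>X\<close>.\<close>
  also have "\<dots> = (\<integral>\<^sup>+p. H p \<partial>(distr M (PiM {k} (\<lambda>_. N)) X \<Otimes>\<^sub>M distr M (PiM L (\<lambda>_. N)) Y))"
    unfolding dist using Hm unfolding S_def by (subst nn_integral_distr) auto
  also have "\<dots> = (\<integral>\<^sup>+z. \<integral>\<^sup>+y. H (z, y) \<partial>distr M (PiM L (\<lambda>_. N)) Y \<partial>distr M (PiM {k} (\<lambda>_. N)) X)"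
    by (rule D.nn_integral_fst[symmetric]) (use Hm in \<open>simp add: S_def cong: measurable_cong_sets\<close>)
  also have "\<dots> \<le> (\<integral>\<^sup>+z. W z \<partial>distr M (PiM {k} (\<lambda>_. N)) X)"
    by (rule nn_integral_mono) (use inner in auto)
  also have "\<dots> = (\<integral>\<^sup>+\<omega>. W (X \<omega>) \<partial>M)"
    by (rule nn_integral_distr) (use Gk in \<open>auto simp: W_def\<close>)
  also have "\<dots> = (\<integral>\<^sup>+\<omega>. G (Z k \<omega>) (V (Z k \<omega>)) * B ^ card L \<partial>M)"
    by (simp add: W_def X_def)
  also have "\<dots> = (\<integral>\<^sup>+\<omega>. G (Z k \<omega>) (V (Z k \<omega>)) \<partial>M) * B ^ card L"
    by (rule nn_integral_multc) (use V in \<open>auto intro!: Gm\<close>)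
  also have "\<dots> \<le> C * B ^ card L" using C by (rule mult_right_mono) simp
  finally show ?thesis by (simp add: cL)
qed

text \<open>Markov's inequality for the exponential of the sum. The summand belonging to the centre
  costs the factor \<open>C\<close> in place of \<open>exp b\<close>, because there the centre is
  not independent of the observation.\<close>

lemma (in prob_space) chernoff_indep_sum:
  fixes Z :: "'i \<Rightarrow> 'a \<Rightarrow> 'b" and \<phi> :: "'b \<Rightarrow> real \<Rightarrow> real" and b s C :: real
  assumes I: "finite I" "k \<in> I" and ind: "indep_vars (\<lambda>_. N) Z I"
    and \<phi>: "(\<lambda>(z, u). \<phi> z u) \<in> borel_measurable (N \<Otimes>\<^sub>M borel)"
    and V: "V \<in> borel_measurable N"
    and B: "\<And>i u. i \<in> I \<Longrightarrow> (\<integral>\<^sup>+\<omega>. ennreal (exp (\<phi> (Z i \<omega>) u)) \<partial>M) \<le> ennreal (exp b)"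
    and C: "(\<integral>\<^sup>+\<omega>. ennreal (exp (\<phi> (Z k \<omega>) (V (Z k \<omega>)))) \<partial>M) \<le> ennreal C"
    and b: "0 \<le> b" and C0: "0 \<le> C"
  shows "measure M {\<omega> \<in> space M. s < (\<Sum>i\<in>I. \<phi> (Z i \<omega>) (V (Z k \<omega>)))} \<le> C * exp (card I * b - s)"
proof -
  define S where "S \<omega> = (\<Sum>i\<in>I. \<phi> (Z i \<omega>) (V (Z k \<omega>)))" for \<omega>
  have Zm[measurable]: "Z i \<in> measurable M N" if "i \<in> I" for i
    using ind that by (auto simp: indep_vars_def)
  have "(\<lambda>\<omega>. \<phi> (Z i \<omega>) (V (Z k \<omega>))) \<in> borel_measurable M" if "i \<in> I" for i
  proof -
    have "(\<lambda>x. (Z i x, V (Z k x))) \<in> measurable M (N \<Otimes>\<^sub>M borel)"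
      using Zm[OF that] measurable_compose[OF Zm[OF I(2)] V] by measurable
    from measurable_compose[OF this \<phi>] show ?thesis by simp
  qed
  then have Sm[measurable]: "S \<in> borel_measurable M"
    unfolding S_def by (intro borel_measurable_sum)
  define E where "E = {\<omega> \<in> space M. s < S \<omega>}"
  have Em[measurable]: "E \<in> sets M" unfolding E_def by measurable
  have "emeasure M E = (\<integral>\<^sup>+\<omega>. indicator E \<omega> \<partial>M)" by simp
  also have "\<dots> \<le> (\<integral>\<^sup>+\<omega>. ennreal (exp (- s)) * (\<Prod>i\<in>I. ennreal (exp (\<phi> (Z i \<omega>) (V (Z k \<omega>))))) \<partial>M)"
  proof (rule nn_integral_mono)
    fix \<omega>
    have "ennreal (exp (- s)) * (\<Prod>i\<in>I. ennreal (exp (\<phi> (Z i \<omega>) (V (Z k \<omega>))))) = ennreal (exp (- s + S \<omega>))"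
      unfolding S_def exp_add exp_sum[OF I(1)] by (simp add: prod_ennreal ennreal_mult prod_nonneg)
    moreover have "indicator E \<omega> \<le> ennreal (exp (- s + S \<omega>))"
      by (auto simp: E_def indicator_def)
    ultimately show "indicator E \<omega> \<le> ennreal (exp (- s)) * (\<Prod>i\<in>I. ennreal (exp (\<phi> (Z i \<omega>) (V (Z k \<omega>)))))"
      by simp
  qed
  also have "\<dots> = ennreal (exp (- s)) * (\<integral>\<^sup>+\<omega>. (\<Prod>i\<in>I. ennreal (exp (\<phi> (Z i \<omega>) (V (Z k \<omega>))))) \<partial>M)"
  proof (rule nn_integral_cmult)
    have "(\<lambda>\<omega>. ennreal (exp (S \<omega>))) \<in> borel_measurable M" by measurable
    then show "(\<lambda>\<omega>. \<Prod>i\<in>I. ennreal (exp (\<phi> (Z i \<omega>) (V (Z k \<omega>))))) \<in> borel_measurable M"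
      unfolding S_def exp_sum[OF I(1)] by (simp add: prod_ennreal)
  qed
  also have "\<dots> \<le> ennreal (exp (- s)) * (ennreal C * ennreal (exp b) ^ (card I - 1))"
  proof (rule mult_left_mono, rule nn_integral_indep_prod_le[OF I ind _ V B C])
    show "(\<lambda>(z, u). ennreal (exp (\<phi> z u))) \<in> borel_measurable (N \<Otimes>\<^sub>M borel)"
      using \<phi> unfolding case_prod_beta by measurable
  qed auto
  also have "\<dots> = ennreal (C * exp (real (card I - 1) * b - s))"
    using C0 by (simp add: ennreal_power ennreal_mult[symmetric] exp_of_nat_mult[symmetric] exp_diff exp_minus field_simps)
  \<comment> \<open>Replacing \<open>card I - 1\<close> by \<open>card I\<close> is harmless because
    \<open>b\<close> is nonnegative.\<close>
  also have "\<dots> \<le> ennreal (C * exp (card I * b - s))"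
    using b C0 by (intro ennreal_leI mult_left_mono) (auto intro!: mult_right_mono)
  finally show ?thesis
    using C0 by (simp add: E_def S_def emeasure_eq_measure)
qed

section \<open>Moment generating functions under boundedness and under factorial moments\<close>

lemma exp_le_quadratic:
  fixes x :: real
  assumes "\<bar>x\<bar> \<le> 1"
  shows "exp x \<le> 1 + x + x\<^sup>2"
proof (cases "0 \<le> x")
  case True
  then show ?thesis using assms exp_bound[of x] by auto
next
  case False
  \<comment> \<open>For negative \<open>x\<close> it suffices to multiply by exp (- x), which is at
    least its quadratic Taylor polynomial; the excess of the product over 1 is x^2 / 2 (1 - x +
    x^2).\<close>
  have "1 \<le> (1 + (- x) + (- x)\<^sup>2 / 2) * (1 + x + x\<^sup>2)"
  proof -
    have "(1 + (- x) + (- x)\<^sup>2 / 2) * (1 + x + x\<^sup>2) = 1 + x\<^sup>2 / 2 * (1 - x + x\<^sup>2)"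
      by (simp add: power2_eq_square field_simps)
    moreover have "0 \<le> x\<^sup>2 / 2 * (1 - x + x\<^sup>2)"
      using False by (intro mult_nonneg_nonneg) auto
    ultimately show ?thesis by simp
  qed
  also have "\<dots> \<le> exp (- x) * (1 + x + x\<^sup>2)"
  proof (rule mult_right_mono)
    show "1 + - x + (- x)\<^sup>2 / 2 \<le> exp (- x)"
      using exp_lower_Taylor_quadratic[of "-x"] False by simp
    show "0 \<le> 1 + x + x\<^sup>2" using assms by auto
  qed
  finally have "exp x * 1 \<le> exp x * (exp (- x) * (1 + x + x\<^sup>2))"
    by (intro mult_left_mono) auto
  also have "\<dots> = 1 + x + x\<^sup>2"
    by (simp add: exp_minus field_simps)
  finally show ?thesis by simp
qed

text \<open>The bound on \<open>\<tau> * c\<close> keeps the exponent in the range where the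
  quadratic bound for exp is valid. The mean stays a separate term because truncated variables are
  no longer centred.\<close>

lemma (in prob_space) mgf_le_of_bounded:
  fixes Y :: "'a \<Rightarrow> real"
  assumes Y[measurable]: "Y \<in> borel_measurable M" and c: "\<And>\<omega>. \<omega> \<in> space M \<Longrightarrow> \<bar>Y \<omega>\<bar> \<le> c"
    and \<tau>: "0 \<le> \<tau>" "\<tau> * c \<le> 1"
    and v: "(\<integral>\<^sup>+\<omega>. ennreal ((Y \<omega>)\<^sup>2) \<partial>M) \<le> ennreal v" "0 \<le> v" and m: "\<bar>expectation Y\<bar> \<le> m"
  shows "(\<integral>\<^sup>+\<omega>. ennreal (exp (\<tau> * Y \<omega>)) \<partial>M) \<le> ennreal (exp (\<tau>\<^sup>2 * v + \<tau> * m))"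
proof -
  have iY: "integrable M Y"
    by (rule integrable_const_bound[where B=c]) (use c in auto)
  have iY2: "integrable M (\<lambda>\<omega>. (Y \<omega>)\<^sup>2)"
    by (rule integrable_const_bound[where B="c\<^sup>2"])
      (use c in \<open>auto intro!: AE_I2 simp: abs_le_square_iff[symmetric] intro: order_trans[OF _ abs_ge_self]\<close>)
  have v': "expectation (\<lambda>\<omega>. (Y \<omega>)\<^sup>2) \<le> v"
    using v by (subst (asm) nn_integral_eq_integral[OF iY2]) auto
  have le: "exp (\<tau> * Y \<omega>) \<le> 1 + \<tau> * Y \<omega> + \<tau>\<^sup>2 * (Y \<omega>)\<^sup>2" if "\<omega> \<in> space M" for \<omega>
  proof -
    have "\<tau> * \<bar>Y \<omega>\<bar> \<le> \<tau> * c" using c[OF that] \<tau> by (intro mult_left_mono) auto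
    then have "\<bar>\<tau> * Y \<omega>\<bar> \<le> 1" using \<tau> by (simp add: abs_mult)
    from exp_le_quadratic[OF this] show ?thesis by (simp add: power_mult_distrib)
  qed
  have "(\<integral>\<^sup>+\<omega>. ennreal (exp (\<tau> * Y \<omega>)) \<partial>M) \<le> (\<integral>\<^sup>+\<omega>. ennreal (1 + \<tau> * Y \<omega> + \<tau>\<^sup>2 * (Y \<omega>)\<^sup>2) \<partial>M)"
    by (intro nn_integral_mono ennreal_leI le)
  also have "\<dots> = ennreal (expectation (\<lambda>\<omega>. 1 + \<tau> * Y \<omega> + \<tau>\<^sup>2 * (Y \<omega>)\<^sup>2))"
  proof (rule nn_integral_eq_integral)
    show "AE \<omega> in M. 0 \<le> 1 + \<tau> * Y \<omega> + \<tau>\<^sup>2 * (Y \<omega>)\<^sup>2"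
      using le by (intro AE_I2) (meson exp_ge_zero order_trans)
  qed (use iY iY2 in auto)
  also have "expectation (\<lambda>\<omega>. 1 + \<tau> * Y \<omega> + \<tau>\<^sup>2 * (Y \<omega>)\<^sup>2)
      = 1 + \<tau> * expectation Y + \<tau>\<^sup>2 * expectation (\<lambda>\<omega>. (Y \<omega>)\<^sup>2)"
    using iY iY2 by (simp add: prob_space)
  also have "\<dots> \<le> 1 + (\<tau>\<^sup>2 * v + \<tau> * m)"
  proof -
    have "\<tau> * expectation Y \<le> \<tau> * m" using m \<tau> by (intro mult_left_mono) auto
    moreover have "\<tau>\<^sup>2 * expectation (\<lambda>\<omega>. (Y \<omega>)\<^sup>2) \<le> \<tau>\<^sup>2 * v" using v' by (intro mult_left_mono) auto
    ultimately show ?thesis by simp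
  qed
  also have "\<dots> \<le> exp (\<tau>\<^sup>2 * v + \<tau> * m)" by (rule exp_ge_add_one_self)
  finally show ?thesis by (auto simp: ennreal_leI)
qed

text \<open>Expand exp and integrate termwise: the factorial in the moment bound cancels that of the
  series and leaves a geometric series of ratio \<tau> c \<le> 1/2. The linear term is kept apart,
  so that the signed mean enters and not the first absolute moment.\<close>

lemma (in prob_space) mgf_le_of_bernstein:
  fixes Y :: "'a \<Rightarrow> real"
  assumes Y[measurable]: "Y \<in> borel_measurable M"
    and v: "\<And>q. 2 \<le> q \<Longrightarrow> (\<integral>\<^sup>+\<omega>. ennreal (\<bar>Y \<omega>\<bar> ^ q) \<partial>M) \<le> ennreal (v / 2 * fact q * c ^ (q - 2))"
    and nonneg: "0 \<le> v" "0 \<le> c"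
    and \<tau>: "0 \<le> \<tau>" "\<tau> * c \<le> 1 / 2" and m: "\<bar>expectation Y\<bar> \<le> m"
  shows "(\<integral>\<^sup>+\<omega>. ennreal (exp (\<tau> * Y \<omega>)) \<partial>M) \<le> ennreal (exp (\<tau>\<^sup>2 * v + \<tau> * m))"
proof -
  \<comment> \<open>The exponential series from order two on, with absolute values: a nonnegative
    majorant, which may be integrated termwise before any integrability is known.\<close>
  define R where "R \<omega> = (\<Sum>q. (\<tau> * \<bar>Y \<omega>\<bar>) ^ (q + 2) / fact (q + 2))" for \<omega>
  have sm: "summable (\<lambda>q. x ^ (q + 2) / fact (q + 2))" for x :: real
    using summable_exp_generic[of x] by (subst summable_iff_shift) (simp add: field_simps)
  have R_eq: "R \<omega> = exp (\<tau> * \<bar>Y \<omega>\<bar>) - 1 - \<tau> * \<bar>Y \<omega>\<bar>" for \<omega>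
    unfolding R_def exp_first_two_terms by (simp add: field_simps add.commute)
  have Rm[measurable]: "R \<in> borel_measurable M" unfolding R_eq[abs_def] by measurable
  have R0: "0 \<le> R \<omega>" for \<omega>
    unfolding R_def using \<tau> by (intro suminf_nonneg sm) auto
  have le: "exp (\<tau> * Y \<omega>) \<le> 1 + \<tau> * Y \<omega> + R \<omega>" for \<omega>
  proof -
    have "exp (\<tau> * Y \<omega>) = 1 + \<tau> * Y \<omega> + (\<Sum>q. (\<tau> * Y \<omega>) ^ (q + 2) / fact (q + 2))"
      unfolding exp_first_two_terms by (simp add: field_simps add.commute)
    also have "(\<Sum>q. (\<tau> * Y \<omega>) ^ (q + 2) / fact (q + 2)) \<le> R \<omega>"
      unfolding R_def
    proof (intro suminf_le sm)
      fix q
      have "(\<tau> * Y \<omega>) ^ (q + 2) \<le> \<bar>(\<tau> * Y \<omega>) ^ (q + 2)\<bar>" by simp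
      also have "\<dots> = (\<tau> * \<bar>Y \<omega>\<bar>) ^ (q + 2)" using \<tau> by (simp add: power_abs abs_mult)
      finally show "(\<tau> * Y \<omega>) ^ (q + 2) / fact (q + 2) \<le> (\<tau> * \<bar>Y \<omega>\<bar>) ^ (q + 2) / fact (q + 2)"
        by (simp add: divide_right_mono)
    qed
    finally show ?thesis by simp
  qed
  have "(\<integral>\<^sup>+\<omega>. ennreal (R \<omega>) \<partial>M) = (\<integral>\<^sup>+\<omega>. (\<Sum>q. ennreal ((\<tau> * \<bar>Y \<omega>\<bar>) ^ (q + 2) / fact (q + 2))) \<partial>M)"
    unfolding R_def using \<tau> by (intro nn_integral_cong suminf_ennreal2[symmetric] sm) auto
  also have "\<dots> = (\<Sum>q. \<integral>\<^sup>+\<omega>. ennreal ((\<tau> * \<bar>Y \<omega>\<bar>) ^ (q + 2) / fact (q + 2)) \<partial>M)"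
    by (rule nn_integral_suminf) measurable
  also have "\<dots> \<le> (\<Sum>q. ennreal (v / 2 * \<tau>\<^sup>2 * (1 / 2) ^ q))"
  proof (rule suminf_le)
    fix q
    have "(\<integral>\<^sup>+\<omega>. ennreal ((\<tau> * \<bar>Y \<omega>\<bar>) ^ (q + 2) / fact (q + 2)) \<partial>M)
        = (\<integral>\<^sup>+\<omega>. ennreal (\<tau> ^ (q + 2) / fact (q + 2)) * ennreal (\<bar>Y \<omega>\<bar> ^ (q + 2)) \<partial>M)"
      using \<tau> by (intro nn_integral_cong) (simp add: ennreal_mult[symmetric] power_mult_distrib)
    also have "\<dots> = ennreal (\<tau> ^ (q + 2) / fact (q + 2)) * (\<integral>\<^sup>+\<omega>. ennreal (\<bar>Y \<omega>\<bar> ^ (q + 2)) \<partial>M)"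
      by (rule nn_integral_cmult) measurable
    also have "\<dots> \<le> ennreal (\<tau> ^ (q + 2) / fact (q + 2)) * ennreal (v / 2 * fact (q + 2) * c ^ q)"
      using v[of "q + 2"] by (intro mult_left_mono) auto
    also have "\<dots> = ennreal (v / 2 * \<tau>\<^sup>2 * (\<tau> * c) ^ q)"
      using \<tau> nonneg by (simp add: ennreal_mult[symmetric] power_mult_distrib power_add power2_eq_square field_simps del: fact_Suc add_2_eq_Suc')
    also have "\<dots> \<le> ennreal (v / 2 * \<tau>\<^sup>2 * (1 / 2) ^ q)"
      using \<tau> nonneg by (intro ennreal_leI mult_left_mono power_mono) auto
    finally show "(\<integral>\<^sup>+\<omega>. ennreal ((\<tau> * \<bar>Y \<omega>\<bar>) ^ (q + 2) / fact (q + 2)) \<partial>M) \<le> ennreal (v / 2 * \<tau>\<^sup>2 * (1 / 2) ^ q)" .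
  qed auto
  also have "\<dots> = ennreal (\<Sum>q. v / 2 * \<tau>\<^sup>2 * (1 / 2) ^ q)"
    using nonneg by (intro suminf_ennreal2) (auto intro!: summable_mult summable_geometric)
  \<comment> \<open>The geometric series sums to 2 and cancels the factor 1/2 in
    \<open>v / 2\<close>.\<close>
  also have "(\<Sum>q. v / 2 * \<tau>\<^sup>2 * (1 / 2) ^ q) = v * \<tau>\<^sup>2"
    by (subst suminf_mult) (auto simp: suminf_geometric)
  finally have R_int: "(\<integral>\<^sup>+\<omega>. ennreal (R \<omega>) \<partial>M) \<le> ennreal (v * \<tau>\<^sup>2)" .
  have iR: "integrable M R"
    by (rule integrableI_nonneg) (use R0 R_int in \<open>auto intro: le_less_trans\<close>)
  have R_le: "expectation R \<le> v * \<tau>\<^sup>2"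
    using R_int nonneg by (subst (asm) nn_integral_eq_integral[OF iR]) (auto simp: R0)
  have iY2: "integrable M (\<lambda>\<omega>. (Y \<omega>)\<^sup>2)"
    by (rule integrableI_nonneg) (use v[of 2] in \<open>auto intro: le_less_trans\<close>)
  have iY: "integrable M Y" using Y iY2 by (rule square_integrable_imp_integrable)
  have "(\<integral>\<^sup>+\<omega>. ennreal (exp (\<tau> * Y \<omega>)) \<partial>M) \<le> (\<integral>\<^sup>+\<omega>. ennreal (1 + \<tau> * Y \<omega> + R \<omega>) \<partial>M)"
    by (intro nn_integral_mono ennreal_leI le)
  also have "\<dots> = ennreal (expectation (\<lambda>\<omega>. 1 + \<tau> * Y \<omega> + R \<omega>))"
  proof (rule nn_integral_eq_integral)
    show "AE \<omega> in M. 0 \<le> 1 + \<tau> * Y \<omega> + R \<omega>"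
      using le by (intro AE_I2) (meson exp_ge_zero order_trans)
  qed (use iY iR in auto)
  also have "expectation (\<lambda>\<omega>. 1 + \<tau> * Y \<omega> + R \<omega>) = 1 + \<tau> * expectation Y + expectation R"
    using iY iR by (simp add: prob_space)
  also have "\<dots> \<le> 1 + (\<tau>\<^sup>2 * v + \<tau> * m)"
  proof -
    have "\<tau> * expectation Y \<le> \<tau> * m" using m \<tau> by (intro mult_left_mono) auto
    then show ?thesis using R_le by (simp add: mult.commute)
  qed
  also have "\<dots> \<le> exp (\<tau>\<^sup>2 * v + \<tau> * m)" by (rule exp_ge_add_one_self)
  finally show ?thesis by (auto simp: ennreal_leI)
qed

text \<open>The property is only required to hold on the complement of a measurable set of small
  measure: being a maximiser, or satisfying a bound for all vectors of a cone, has no evident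
  measurability. Union bounds remain valid in this form.\<close>

definition holds_off :: "'a measure \<Rightarrow> real \<Rightarrow> ('a \<Rightarrow> bool) \<Rightarrow> bool" where
  "holds_off M \<epsilon> P \<longleftrightarrow> (\<exists>E\<in>sets M. measure M E \<le> \<epsilon> \<and> (\<forall>\<omega>\<in>space M - E. P \<omega>))"

lemma holds_off_mono:
  assumes "holds_off M \<epsilon> P" "\<epsilon> \<le> \<epsilon>'" "\<And>\<omega>. \<omega> \<in> space M \<Longrightarrow> P \<omega> \<Longrightarrow> Q \<omega>"
  shows "holds_off M \<epsilon>' Q"
  using assms unfolding holds_off_def by (meson DiffD1 order_trans)

lemma (in prob_space) holds_off_conj:
  assumes "holds_off M a P" "holds_off M b Q"
  shows "holds_off M (a + b) (\<lambda>\<omega>. P \<omega> \<and> Q \<omega>)"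
proof -
  obtain E F where "E \<in> sets M" "measure M E \<le> a" "\<forall>\<omega>\<in>space M - E. P \<omega>"
    "F \<in> sets M" "measure M F \<le> b" "\<forall>\<omega>\<in>space M - F. Q \<omega>"
    using assms unfolding holds_off_def by blast
  then show ?thesis
    unfolding holds_off_def using measure_Un_le[of E M F] by (intro bexI[of _ "E \<union> F"]) auto
qed

lemma (in prob_space) holds_off_ball:
  fixes a :: real
  assumes "finite A" "\<And>x. x \<in> A \<Longrightarrow> holds_off M a (P x)"
  shows "holds_off M (card A * a) (\<lambda>\<omega>. \<forall>x\<in>A. P x \<omega>)"
  using assms
proof (induction A)
  case empty
  show ?case unfolding holds_off_def by (intro bexI[of _ "{}"]) auto
next
  case (insert x A)
  then have "holds_off M (a + card A * a) (\<lambda>\<omega>. P x \<omega> \<and> (\<forall>x\<in>A. P x \<omega>))"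
    by (intro holds_off_conj) auto
  with insert show ?case by (auto simp: algebra_simps)
qed

lemma holds_off_not:
  assumes "measure M {\<omega> \<in> space M. \<not> P \<omega>} \<le> \<epsilon>" "{\<omega> \<in> space M. \<not> P \<omega>} \<in> sets M"
  shows "holds_off M \<epsilon> P"
  using assms unfolding holds_off_def by blast

lemma holds_off_AE:
  assumes "AE \<omega> in M. P \<omega>"
  shows "holds_off M 0 P"
proof -
  obtain E where "{\<omega> \<in> space M. \<not> P \<omega>} \<subseteq> E" "emeasure M E = 0" "E \<in> sets M"
    using assms by (rule AE_E)
  then show ?thesis unfolding holds_off_def by (intro bexI[of _ E]) (auto simp: measure_def)
qed

text \<open>The \<open>measure\<close> of a non-measurable set is 0, so the exceptional set need not be measurable.\<close>

lemma (in prob_space) holds_off_measure_le: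
  assumes "holds_off M \<epsilon> P" "\<And>\<omega>. \<omega> \<in> A \<Longrightarrow> \<omega> \<in> space M \<and> \<not> P \<omega>" "0 \<le> \<epsilon>"
  shows "measure M A \<le> \<epsilon>"
proof (cases "A \<in> sets M")
  case True
  obtain E where "E \<in> sets M" "measure M E \<le> \<epsilon>" "\<forall>\<omega>\<in>space M - E. P \<omega>"
    using assms unfolding holds_off_def by blast
  then show ?thesis using finite_measure_mono[of A E] assms(2) by fastforce
qed (simp add: measure_notin_sets assms)

section \<open>Kernel sums over one independent sample\<close>

locale kernel_sample = prob_space M
  for M :: "'a measure" +
  fixes N :: "'b measure" and Z :: "nat \<Rightarrow> 'a \<Rightarrow> 'b" and n :: nat and V :: "'b \<Rightarrow> real"
    and w :: "real \<Rightarrow> real" and W B h cV :: real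
  assumes Z_indep: "indep_vars (\<lambda>_. N) Z {1..n}"
    and V_meas: "V \<in> borel_measurable N"
    and w_meas: "w \<in> borel_measurable borel"
    and w_le: "\<And>t. \<bar>w t\<bar> \<le> W * indicator {-B..B} t"
    and W_pos: "0 < W" and B_pos: "0 < B" and h_pos: "0 < h" and cV_pos: "0 < cV"
    and V_dens: "\<And>i u r. i \<in> {1..n} \<Longrightarrow> 0 \<le> r \<Longrightarrow>
      (\<integral>\<^sup>+\<omega>. indicator {\<omega>. \<bar>V (Z i \<omega>) - u\<bar> \<le> r} \<omega> \<partial>M) \<le> ennreal (cV * r)"
begin

text \<open>By \<open>w_le\<close> the weight of an observation vanishes outside this event, and by
  \<open>V_dens\<close> the event has probability O(h). Every factor \<open>h\<close> in the moment
  bounds below originates here.\<close>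

abbreviation near :: "nat \<Rightarrow> real \<Rightarrow> 'a set" where
  "near i u \<equiv> {\<omega>. \<bar>V (Z i \<omega>) - u\<bar> \<le> B * h}"

definition wterm :: "('b \<Rightarrow> real) \<Rightarrow> nat \<Rightarrow> real \<Rightarrow> 'a \<Rightarrow> real" where
  "wterm f i u \<omega> = f (Z i \<omega>) * w ((V (Z i \<omega>) - u) / h)"

definition wsum :: "('b \<Rightarrow> real) \<Rightarrow> nat \<Rightarrow> 'a \<Rightarrow> real" where
  "wsum f k \<omega> = (\<Sum>i=1..n. wterm f i (V (Z k \<omega>)) \<omega>)"

lemma Z_meas: "i \<in> {1..n} \<Longrightarrow> Z i \<in> measurable M N"
  using Z_indep by (auto simp: indep_vars_def)

lemma VZ_meas: "i \<in> {1..n} \<Longrightarrow> (\<lambda>\<omega>. V (Z i \<omega>)) \<in> borel_measurable M"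
  by (rule measurable_compose[OF Z_meas V_meas])

lemma fZ_meas: "i \<in> {1..n} \<Longrightarrow> f \<in> borel_measurable N \<Longrightarrow> (\<lambda>\<omega>. f (Z i \<omega>)) \<in> borel_measurable M"
  by (rule measurable_compose[OF Z_meas])

lemma wterm_meas:
  assumes "i \<in> {1..n}" "f \<in> borel_measurable N"
  shows "wterm f i u \<in> borel_measurable M"
  unfolding wterm_def using fZ_meas[OF assms] VZ_meas[OF assms(1)] w_meas by measurable

lemma wsum_meas:
  assumes "k \<in> {1..n}" "f \<in> borel_measurable N"
  shows "wsum f k \<in> borel_measurable M"
  unfolding wsum_def wterm_def
  by (intro borel_measurable_sum borel_measurable_times fZ_meas assms
      measurable_compose[OF _ w_meas] borel_measurable_divide borel_measurable_diff VZ_meas) auto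

lemma near_sets: "i \<in> {1..n} \<Longrightarrow> space M \<inter> near i u \<in> sets M"
proof -
  assume i: "i \<in> {1..n}"
  note [measurable] = VZ_meas[OF i]
  have "{\<omega> \<in> space M. \<bar>V (Z i \<omega>) - u\<bar> \<le> B * h} \<in> sets M" by measurable
  moreover have "{\<omega> \<in> space M. \<bar>V (Z i \<omega>) - u\<bar> \<le> B * h} = space M \<inter> near i u" by auto
  ultimately show ?thesis by simp
qed

lemma near_ind_meas [measurable]: "i \<in> {1..n} \<Longrightarrow> (indicator (near i u) :: 'a \<Rightarrow> real) \<in> borel_measurable M"
  using borel_measurable_indicator_iff[of "near i u" M] near_sets[of i u] by (simp add: Int_commute)

lemma w_abs_le: "\<bar>w t\<bar> \<le> W"
  using w_le[of t] W_pos by (cases "t \<in> {-B..B}") auto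

lemma wterm_le: "\<bar>wterm f i u \<omega>\<bar> \<le> W * (\<bar>f (Z i \<omega>)\<bar> * indicator (near i u) \<omega>)"
proof -
  have eq: "indicator {-B..B} ((V (Z i \<omega>) - u) / h) = (indicator (near i u) \<omega> :: real)"
    using h_pos by (auto simp: indicator_def abs_le_iff field_simps)
  have "\<bar>wterm f i u \<omega>\<bar> \<le> \<bar>f (Z i \<omega>)\<bar> * (W * indicator {-B..B} ((V (Z i \<omega>) - u) / h))"
    unfolding wterm_def abs_mult by (intro mult_left_mono w_le) auto
  then show ?thesis unfolding eq by (simp add: mult_ac)
qed

text \<open>Both signs \<sigma> obey the same Chernoff bound, hence the factor 2. The summand of the
  centre has the weight \<open>w 0\<close>, at most \<open>W\<close> in absolute value, so an
  exponential moment of W |f| at observation \<open>k\<close> covers it.\<close>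

lemma wsum_tail:
  fixes b C s \<tau> :: real
  assumes f: "f \<in> borel_measurable N" and k: "k \<in> {1..n}" and b: "0 \<le> b" and C: "0 \<le> C" and \<tau>: "0 \<le> \<tau>"
    and mgf: "\<And>\<sigma> i u. \<sigma> \<in> {-1, 1} \<Longrightarrow> i \<in> {1..n} \<Longrightarrow>
      (\<integral>\<^sup>+\<omega>. ennreal (exp (\<tau> * (\<sigma> * wterm f i u \<omega>))) \<partial>M) \<le> ennreal (exp b)"
    and fC: "(\<integral>\<^sup>+\<omega>. ennreal (exp (\<tau> * W * \<bar>f (Z k \<omega>)\<bar>)) \<partial>M) \<le> ennreal C"
  shows "holds_off M (2 * C * exp (n * b - \<tau> * s)) (\<lambda>\<omega>. \<bar>wsum f k \<omega>\<bar> \<le> s)"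
proof (cases "\<tau> = 0")
  \<comment> \<open>Exponentials carry no information at \<tau> = 0, but the claimed probability
    bound is then at least 1 and the exceptional set may be everything.\<close>
  case True
  have "(\<integral>\<^sup>+\<omega>. ennreal (exp (\<tau> * W * \<bar>f (Z k \<omega>)\<bar>)) \<partial>M) = 1"
    using True emeasure_space_1 by simp
  then have "1 \<le> ennreal C" using fC by simp
  then have "1 \<le> C" by simp
  moreover have "1 \<le> exp (n * b - \<tau> * s)" using True b by simp
  ultimately have "1 * 1 \<le> C * exp (n * b - \<tau> * s)" by (intro mult_mono) auto
  then have "1 \<le> 2 * C * exp (n * b - \<tau> * s)" by linarith
  then show ?thesis unfolding holds_off_def by (intro bexI[of _ "space M"]) (auto simp: prob_space)
next
  case False
  then have \<tau>: "0 < \<tau>" using \<tau> by simp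
  have one: "measure M {\<omega> \<in> space M. \<not> \<sigma> * wsum f k \<omega> \<le> s} \<le> C * exp (n * b - \<tau> * s)"
    if \<sigma>: "\<sigma> \<in> {-1, 1}" for \<sigma> :: real
  proof -
    define \<phi> where "\<phi> z u = \<tau> * (\<sigma> * (f z * w ((V z - u) / h)))" for z u
    have \<phi>m: "(\<lambda>(z, u). \<phi> z u) \<in> borel_measurable (N \<Otimes>\<^sub>M borel)"
      unfolding \<phi>_def case_prod_beta using f V_meas w_meas by measurable
    have \<phi>w: "\<phi> (Z i \<omega>) u = \<tau> * (\<sigma> * wterm f i u \<omega>)" for i \<omega> u
      by (simp add: \<phi>_def wterm_def)
    have "(\<integral>\<^sup>+\<omega>. ennreal (exp (\<phi> (Z k \<omega>) (V (Z k \<omega>)))) \<partial>M) \<le> (\<integral>\<^sup>+\<omega>. ennreal (exp (\<tau> * W * \<bar>f (Z k \<omega>)\<bar>)) \<partial>M)"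
    proof (intro nn_integral_mono ennreal_leI)
      fix \<omega>
      have "\<sigma> * (f (Z k \<omega>) * w 0) \<le> \<bar>\<sigma> * (f (Z k \<omega>) * w 0)\<bar>" by simp
      also have "\<dots> \<le> \<bar>f (Z k \<omega>)\<bar> * W"
        using \<sigma> by (auto simp: abs_mult intro!: mult_left_mono w_abs_le)
      finally show "exp (\<phi> (Z k \<omega>) (V (Z k \<omega>))) \<le> exp (\<tau> * W * \<bar>f (Z k \<omega>)\<bar>)"
        using \<tau> by (simp add: \<phi>_def mult_ac)
    qed
    also note fC
    finally have C': "(\<integral>\<^sup>+\<omega>. ennreal (exp (\<phi> (Z k \<omega>) (V (Z k \<omega>)))) \<partial>M) \<le> ennreal C" .
    have "measure M {\<omega> \<in> space M. \<tau> * s < (\<Sum>i\<in>{1..n}. \<phi> (Z i \<omega>) (V (Z k \<omega>)))}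
        \<le> C * exp (real (card {1..n}) * b - \<tau> * s)"
      by (rule chernoff_indep_sum[OF _ k Z_indep \<phi>m V_meas _ C' b C]) (use mgf[OF \<sigma>] in \<open>auto simp: \<phi>w\<close>)
    moreover have "(\<Sum>i\<in>{1..n}. \<phi> (Z i \<omega>) (V (Z k \<omega>))) = \<tau> * (\<sigma> * wsum f k \<omega>)" for \<omega>
      unfolding wsum_def \<phi>w by (simp add: sum_distrib_left)
    ultimately show ?thesis using \<tau> by (simp add: not_le)
  qed
  note [measurable] = wsum_meas[OF k f]
  have "holds_off M (C * exp (n * b - \<tau> * s) + C * exp (n * b - \<tau> * s))
    (\<lambda>\<omega>. 1 * wsum f k \<omega> \<le> s \<and> - 1 * wsum f k \<omega> \<le> s)"
    by (intro holds_off_conj holds_off_not one) auto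
  then show ?thesis by (rule holds_off_mono) auto
qed

text \<open>Boundedness by \<open>T\<close> limits \<tau> to 1 / (W T), while the variance is a
  second moment over the observations near the centre only, which is what will make it O(h).\<close>

lemma wterm_mgf_bounded:
  fixes T v m \<tau> :: real
  assumes f: "f \<in> borel_measurable N" and i: "i \<in> {1..n}" and \<sigma>: "\<sigma> \<in> {-1, 1}"
    and T: "\<And>z. \<bar>f z\<bar> \<le> T" and \<tau>: "0 \<le> \<tau>" "\<tau> * (W * T) \<le> 1"
    and v: "(\<integral>\<^sup>+\<omega>. ennreal ((f (Z i \<omega>))\<^sup>2 * indicator (near i u) \<omega>) \<partial>M) \<le> ennreal v" "0 \<le> v"
    and m: "\<bar>expectation (wterm f i u)\<bar> \<le> m"
  shows "(\<integral>\<^sup>+\<omega>. ennreal (exp (\<tau> * (\<sigma> * wterm f i u \<omega>))) \<partial>M) \<le> ennreal (exp (\<tau>\<^sup>2 * (W\<^sup>2 * v) + \<tau> * m))"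
proof (rule mgf_le_of_bounded[where c="W * T"])
  note [measurable] = wterm_meas[OF i f] fZ_meas[OF i f]
  show "(\<lambda>\<omega>. \<sigma> * wterm f i u \<omega>) \<in> borel_measurable M" by measurable
  have \<sigma>1: "\<bar>\<sigma>\<bar> = 1" using \<sigma> by auto
  show "\<bar>\<sigma> * wterm f i u \<omega>\<bar> \<le> W * T" for \<omega>
  proof -
    have "\<bar>f (Z i \<omega>)\<bar> * indicator (near i u) \<omega> \<le> T * 1"
      using T[of "Z i \<omega>"] abs_ge_zero[of "f (Z i \<omega>)"] by (auto simp: indicator_def split: if_splits)
    then have "W * (\<bar>f (Z i \<omega>)\<bar> * indicator (near i u) \<omega>) \<le> W * T"
      using W_pos by simp
    then show ?thesis unfolding abs_mult \<sigma>1 using wterm_le[of f i u \<omega>] by simp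
  qed
  have "(\<integral>\<^sup>+\<omega>. ennreal ((\<sigma> * wterm f i u \<omega>)\<^sup>2) \<partial>M)
      \<le> (\<integral>\<^sup>+\<omega>. ennreal (W\<^sup>2) * ennreal ((f (Z i \<omega>))\<^sup>2 * indicator (near i u) \<omega>) \<partial>M)"
  proof (intro nn_integral_mono)
    fix \<omega>
    have "(\<sigma> * wterm f i u \<omega>)\<^sup>2 = \<bar>wterm f i u \<omega>\<bar>\<^sup>2" using \<sigma> by auto
    also have "\<dots> \<le> (W * (\<bar>f (Z i \<omega>)\<bar> * indicator (near i u) \<omega>))\<^sup>2"
      by (intro power_mono wterm_le) auto
    also have "\<dots> = W\<^sup>2 * ((f (Z i \<omega>))\<^sup>2 * indicator (near i u) \<omega>)"
      by (auto simp: indicator_def power_mult_distrib)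
    finally show "ennreal ((\<sigma> * wterm f i u \<omega>)\<^sup>2) \<le> ennreal (W\<^sup>2) * ennreal ((f (Z i \<omega>))\<^sup>2 * indicator (near i u) \<omega>)"
      by (simp add: ennreal_mult[symmetric] ennreal_leI)
  qed
  also have "\<dots> = ennreal (W\<^sup>2) * (\<integral>\<^sup>+\<omega>. ennreal ((f (Z i \<omega>))\<^sup>2 * indicator (near i u) \<omega>) \<partial>M)"
    using i by (intro nn_integral_cmult) measurable
  also have "\<dots> \<le> ennreal (W\<^sup>2) * ennreal v" by (intro mult_left_mono v) auto
  also have "\<dots> = ennreal (W\<^sup>2 * v)" using v by (simp add: ennreal_mult)
  finally show "(\<integral>\<^sup>+\<omega>. ennreal ((\<sigma> * wterm f i u \<omega>)\<^sup>2) \<partial>M) \<le> ennreal (W\<^sup>2 * v)" .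
  show "\<bar>expectation (\<lambda>\<omega>. \<sigma> * wterm f i u \<omega>)\<bar> \<le> m" using m \<sigma> by auto
qed (use \<tau> v in auto)

text \<open>Here the range of \<tau> depends on \<open>W\<close> alone: growth of moments like q!
  replaces the bound on the variable itself.\<close>

lemma wterm_mgf_bernstein:
  fixes v m \<tau> :: real
  assumes f: "f \<in> borel_measurable N" and i: "i \<in> {1..n}" and \<sigma>: "\<sigma> \<in> {-1, 1}"
    and \<tau>: "0 \<le> \<tau>" "\<tau> * W \<le> 1 / 2"
    and v: "\<And>q. 2 \<le> q \<Longrightarrow>
      (\<integral>\<^sup>+\<omega>. ennreal (\<bar>f (Z i \<omega>)\<bar> ^ q * indicator (near i u) \<omega>) \<partial>M) \<le> ennreal (v / 2 * fact q)" "0 \<le> v"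
    and m: "\<bar>expectation (wterm f i u)\<bar> \<le> m"
  shows "(\<integral>\<^sup>+\<omega>. ennreal (exp (\<tau> * (\<sigma> * wterm f i u \<omega>))) \<partial>M) \<le> ennreal (exp (\<tau>\<^sup>2 * (W\<^sup>2 * v) + \<tau> * m))"
proof (rule mgf_le_of_bernstein[where c=W])
  note [measurable] = wterm_meas[OF i f] fZ_meas[OF i f]
  show "(\<lambda>\<omega>. \<sigma> * wterm f i u \<omega>) \<in> borel_measurable M" by measurable
  have \<sigma>1: "\<bar>\<sigma>\<bar> = 1" using \<sigma> by auto
  fix q :: nat assume q: "2 \<le> q"
  have "(\<integral>\<^sup>+\<omega>. ennreal (\<bar>\<sigma> * wterm f i u \<omega>\<bar> ^ q) \<partial>M)
      \<le> (\<integral>\<^sup>+\<omega>. ennreal (W ^ q) * ennreal (\<bar>f (Z i \<omega>)\<bar> ^ q * indicator (near i u) \<omega>) \<partial>M)"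
  proof (intro nn_integral_mono)
    fix \<omega>
    have "\<bar>\<sigma> * wterm f i u \<omega>\<bar> ^ q \<le> (W * (\<bar>f (Z i \<omega>)\<bar> * indicator (near i u) \<omega>)) ^ q"
      unfolding abs_mult[of \<sigma>] \<sigma>1 by (intro power_mono) (auto intro: wterm_le)
    also have "\<dots> = W ^ q * (\<bar>f (Z i \<omega>)\<bar> ^ q * indicator (near i u) \<omega>)"
      using q by (auto simp: indicator_def power_mult_distrib)
    finally show "ennreal (\<bar>\<sigma> * wterm f i u \<omega>\<bar> ^ q)
        \<le> ennreal (W ^ q) * ennreal (\<bar>f (Z i \<omega>)\<bar> ^ q * indicator (near i u) \<omega>)"
      using W_pos by (simp add: ennreal_mult[symmetric] ennreal_leI)
  qed
  also have "\<dots> = ennreal (W ^ q) * (\<integral>\<^sup>+\<omega>. ennreal (\<bar>f (Z i \<omega>)\<bar> ^ q * indicator (near i u) \<omega>) \<partial>M)"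
    using i by (intro nn_integral_cmult) measurable
  also have "\<dots> \<le> ennreal (W ^ q) * ennreal (v / 2 * fact q)" by (intro mult_left_mono v q) auto
  also have "\<dots> = ennreal (W\<^sup>2 * v / 2 * fact q * W ^ (q - 2))"
  proof -
    have "W ^ q = W\<^sup>2 * W ^ (q - 2)" using q by (metis le_add_diff_inverse power_add)
    then show ?thesis using v W_pos by (simp add: ennreal_mult[symmetric] mult_ac)
  qed
  finally show "(\<integral>\<^sup>+\<omega>. ennreal (\<bar>\<sigma> * wterm f i u \<omega>\<bar> ^ q) \<partial>M) \<le> ennreal (W\<^sup>2 * v / 2 * fact q * W ^ (q - 2))" .
next
  show "\<bar>expectation (\<lambda>\<omega>. \<sigma> * wterm f i u \<omega>)\<bar> \<le> m" using m \<sigma> by auto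
qed (use \<tau> v W_pos in auto)

end

section \<open>Moment classes and truncation\<close>

lemma abs_le_1_plus_square: "\<bar>x\<bar> \<le> 1 + \<bar>x\<bar>\<^sup>2" for x :: real
  using zero_le_power2[of "\<bar>x\<bar> - 1"] by (auto simp: power2_eq_square algebra_simps)

lemma abs_le_1_plus_powr:
  fixes x m :: real
  assumes "1 \<le> m"
  shows "\<bar>x\<bar> \<le> 1 + \<bar>x\<bar> powr m"
proof (cases "\<bar>x\<bar> \<le> 1")
  case False
  then have "\<bar>x\<bar> = \<bar>x\<bar> powr 1" by simp
  also have "\<dots> \<le> \<bar>x\<bar> powr m" using False assms by (intro powr_mono) auto
  finally show ?thesis by simp
qed (use powr_ge_zero[of "\<bar>x\<bar>" m] in linarith)

context kernel_sample
begin

text \<open>The common interface of the two moment regimes. For \<tau> up to \<open>\<tau>0\<close>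
  the exponent is \<open>h\<close> times a quadratic in \<tau>, with \<open>v\<close> a variance and
  \<open>m\<close> a mean per unit bandwidth; \<open>C\<close> pays for the summand of the centre
  itself. The main difference between the regimes is how large \<open>\<tau>0\<close> may
  be.\<close>

definition mgf_class :: "('b \<Rightarrow> real) \<Rightarrow> real \<Rightarrow> real \<Rightarrow> real \<Rightarrow> real \<Rightarrow> bool" where
  "mgf_class f \<tau>0 v m C \<longleftrightarrow> f \<in> borel_measurable N \<and>
     (\<forall>\<tau>\<in>{0..\<tau>0}. \<forall>\<sigma>\<in>{-1, 1}. \<forall>i\<in>{1..n}. \<forall>u.
        (\<integral>\<^sup>+\<omega>. ennreal (exp (\<tau> * (\<sigma> * wterm f i u \<omega>))) \<partial>M) \<le> ennreal (exp (h * (\<tau>\<^sup>2 * v + \<tau> * m)))) \<and>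
     (\<forall>k\<in>{1..n}. (\<integral>\<^sup>+\<omega>. ennreal (exp (\<tau>0 * W * \<bar>f (Z k \<omega>)\<bar>)) \<partial>M) \<le> ennreal C)"

text \<open>The scale n h t is the natural one: of order n h observations lie near a centre, and n h
  then factors out of the whole exponent. The factor n p counts the centres and the members of the
  family.\<close>

lemma wsum_family_tail:
  fixes p \<tau> \<tau>0 v m C t :: real
  assumes J: "finite J" "real (card J) \<le> p" and f: "\<And>j. j \<in> J \<Longrightarrow> mgf_class (f j) \<tau>0 v m C"
    and \<tau>: "0 \<le> \<tau>" "\<tau> \<le> \<tau>0" and nn: "0 \<le> v" "0 \<le> m" "0 \<le> C"
  shows "holds_off M (n * p * (2 * C * exp (n * h * (\<tau>\<^sup>2 * v + \<tau> * m - \<tau> * t))))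
    (\<lambda>\<omega>. \<forall>k\<in>{1..n}. \<forall>j\<in>J. \<bar>wsum (f j) k \<omega>\<bar> \<le> n * h * t)"
proof -
  define e where "e = 2 * C * exp (n * h * (\<tau>\<^sup>2 * v + \<tau> * m - \<tau> * t))"
  have one: "holds_off M e (\<lambda>\<omega>. \<bar>wsum (f j) k \<omega>\<bar> \<le> n * h * t)" if jk: "j \<in> J" "k \<in> {1..n}" for j k
  proof -
    note c = f[OF jk(1), unfolded mgf_class_def]
    have fm: "f j \<in> borel_measurable N" using c by blast
    note [measurable] = fZ_meas[OF jk(2) fm]
    have "holds_off M (2 * C * exp (n * (h * (\<tau>\<^sup>2 * v + \<tau> * m)) - \<tau> * (n * h * t)))
      (\<lambda>\<omega>. \<bar>wsum (f j) k \<omega>\<bar> \<le> n * h * t)"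
    proof (rule wsum_tail[OF fm jk(2) _ nn(3) \<tau>(1)])
      show "0 \<le> h * (\<tau>\<^sup>2 * v + \<tau> * m)" using nn \<tau> h_pos by auto
      show "(\<integral>\<^sup>+\<omega>. ennreal (exp (\<tau> * (\<sigma> * wterm (f j) i u \<omega>))) \<partial>M) \<le> ennreal (exp (h * (\<tau>\<^sup>2 * v + \<tau> * m)))"
        if "\<sigma> \<in> {-1, 1}" "i \<in> {1..n}" for \<sigma> :: real and i u
        using c that \<tau> by auto
      have "(\<integral>\<^sup>+\<omega>. ennreal (exp (\<tau> * W * \<bar>f j (Z k \<omega>)\<bar>)) \<partial>M) \<le> (\<integral>\<^sup>+\<omega>. ennreal (exp (\<tau>0 * W * \<bar>f j (Z k \<omega>)\<bar>)) \<partial>M)"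
        using \<tau> W_pos by (intro nn_integral_mono ennreal_leI) (auto intro!: mult_right_mono)
      also have "\<dots> \<le> ennreal C" using c jk by auto
      finally show "(\<integral>\<^sup>+\<omega>. ennreal (exp (\<tau> * W * \<bar>f j (Z k \<omega>)\<bar>)) \<partial>M) \<le> ennreal C" .
    qed
    then show ?thesis by (simp add: e_def algebra_simps)
  qed
  have "holds_off M (card ({1..n} \<times> J) * e) (\<lambda>\<omega>. \<forall>(k, j)\<in>{1..n} \<times> J. \<bar>wsum (f j) k \<omega>\<bar> \<le> n * h * t)"
    using J one by (intro holds_off_ball) auto
  then show ?thesis
  proof (rule holds_off_mono)
    have "card ({1..n} \<times> J) * e = n * (card J * e)" by (simp add: card_cartesian_product)
    also have "\<dots> \<le> n * (p * e)" using J nn by (intro mult_left_mono mult_right_mono) (auto simp: e_def)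
    finally show "card ({1..n} \<times> J) * e \<le> n * p * (2 * C * exp (n * h * (\<tau>\<^sup>2 * v + \<tau> * m - \<tau> * t)))"
      by (simp add: e_def mult_ac)
  qed auto
qed

lemma near_prob:
  assumes "i \<in> {1..n}"
  shows "(\<integral>\<^sup>+\<omega>. indicator (near i u) \<omega> \<partial>M) \<le> ennreal (cV * B * h)"
  using V_dens[OF assms, of "B * h" u] B_pos h_pos by (simp add: mult_ac)

text \<open>Lower moments are dominated by 1 plus a higher one. The constant 1 integrates to the
  probability of being near the centre, so the factor \<open>h\<close> survives.\<close>

lemma near_integral_le:
  fixes A :: real
  assumes i: "i \<in> {1..n}" and F: "F \<in> borel_measurable N" "\<And>z. 0 \<le> F z" and G: "\<And>z. G z \<le> 1 + F z"
    and A: "(\<integral>\<^sup>+\<omega>. ennreal (F (Z i \<omega>) * indicator (near i u) \<omega>) \<partial>M) \<le> ennreal (A * h)" "0 \<le> A"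
  shows "(\<integral>\<^sup>+\<omega>. ennreal (G (Z i \<omega>) * indicator (near i u) \<omega>) \<partial>M) \<le> ennreal ((cV * B + A) * h)"
proof -
  note [measurable] = fZ_meas[OF i F(1)] near_ind_meas[OF i, of u]
  have "(\<integral>\<^sup>+\<omega>. ennreal (G (Z i \<omega>) * indicator (near i u) \<omega>) \<partial>M)
    \<le> (\<integral>\<^sup>+\<omega>. ennreal (indicator (near i u) \<omega>) + ennreal (F (Z i \<omega>) * indicator (near i u) \<omega>) \<partial>M)"
    using G F(2) by (intro nn_integral_mono) (auto simp: indicator_def ennreal_leI simp flip: ennreal_plus ennreal_1)
  also have "\<dots> = (\<integral>\<^sup>+\<omega>. ennreal (indicator (near i u) \<omega>) \<partial>M) + (\<integral>\<^sup>+\<omega>. ennreal (F (Z i \<omega>) * indicator (near i u) \<omega>) \<partial>M)"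
    by (intro nn_integral_add) auto
  also have "\<dots> \<le> ennreal (cV * B * h) + ennreal (A * h)"
    using near_prob[OF i, of u] by (intro add_mono A) (simp add: ennreal_indicator)
  also have "\<dots> = ennreal ((cV * B + A) * h)"
    using cV_pos B_pos h_pos A by (simp add: ennreal_plus[symmetric] algebra_simps del: ennreal_plus)
  finally show ?thesis .
qed

lemma abs_expectation_wterm_le:
  fixes A :: real
  assumes i: "i \<in> {1..n}" and f: "f \<in> borel_measurable N"
    and A: "(\<integral>\<^sup>+\<omega>. ennreal (\<bar>f (Z i \<omega>)\<bar> * indicator (near i u) \<omega>) \<partial>M) \<le> ennreal (A * h)" "0 \<le> A"
  shows "integrable M (wterm f i u)" "\<bar>expectation (wterm f i u)\<bar> \<le> W * A * h"
proof -
  note [measurable] = fZ_meas[OF i f] near_ind_meas[OF i, of u] wterm_meas[OF i f]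
  have "(\<integral>\<^sup>+\<omega>. ennreal \<bar>wterm f i u \<omega>\<bar> \<partial>M) \<le> (\<integral>\<^sup>+\<omega>. ennreal W * ennreal (\<bar>f (Z i \<omega>)\<bar> * indicator (near i u) \<omega>) \<partial>M)"
    using wterm_le[of f i u] W_pos by (intro nn_integral_mono) (auto simp: ennreal_mult[symmetric] intro: ennreal_leI)
  also have "\<dots> = ennreal W * (\<integral>\<^sup>+\<omega>. ennreal (\<bar>f (Z i \<omega>)\<bar> * indicator (near i u) \<omega>) \<partial>M)"
    by (intro nn_integral_cmult) auto
  also have "\<dots> \<le> ennreal W * ennreal (A * h)" by (intro mult_left_mono A) auto
  also have "\<dots> = ennreal (W * A * h)" using W_pos A h_pos by (simp add: ennreal_mult[symmetric] mult_ac)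
  finally have le: "(\<integral>\<^sup>+\<omega>. ennreal \<bar>wterm f i u \<omega>\<bar> \<partial>M) \<le> ennreal (W * A * h)" .
  then show int: "integrable M (wterm f i u)"
    by (intro integrableI_bounded) (auto intro: le_less_trans)
  have "ennreal (expectation (\<lambda>\<omega>. \<bar>wterm f i u \<omega>\<bar>)) \<le> ennreal (W * A * h)"
    using le int by (subst (asm) nn_integral_eq_integral) auto
  then have "expectation (\<lambda>\<omega>. \<bar>wterm f i u \<omega>\<bar>) \<le> W * A * h"
    using W_pos A h_pos by (subst (asm) ennreal_le_iff) auto
  with integral_abs_bound[of M "wterm f i u"]
  show "\<bar>expectation (wterm f i u)\<bar> \<le> W * A * h" by (rule order_trans)
qed

text \<open>The factor 2 brings \<open>A * fact q\<close> into the form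
  \<open>v / 2 * fact q\<close> of the Bernstein bound. The same bound without localisation, applied
  to the absolute value, controls the exponential moment at the centre's own observation.\<close>

lemma mgf_class_bernstein:
  fixes A A0 \<tau>0 m :: real
  assumes f: "f \<in> borel_measurable N" and \<tau>0: "0 \<le> \<tau>0" "\<tau>0 * W \<le> 1 / 2" and A0: "0 \<le> A" "0 \<le> A0"
    and near: "\<And>i u q. i \<in> {1..n} \<Longrightarrow> 2 \<le> q \<Longrightarrow>
      (\<integral>\<^sup>+\<omega>. ennreal (\<bar>f (Z i \<omega>)\<bar> ^ q * indicator (near i u) \<omega>) \<partial>M) \<le> ennreal (A * fact q * h)"
    and all: "\<And>i q. i \<in> {1..n} \<Longrightarrow> 2 \<le> q \<Longrightarrow> (\<integral>\<^sup>+\<omega>. ennreal (\<bar>f (Z i \<omega>)\<bar> ^ q) \<partial>M) \<le> ennreal (A0 * fact q)"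
    and m: "\<And>i u. i \<in> {1..n} \<Longrightarrow> \<bar>expectation (wterm f i u)\<bar> \<le> m * h"
  shows "mgf_class f \<tau>0 (W\<^sup>2 * (2 * A)) m (exp (1 + 3 * A0))"
  unfolding mgf_class_def
proof (intro conjI ballI allI f)
  fix \<tau> \<sigma> :: real and i u assume \<tau>: "\<tau> \<in> {0..\<tau>0}" and \<sigma>: "\<sigma> \<in> {-1, 1}" and i: "i \<in> {1..n}"
  have "\<tau> * W \<le> \<tau>0 * W" using \<tau> W_pos by (intro mult_right_mono) auto
  then have "\<tau> * W \<le> 1 / 2" using \<tau>0 by linarith
  then have "(\<integral>\<^sup>+\<omega>. ennreal (exp (\<tau> * (\<sigma> * wterm f i u \<omega>))) \<partial>M)
      \<le> ennreal (exp (\<tau>\<^sup>2 * (W\<^sup>2 * (2 * A * h)) + \<tau> * (m * h)))"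
    using \<tau> A0 h_pos near[OF i, of _ u] m[OF i]
    by (intro wterm_mgf_bernstein f i \<sigma>) (auto simp: field_simps)
  also have "\<dots> = ennreal (exp (h * (\<tau>\<^sup>2 * (W\<^sup>2 * (2 * A)) + \<tau> * m)))" by (simp add: algebra_simps)
  finally show "(\<integral>\<^sup>+\<omega>. ennreal (exp (\<tau> * (\<sigma> * wterm f i u \<omega>))) \<partial>M) \<le> \<dots>" .
next
  fix k assume k: "k \<in> {1..n}"
  note [measurable] = fZ_meas[OF k f]
  let ?Y = "\<lambda>\<omega>. \<bar>f (Z k \<omega>)\<bar>"
  have "(\<integral>\<^sup>+\<omega>. ennreal (?Y \<omega>) \<partial>M) \<le> (\<integral>\<^sup>+\<omega>. 1 + ennreal (?Y \<omega> ^ 2) \<partial>M)"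
  proof (intro nn_integral_mono)
    fix \<omega>
    show "ennreal (?Y \<omega>) \<le> 1 + ennreal (?Y \<omega> ^ 2)"
      using abs_le_1_plus_square[of "f (Z k \<omega>)"] by (simp flip: ennreal_plus ennreal_1 add: ennreal_leI)
  qed
  also have "\<dots> = 1 + (\<integral>\<^sup>+\<omega>. ennreal (?Y \<omega> ^ 2) \<partial>M)"
    by (subst nn_integral_add) (auto simp: emeasure_space_1)
  also have "\<dots> \<le> 1 + ennreal (A0 * fact 2)" by (intro add_left_mono all k) auto
  also have "\<dots> = ennreal (1 + 2 * A0)" using A0 by (simp flip: ennreal_plus ennreal_1 add: mult.commute)
  finally have le: "(\<integral>\<^sup>+\<omega>. ennreal (?Y \<omega>) \<partial>M) \<le> ennreal (1 + 2 * A0)" .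
  have int: "integrable M ?Y" by (rule integrableI_bounded) (use le in \<open>auto intro: le_less_trans\<close>)
  have "ennreal (expectation ?Y) \<le> ennreal (1 + 2 * A0)"
    using le by (subst (asm) nn_integral_eq_integral[OF int]) auto
  then have m1: "\<bar>expectation ?Y\<bar> \<le> 1 + 2 * A0"
    using A0 by (subst (asm) ennreal_le_iff) auto
  have "(\<integral>\<^sup>+\<omega>. ennreal (exp (\<tau>0 * W * ?Y \<omega>)) \<partial>M) \<le> ennreal (exp ((\<tau>0 * W)\<^sup>2 * (2 * A0) + \<tau>0 * W * (1 + 2 * A0)))"
    by (rule mgf_le_of_bernstein[where c=1]) (use all[OF k] A0 \<tau>0 W_pos m1 in auto)
  \<comment> \<open>With \<tau>0 W \<le> 1/2 the exponent is at most A0 / 2 + 1 / 2 + A0, generously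
    rounded up.\<close>
  also have "\<dots> \<le> ennreal (exp (1 + 3 * A0))"
  proof -
    have "(\<tau>0 * W)\<^sup>2 \<le> (1/2)\<^sup>2" using \<tau>0 W_pos by (intro power_mono) auto
    then have "(\<tau>0 * W)\<^sup>2 * (2 * A0) \<le> (1/2)\<^sup>2 * (2 * A0)" using A0 by (intro mult_right_mono) auto
    moreover have "\<tau>0 * W * (1 + 2 * A0) \<le> 1 / 2 * (1 + 2 * A0)" using A0 \<tau>0 by (intro mult_right_mono) auto
    ultimately show ?thesis using A0 by (auto simp: power2_eq_square algebra_simps intro!: ennreal_leI)
  qed
  finally show "(\<integral>\<^sup>+\<omega>. ennreal (exp (\<tau>0 * W * ?Y \<omega>)) \<partial>M) \<le> ennreal (exp (1 + 3 * A0))" .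
qed

definition trunc :: "real \<Rightarrow> ('b \<Rightarrow> real) \<Rightarrow> 'b \<Rightarrow> real" where
  "trunc T f z = (if \<bar>f z\<bar> \<le> T then f z else 0)"

lemma trunc_meas: "f \<in> borel_measurable N \<Longrightarrow> trunc T f \<in> borel_measurable N"
proof -
  assume [measurable]: "f \<in> borel_measurable N"
  show ?thesis unfolding trunc_def by measurable
qed

lemma trunc_le: "0 \<le> T \<Longrightarrow> \<bar>trunc T f z\<bar> \<le> T"
  by (simp add: trunc_def)

text \<open>Weighted truncated terms are at most W T, so \<tau> may go up to 1 / (W T); at that
  value the centre's own summand contributes at most exp 1 whatever its distribution. The variance
  is bounded independently of \<open>T\<close> because m0 > 2 dominates squares.\<close>

lemma mgf_class_trunc:
  fixes A T m m0 :: real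
  assumes f: "f \<in> borel_measurable N" and T: "0 < T" and A: "0 \<le> A" and m0: "2 < m0"
    and near: "\<And>i u. i \<in> {1..n} \<Longrightarrow>
      (\<integral>\<^sup>+\<omega>. ennreal (\<bar>f (Z i \<omega>)\<bar> powr m0 * indicator (near i u) \<omega>) \<partial>M) \<le> ennreal (A * h)"
    and m: "\<And>i u. i \<in> {1..n} \<Longrightarrow> \<bar>expectation (wterm (trunc T f) i u)\<bar> \<le> m * h"
  shows "mgf_class (trunc T f) (1 / (W * T)) (W\<^sup>2 * (cV * B + A)) m (exp 1)"
  unfolding mgf_class_def
proof (intro conjI ballI allI trunc_meas f)
  fix \<tau> \<sigma> :: real and i u assume \<tau>: "\<tau> \<in> {0..1 / (W * T)}" and \<sigma>: "\<sigma> \<in> {-1, 1}" and i: "i \<in> {1..n}"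
  have \<tau>': "0 \<le> \<tau>" "\<tau> * (W * T) \<le> 1" using \<tau> W_pos T by (auto simp: field_simps)
  have "(\<integral>\<^sup>+\<omega>. ennreal (exp (\<tau> * (\<sigma> * wterm (trunc T f) i u \<omega>))) \<partial>M)
      \<le> ennreal (exp (\<tau>\<^sup>2 * (W\<^sup>2 * ((cV * B + A) * h)) + \<tau> * (m * h)))"
  proof (rule wterm_mgf_bounded[OF trunc_meas[OF f] i \<sigma> trunc_le[OF less_imp_le[OF T]] \<tau>' _ _ m[OF i]])
    show "(\<integral>\<^sup>+\<omega>. ennreal ((trunc T f (Z i \<omega>))\<^sup>2 * indicator (near i u) \<omega>) \<partial>M) \<le> ennreal ((cV * B + A) * h)"
    proof (rule near_integral_le[OF i _ _ _ near[OF i] A])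
      show "(trunc T f z)\<^sup>2 \<le> 1 + \<bar>f z\<bar> powr m0" for z
      proof (cases "\<bar>f z\<bar> \<le> 1")
        case True
        then have "(trunc T f z)\<^sup>2 \<le> 1" by (auto simp: trunc_def abs_square_le_1)
        then show ?thesis by (smt (verit) powr_ge_zero)
      next
        case False
        then have "(f z)\<^sup>2 = \<bar>f z\<bar> powr 2" by (simp add: powr_numeral)
        also have "\<dots> \<le> \<bar>f z\<bar> powr m0" using False m0 by (intro powr_mono) auto
        finally show ?thesis by (auto simp: trunc_def)
      qed
      show "(\<lambda>z. \<bar>f z\<bar> powr m0) \<in> borel_measurable N" using f by measurable
    qed auto
    show "0 \<le> (cV * B + A) * h" using cV_pos B_pos h_pos A by auto
  qed
  also have "\<dots> = ennreal (exp (h * (\<tau>\<^sup>2 * (W\<^sup>2 * (cV * B + A)) + \<tau> * m)))" by (simp add: algebra_simps)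
  finally show "(\<integral>\<^sup>+\<omega>. ennreal (exp (\<tau> * (\<sigma> * wterm (trunc T f) i u \<omega>))) \<partial>M) \<le> \<dots>" .
next
  fix k assume k: "k \<in> {1..n}"
  have "(\<integral>\<^sup>+\<omega>. ennreal (exp (1 / (W * T) * W * \<bar>trunc T f (Z k \<omega>)\<bar>)) \<partial>M) \<le> (\<integral>\<^sup>+\<omega>. ennreal (exp 1) \<partial>M)"
    using W_pos T trunc_le[of T f] by (intro nn_integral_mono ennreal_leI) (auto simp: field_simps)
  then show "(\<integral>\<^sup>+\<omega>. ennreal (exp (1 / (W * T) * W * \<bar>trunc T f (Z k \<omega>)\<bar>)) \<partial>M) \<le> ennreal (exp 1)"
    by (simp add: emeasure_space_1)
qed

text \<open>For families that only have to stay bounded, a mean of order \<open>h\<close> is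
  acceptable; the point is that the bound is uniform in \<open>T\<close>.\<close>

lemma expectation_wterm_trunc_le:
  fixes A T m0 :: real
  assumes f: "f \<in> borel_measurable N" and A: "0 \<le> A" and m0: "2 < m0" and i: "i \<in> {1..n}"
    and near: "(\<integral>\<^sup>+\<omega>. ennreal (\<bar>f (Z i \<omega>)\<bar> powr m0 * indicator (near i u) \<omega>) \<partial>M) \<le> ennreal (A * h)"
  shows "\<bar>expectation (wterm (trunc T f) i u)\<bar> \<le> W * (cV * B + A) * h"
proof (rule abs_expectation_wterm_le[OF i trunc_meas[OF f]])
  show "(\<integral>\<^sup>+\<omega>. ennreal (\<bar>trunc T f (Z i \<omega>)\<bar> * indicator (near i u) \<omega>) \<partial>M) \<le> ennreal ((cV * B + A) * h)"
  proof (rule near_integral_le[OF i _ _ _ near A])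
    show "\<bar>trunc T f z\<bar> \<le> 1 + \<bar>f z\<bar> powr m0" for z
      using abs_le_1_plus_powr[of m0 "f z"] m0 by (auto simp: trunc_def add_nonneg_nonneg)
    show "(\<lambda>z. \<bar>f z\<bar> powr m0) \<in> borel_measurable N" using f by measurable
  qed auto
  show "0 \<le> cV * B + A" using cV_pos B_pos A by auto
qed

text \<open>If the untruncated terms are centred, the mean of the truncated ones is that of the cut-off part.\<close>

lemma expectation_wterm_trunc_centred_le:
  fixes A T m0 :: real
  assumes f: "f \<in> borel_measurable N" and T: "0 < T" and A: "0 \<le> A" and m0: "2 < m0" and i: "i \<in> {1..n}"
    and near: "(\<integral>\<^sup>+\<omega>. ennreal (\<bar>f (Z i \<omega>)\<bar> powr m0 * indicator (near i u) \<omega>) \<partial>M) \<le> ennreal (A * h)"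
    and centred: "expectation (wterm f i u) = 0" "integrable M (wterm f i u)"
  shows "\<bar>expectation (wterm (trunc T f) i u)\<bar> \<le> W * A * T powr (1 - m0) * h"
proof -
  define g where "g z = f z - trunc T f z" for z
  have gm: "g \<in> borel_measurable N" unfolding g_def using f trunc_meas[OF f] by measurable
  note [measurable] = fZ_meas[OF i f] near_ind_meas[OF i, of u]
  have g_le: "\<bar>g z\<bar> \<le> T powr (1 - m0) * \<bar>f z\<bar> powr m0" for z
  proof (cases "\<bar>f z\<bar> \<le> T")
    case True
    then show ?thesis by (simp add: g_def trunc_def)
  next
    case False
    then have pos: "0 < \<bar>f z\<bar>" using T by linarith
    \<comment> \<open>As 1 - m0 is negative, |f|^(1 - m0) is at most T^(1 - m0) beyond the
      truncation level: the excess power of the moment becomes decay in \<open>T\<close>.\<close>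
    have "\<bar>f z\<bar> = \<bar>f z\<bar> powr (1 - m0) * \<bar>f z\<bar> powr m0" using pos by (simp flip: powr_add)
    also have "\<dots> \<le> T powr (1 - m0) * \<bar>f z\<bar> powr m0"
      using False T m0 by (intro mult_right_mono powr_mono2') auto
    finally show ?thesis using False by (simp add: g_def trunc_def)
  qed
  have "(\<integral>\<^sup>+\<omega>. ennreal (\<bar>g (Z i \<omega>)\<bar> * indicator (near i u) \<omega>) \<partial>M)
      \<le> (\<integral>\<^sup>+\<omega>. ennreal (T powr (1 - m0)) * ennreal (\<bar>f (Z i \<omega>)\<bar> powr m0 * indicator (near i u) \<omega>) \<partial>M)"
    using g_le by (intro nn_integral_mono) (auto simp: indicator_def ennreal_mult[symmetric] intro: ennreal_leI)
  also have "\<dots> = ennreal (T powr (1 - m0)) * (\<integral>\<^sup>+\<omega>. ennreal (\<bar>f (Z i \<omega>)\<bar> powr m0 * indicator (near i u) \<omega>) \<partial>M)"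
    by (intro nn_integral_cmult) measurable
  also have "\<dots> \<le> ennreal (T powr (1 - m0)) * ennreal (A * h)" by (intro mult_left_mono near) auto
  also have "\<dots> = ennreal ((A * T powr (1 - m0)) * h)" using A h_pos by (simp add: ennreal_mult[symmetric] mult_ac)
  finally have "(\<integral>\<^sup>+\<omega>. ennreal (\<bar>g (Z i \<omega>)\<bar> * indicator (near i u) \<omega>) \<partial>M) \<le> ennreal ((A * T powr (1 - m0)) * h)" .
  from abs_expectation_wterm_le[OF i gm this] A
  have g: "integrable M (wterm g i u)" "\<bar>expectation (wterm g i u)\<bar> \<le> W * (A * T powr (1 - m0)) * h"
    by auto
  have "wterm (trunc T f) i u = (\<lambda>\<omega>. wterm f i u \<omega> - wterm g i u \<omega>)"
    by (auto simp: wterm_def g_def algebra_simps)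
  then have "expectation (wterm (trunc T f) i u) = - expectation (wterm g i u)"
    using g(1) centred by (simp add: Bochner_Integration.integral_diff)
  then show ?thesis using g(2) by (simp add: mult_ac)
qed

lemma abs_le_powr_tail:
  fixes a p T m0 :: real
  assumes J: "finite J" "real (card J) \<le> p" and f: "\<And>j. j \<in> J \<Longrightarrow> f j \<in> borel_measurable N"
    and T: "0 < T" and m0: "0 < m0" and a: "0 \<le> a"
    and mom: "\<And>i j. i \<in> {1..n} \<Longrightarrow> j \<in> J \<Longrightarrow> (\<integral>\<^sup>+\<omega>. ennreal (\<bar>f j (Z i \<omega>)\<bar> powr m0) \<partial>M) \<le> ennreal a"
  shows "holds_off M (n * p * (a / T powr m0)) (\<lambda>\<omega>. \<forall>i\<in>{1..n}. \<forall>j\<in>J. \<bar>f j (Z i \<omega>)\<bar> \<le> T)"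
proof -
  have one: "holds_off M (a / T powr m0) (\<lambda>\<omega>. \<bar>f j (Z i \<omega>)\<bar> \<le> T)" if ij: "i \<in> {1..n}" "j \<in> J" for i j
  proof (rule holds_off_not)
    note [measurable] = fZ_meas[OF ij(1) f[OF ij(2)]]
    show E: "{\<omega> \<in> space M. \<not> \<bar>f j (Z i \<omega>)\<bar> \<le> T} \<in> sets M" by measurable
    have "emeasure M {\<omega> \<in> space M. \<not> \<bar>f j (Z i \<omega>)\<bar> \<le> T} = (\<integral>\<^sup>+\<omega>. indicator {\<omega> \<in> space M. \<not> \<bar>f j (Z i \<omega>)\<bar> \<le> T} \<omega> \<partial>M)"
      using E by simp
    also have "\<dots> \<le> (\<integral>\<^sup>+\<omega>. ennreal (1 / T powr m0) * ennreal (\<bar>f j (Z i \<omega>)\<bar> powr m0) \<partial>M)"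
    proof (intro nn_integral_mono)
      fix \<omega>
      have "1 \<le> 1 / T powr m0 * \<bar>f j (Z i \<omega>)\<bar> powr m0" if "\<not> \<bar>f j (Z i \<omega>)\<bar> \<le> T"
        using that T m0 powr_mono2[of m0 T "\<bar>f j (Z i \<omega>)\<bar>"] by (simp add: field_simps)
      then show "indicator {\<omega> \<in> space M. \<not> \<bar>f j (Z i \<omega>)\<bar> \<le> T} \<omega> \<le> ennreal (1 / T powr m0) * ennreal (\<bar>f j (Z i \<omega>)\<bar> powr m0)"
        by (auto simp: indicator_def ennreal_mult[symmetric])
    qed
    also have "\<dots> = ennreal (1 / T powr m0) * (\<integral>\<^sup>+\<omega>. ennreal (\<bar>f j (Z i \<omega>)\<bar> powr m0) \<partial>M)"
      by (intro nn_integral_cmult) measurable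
    also have "\<dots> \<le> ennreal (1 / T powr m0) * ennreal a" by (intro mult_left_mono mom ij) auto
    also have "\<dots> = ennreal (a / T powr m0)" using a by (simp add: ennreal_mult[symmetric])
    finally show "measure M {\<omega> \<in> space M. \<not> \<bar>f j (Z i \<omega>)\<bar> \<le> T} \<le> a / T powr m0"
      using a by (simp add: emeasure_eq_measure)
  qed
  have "holds_off M (card ({1..n} \<times> J) * (a / T powr m0)) (\<lambda>\<omega>. \<forall>(i, j)\<in>{1..n} \<times> J. \<bar>f j (Z i \<omega>)\<bar> \<le> T)"
    using J one by (intro holds_off_ball) auto
  then show ?thesis
  proof (rule holds_off_mono)
    have "card ({1..n} \<times> J) * (a / T powr m0) = n * (card J * (a / T powr m0))"
      by (simp add: card_cartesian_product)
    also have "\<dots> \<le> n * (p * (a / T powr m0))" using J a by (intro mult_left_mono mult_right_mono) auto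
    finally show "card ({1..n} \<times> J) * (a / T powr m0) \<le> n * p * (a / T powr m0)" by (simp add: mult_ac)
  qed auto
qed

lemma wsum_trunc:
  assumes "\<forall>i\<in>{1..n}. \<bar>f (Z i \<omega>)\<bar> \<le> T"
  shows "wsum (trunc T f) k \<omega> = wsum f k \<omega>"
  unfolding wsum_def wterm_def using assms by (intro sum.cong) (auto simp: trunc_def)

end

section \<open>Triangular arrays of kernel sums\<close>

text \<open>A union bound over n centres and at most d^3 coordinate tuples has logarithm at most ln
  n + 3 ln d. Once \<open>y\<close> exceeds 4 (ln n + ln d), the product with exp (- y) is at most 1
  / n.\<close>

lemma eventually_card_exp_le:
  fixes y :: "nat \<Rightarrow> real" and d :: "nat \<Rightarrow> nat" and C \<epsilon> :: real
  assumes d: "\<And>n. 1 \<le> d n" and y: "filterlim (\<lambda>n. y n / (ln (real n) + ln (real (d n)))) at_top sequentially"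
    and C: "0 \<le> C" and \<epsilon>: "0 < \<epsilon>"
  shows "\<forall>\<^sub>F n in sequentially. real n * real (d n) ^ 3 * (C * exp (- y n)) \<le> \<epsilon>"
proof -
  have "\<forall>\<^sub>F n in sequentially. 4 \<le> y n / (ln (real n) + ln (real (d n)))"
    using y by (auto simp: filterlim_at_top)
  moreover have "\<forall>\<^sub>F n in sequentially. max 3 (nat \<lceil>C / \<epsilon>\<rceil>) \<le> n" by (rule eventually_ge_at_top)
  ultimately show ?thesis
  proof eventually_elim
    case (elim n)
    have n: "3 \<le> n" "C / \<epsilon> \<le> real n" using elim by linarith+
    define L where "L = ln (real n) + ln (real (d n))"
    have ld: "0 \<le> ln (real (d n))" "0 < ln (real n)" using d[of n] n by auto
    then have L: "0 < L" by (simp add: L_def)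
    have yL: "4 * L \<le> y n" using elim(1) L by (simp add: L_def field_simps)
    have "real n * real (d n) ^ 3 = exp (ln (real n) + 3 * ln (real (d n)))"
      using n d[of n] by (simp add: exp_add exp_of_nat_mult[of 3, simplified])
    then have "real n * real (d n) ^ 3 * exp (- y n) = exp (ln (real n) + 3 * ln (real (d n)) - y n)"
      by (simp add: exp_diff exp_minus field_simps)
    also have "\<dots> \<le> exp (- ln (real n))" using yL ld by (simp add: L_def)
    also have "\<dots> = 1 / real n" using n by (simp add: exp_minus field_simps)
    finally have "C * (real n * real (d n) ^ 3 * exp (- y n)) \<le> C * (1 / real n)"
      using C by (rule mult_left_mono)
    also have "\<dots> \<le> \<epsilon>" using n \<epsilon> by (simp add: field_simps)
    finally show ?case by (simp add: mult_ac)
  qed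
qed

text \<open>One sample for every n, with constants \<open>W\<close>, \<open>B\<close>,
  \<open>cV\<close> independent of n. The families will be indexed by coordinates, pairs or triples
  of coordinates, whence the cube in \<open>J_card\<close>.\<close>

locale kernel_array =
  fixes M :: "nat \<Rightarrow> 'a measure" and N :: "nat \<Rightarrow> 'b measure" and Z :: "nat \<Rightarrow> nat \<Rightarrow> 'a \<Rightarrow> 'b"
    and V :: "'b \<Rightarrow> real" and w :: "real \<Rightarrow> real" and W B :: real and h :: "nat \<Rightarrow> real" and cV :: real
    and d :: "nat \<Rightarrow> nat" and J :: "nat \<Rightarrow> 'j set" and f :: "nat \<Rightarrow> 'j \<Rightarrow> 'b \<Rightarrow> real"
  assumes sample: "\<And>n. kernel_sample (M n) (N n) (Z n) n V w W B (h n) cV"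
    and d_ge: "\<And>n. 1 \<le> d n"
    and J_fin: "\<And>n. finite (J n)" and J_card: "\<And>n. real (card (J n)) \<le> real (d n) ^ 3"
    and f_meas: "\<And>n j. j \<in> J n \<Longrightarrow> f n j \<in> borel_measurable (N n)"
begin

abbreviation mclass where "mclass n \<equiv> kernel_sample.mgf_class (M n) (N n) (Z n) n V w W (h n)"
abbreviation term_at where "term_at n \<equiv> kernel_sample.wterm (Z n) V w (h n)"
abbreviation total where "total n \<equiv> kernel_sample.wsum (Z n) n V w (h n)"
abbreviation near_at where "near_at n i u \<equiv> {\<omega>. \<bar>V (Z n i \<omega>) - u\<bar> \<le> B * h n}"

abbreviation logs :: "nat \<Rightarrow> real" where "logs n \<equiv> ln (real n) + ln (real (d n))"

lemma consts_pos: "0 < W" "0 < B" "0 < h n" "0 < cV"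
  using sample[of n] by (auto simp: kernel_sample_def kernel_sample_axioms_def)

text \<open>The threshold v + m + 1 exceeds the quadratic and the mean term by 1 for every \<tau>
  \<le> 1, so the choice \<tau> = \<theta> leaves the exponent - n h \<theta>. The threshold
  contains neither \<theta> nor \<open>C\<close>, hence no truncation level.\<close>

lemma total_bounded_in_prob:
  fixes \<theta> :: "nat \<Rightarrow> real" and v m C \<epsilon> :: real
  assumes cls: "\<And>n j. j \<in> J n \<Longrightarrow> mclass n (g n j) (\<theta> n) v m C"
    and \<theta>: "\<forall>\<^sub>F n in sequentially. 0 \<le> \<theta> n \<and> \<theta> n \<le> 1"
    and rate: "filterlim (\<lambda>n. real n * h n * \<theta> n / logs n) at_top sequentially"
    and nn: "0 \<le> v" "0 \<le> m" "0 \<le> C" and \<epsilon>: "0 < \<epsilon>"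
  shows "\<forall>\<^sub>F n in sequentially. holds_off (M n) \<epsilon>
    (\<lambda>\<omega>. \<forall>k\<in>{1..n}. \<forall>j\<in>J n. \<bar>total n (g n j) k \<omega>\<bar> \<le> real n * h n * (v + m + 1))"
proof -
  have "\<forall>\<^sub>F n in sequentially. real n * real (d n) ^ 3 * (2 * C * exp (- (real n * h n * \<theta> n))) \<le> \<epsilon>"
    by (rule eventually_card_exp_le[OF d_ge rate]) (use nn \<epsilon> in auto)
  then show ?thesis using \<theta>
  proof eventually_elim
    case (elim n)
    have \<tau>: "0 \<le> \<theta> n" "\<theta> n \<le> 1" using elim by auto
    have "\<theta> n * (\<theta> n * v) \<le> 1 * (\<theta> n * v)" using \<tau> nn by (intro mult_right_mono) auto
    then have "(\<theta> n)\<^sup>2 * v + \<theta> n * m - \<theta> n * (v + m + 1) \<le> - \<theta> n"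
      by (simp add: power2_eq_square algebra_simps)
    then have "real n * h n * ((\<theta> n)\<^sup>2 * v + \<theta> n * m - \<theta> n * (v + m + 1)) \<le> real n * h n * (- \<theta> n)"
      using consts_pos(3)[of n] by (intro mult_left_mono) auto
    then have e: "real n * real (d n) ^ 3 * (2 * C * exp (real n * h n * ((\<theta> n)\<^sup>2 * v + \<theta> n * m - \<theta> n * (v + m + 1))))
      \<le> real n * real (d n) ^ 3 * (2 * C * exp (- (real n * h n * \<theta> n)))"
      using nn by (intro mult_left_mono) auto
    show ?case
      by (rule holds_off_mono[OF kernel_sample.wsum_family_tail[OF sample J_fin J_card cls \<tau>(1) order_refl nn]])
        (use order_trans[OF e elim(1)] in auto)
  qed
qed

text \<open>The best \<tau> for a threshold \<eta> lam is proportional to lam / v, but \<theta> caps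
  it; the gain in the exponent is therefore of order n h lam min (lam, \<theta>).\<close>

lemma total_small_in_prob:
  fixes \<theta> m lam :: "nat \<Rightarrow> real" and v C \<epsilon> \<eta> :: real
  assumes cls: "\<And>n j. j \<in> J n \<Longrightarrow> mclass n (g n j) (\<theta> n) v (m n) C"
    and \<theta>: "\<And>n. 0 \<le> \<theta> n" and lam: "\<And>n. 0 < lam n"
    and rate: "filterlim (\<lambda>n. real n * h n * lam n * min (lam n) (\<theta> n) / logs n) at_top sequentially"
    and m: "(\<lambda>n. m n / lam n) \<longlonglongrightarrow> 0" and m0: "\<And>n. 0 \<le> m n"
    and nn: "0 \<le> v" "0 \<le> C" and \<epsilon>: "0 < \<epsilon>" and \<eta>: "0 < \<eta>"
  shows "\<forall>\<^sub>F n in sequentially. holds_off (M n) \<epsilon>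
    (\<lambda>\<omega>. \<forall>k\<in>{1..n}. \<forall>j\<in>J n. \<bar>total n (g n j) k \<omega>\<bar> \<le> real n * h n * (\<eta> * lam n))"
proof -
  \<comment> \<open>Keeps the division by the variance meaningful when \<open>v\<close> is
    0.\<close>
  define v' where "v' = v + 1"
  have v': "0 < v'" "v \<le> v'" using nn by (auto simp: v'_def)
  \<comment> \<open>\<eta> / 4 is the share of the threshold left after the quadratic term has taken
    a quarter and the mean a half; the other factor compares \<tau> with min (lam,
    \<theta>).\<close>
  define c where "c = \<eta> / 4 * min 1 (\<eta> / (4 * v'))"
  have c: "0 < c" using \<eta> v' by (simp add: c_def)
  have "filterlim (\<lambda>n. c * (real n * h n * lam n * min (lam n) (\<theta> n) / logs n)) at_top sequentially"
    using c rate by (intro filterlim_tendsto_pos_mult_at_top[OF tendsto_const]) auto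
  then have rate': "filterlim (\<lambda>n. c * (real n * h n * lam n * min (lam n) (\<theta> n)) / logs n) at_top sequentially"
    by (simp add: field_simps)
  have "\<forall>\<^sub>F n in sequentially. real n * real (d n) ^ 3 * (2 * C * exp (- (c * (real n * h n * lam n * min (lam n) (\<theta> n))))) \<le> \<epsilon>"
    by (rule eventually_card_exp_le[OF d_ge rate']) (use nn \<epsilon> in auto)
  moreover have "\<forall>\<^sub>F n in sequentially. m n / lam n < \<eta> / 2"
    using m \<eta> by (intro order_tendstoD(2)[where y=0]) auto
  ultimately show ?thesis
  proof eventually_elim
    case (elim n)
    define \<tau> where "\<tau> = min (\<eta> * lam n / (4 * v')) (\<theta> n)"
    have \<tau>: "0 \<le> \<tau>" "\<tau> \<le> \<theta> n" "\<tau> \<le> \<eta> * lam n / (4 * v')"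
      using \<theta>[of n] lam[of n] \<eta> v' by (auto simp: \<tau>_def)
    have mn: "m n \<le> \<eta> * lam n / 2" using elim(2) lam[of n] by (simp add: field_simps)
    have "\<tau>\<^sup>2 * v \<le> \<tau> * (\<tau> * v')"
      unfolding power2_eq_square mult.assoc using \<tau> v' by (intro mult_left_mono) auto
    also have "\<dots> \<le> \<tau> * (\<eta> * lam n / 4)"
      using \<tau> v' by (intro mult_left_mono) (auto simp: field_simps)
    finally have 1: "\<tau>\<^sup>2 * v \<le> \<tau> * (\<eta> * lam n / 4)" .
    have 2: "\<tau> * m n \<le> \<tau> * (\<eta> * lam n / 2)" using mn \<tau> by (intro mult_left_mono) auto
    have 3: "lam n * min (lam n) (\<theta> n) * c \<le> \<tau> * (\<eta> * lam n / 4)"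
    proof -
      have mm: "0 \<le> min (lam n) (\<theta> n)" using lam[of n] \<theta>[of n] by auto
      have "min 1 (\<eta> / (4 * v')) * min (lam n) (\<theta> n) \<le> \<tau>"
        unfolding \<tau>_def
      proof (rule min.boundedI)
        have "min 1 (\<eta> / (4 * v')) * min (lam n) (\<theta> n) \<le> \<eta> / (4 * v') * lam n"
          using mm \<eta> v' by (intro mult_mono) auto
        then show "min 1 (\<eta> / (4 * v')) * min (lam n) (\<theta> n) \<le> \<eta> * lam n / (4 * v')" by simp
        have "min 1 (\<eta> / (4 * v')) * min (lam n) (\<theta> n) \<le> 1 * \<theta> n"
          using mm by (intro mult_mono) auto
        then show "min 1 (\<eta> / (4 * v')) * min (lam n) (\<theta> n) \<le> \<theta> n" by simp
      qed
      then have "\<eta> / 4 * lam n * (min 1 (\<eta> / (4 * v')) * min (lam n) (\<theta> n)) \<le> \<eta> / 4 * lam n * \<tau>"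
        using \<eta> lam[of n] by (intro mult_left_mono) auto
      then show ?thesis by (simp add: c_def mult_ac)
    qed
    have "\<tau>\<^sup>2 * v + \<tau> * m n - \<tau> * (\<eta> * lam n) \<le> - (lam n * min (lam n) (\<theta> n) * c)"
      using 1 2 3 by (simp add: algebra_simps)
    then have "real n * h n * (\<tau>\<^sup>2 * v + \<tau> * m n - \<tau> * (\<eta> * lam n)) \<le> real n * h n * (- (lam n * min (lam n) (\<theta> n) * c))"
      using consts_pos(3)[of n] by (intro mult_left_mono) auto
    also have "\<dots> = - (c * (real n * h n * lam n * min (lam n) (\<theta> n)))" by (simp add: mult_ac)
    finally have e: "real n * real (d n) ^ 3 * (2 * C * exp (real n * h n * (\<tau>\<^sup>2 * v + \<tau> * m n - \<tau> * (\<eta> * lam n))))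
      \<le> real n * real (d n) ^ 3 * (2 * C * exp (- (c * (real n * h n * lam n * min (lam n) (\<theta> n)))))"
      using nn by (intro mult_left_mono) auto
    show ?case
      by (rule holds_off_mono[OF kernel_sample.wsum_family_tail[OF sample J_fin J_card cls \<tau>(1,2) nn(1) m0 nn(2)]])
        (use order_trans[OF e elim(1)] in auto)
  qed
qed

text \<open>
  Under polynomial moments the variables are truncated at a large multiple of \<open>G n = (n d\<^sup>3)\<^bsup>1/m0\<^esup>\<close>, below which all of them lie with high probability.
\<close>

definition poly_moments :: "real \<Rightarrow> real \<Rightarrow> bool" where
  "poly_moments m0 A \<longleftrightarrow> 2 < m0 \<and> 0 \<le> A \<and> (\<forall>n. \<forall>j\<in>J n. \<forall>i\<in>{1..n}.
     (\<integral>\<^sup>+\<omega>. ennreal (\<bar>f n j (Z n i \<omega>)\<bar> powr m0) \<partial>M n) \<le> ennreal A \<and>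
     (\<forall>u. (\<integral>\<^sup>+\<omega>. ennreal (\<bar>f n j (Z n i \<omega>)\<bar> powr m0 * indicator (near_at n i u) \<omega>) \<partial>M n) \<le> ennreal (A * h n)))"

definition exp_moments :: "real \<Rightarrow> bool" where
  "exp_moments A \<longleftrightarrow> 0 \<le> A \<and> (\<forall>n. \<forall>j\<in>J n. \<forall>i\<in>{1..n}. \<forall>q\<ge>2.
     (\<integral>\<^sup>+\<omega>. ennreal (\<bar>f n j (Z n i \<omega>)\<bar> ^ q) \<partial>M n) \<le> ennreal (A * fact q) \<and>
     (\<forall>u. (\<integral>\<^sup>+\<omega>. ennreal (\<bar>f n j (Z n i \<omega>)\<bar> ^ q * indicator (near_at n i u) \<omega>) \<partial>M n) \<le> ennreal (A * fact q * h n)))"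

definition centred :: bool where
  "centred \<longleftrightarrow> (\<forall>n. \<forall>j\<in>J n. \<forall>i\<in>{1..n}. \<forall>u. integrable (M n) (term_at n (f n j) i u) \<and>
     integral\<^sup>L (M n) (term_at n (f n j) i u) = 0)"

definition G :: "real \<Rightarrow> nat \<Rightarrow> real" where
  "G m0 n = (real n * real (d n) ^ 3) powr (1 / m0)"

lemma exp_moments_abs_expectation_le:
  assumes mom: "exp_moments A" and j: "j \<in> J n" and i: "i \<in> {1..n}"
  shows "\<bar>integral\<^sup>L (M n) (term_at n (f n j) i u)\<bar> \<le> W * (cV * B + 2 * A) * h n"
proof -
  interpret kernel_sample "M n" "N n" "Z n" n V w W B "h n" cV by (rule sample)
  have A: "0 \<le> A" using mom by (simp add: exp_moments_def)
  have "(\<integral>\<^sup>+\<omega>. ennreal (\<bar>f n j (Z n i \<omega>)\<bar> ^ q * indicator (near_at n i u) \<omega>) \<partial>M n) \<le> ennreal (A * fact q * h n)"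
    if "2 \<le> q" for q
    using mom j i that unfolding exp_moments_def by blast
  from this[of 2] have mm: "(\<integral>\<^sup>+\<omega>. ennreal (\<bar>f n j (Z n i \<omega>)\<bar> ^ 2 * indicator (near_at n i u) \<omega>) \<partial>M n) \<le> ennreal (2 * A * h n)"
    by (simp add: mult_ac)
  show ?thesis
  proof (rule abs_expectation_wterm_le[OF i f_meas[OF j]])
    show "(\<integral>\<^sup>+\<omega>. ennreal (\<bar>f n j (Z n i \<omega>)\<bar> * indicator (near_at n i u) \<omega>) \<partial>M n) \<le> ennreal ((cV * B + 2 * A) * h n)"
    proof (rule near_integral_le[OF i _ _ _ mm])
      show "\<bar>f n j z\<bar> \<le> 1 + \<bar>f n j z\<bar>\<^sup>2" for z
        by (rule abs_le_1_plus_square)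
      show "(\<lambda>z. \<bar>f n j z\<bar>\<^sup>2) \<in> borel_measurable (N n)" using f_meas[OF j] by measurable
    qed (use A in auto)
    show "0 \<le> cV * B + 2 * A" using cV_pos B_pos A by auto
  qed
qed

text \<open>The Bernstein bound asks for \<tau> W \<le> 1/2, the fixed threshold in
  \<open>total_bounded_in_prob\<close> for \<tau> \<le> 1.\<close>

definition \<tau>W :: real where "\<tau>W = min 1 (1 / (2 * W))"

lemma \<tau>W: "0 < \<tau>W" "\<tau>W \<le> 1" "\<tau>W * W \<le> 1 / 2"
proof -
  show "0 < \<tau>W" "\<tau>W \<le> 1" using consts_pos(1) by (auto simp: \<tau>W_def)
  have "\<tau>W * W \<le> 1 / (2 * W) * W" using consts_pos(1) by (intro mult_right_mono) (auto simp: \<tau>W_def)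
  then show "\<tau>W * W \<le> 1 / 2" using consts_pos(1) by simp
qed

lemma exp_moments_mclass:
  assumes mom: "exp_moments A" and j: "j \<in> J n"
    and m: "\<And>i u. i \<in> {1..n} \<Longrightarrow> \<bar>integral\<^sup>L (M n) (term_at n (f n j) i u)\<bar> \<le> m * h n"
  shows "mclass n (f n j) \<tau>W (W\<^sup>2 * (2 * A)) m (exp (1 + 3 * A))"
proof -
  interpret kernel_sample "M n" "N n" "Z n" n V w W B "h n" cV by (rule sample)
  have A: "0 \<le> A" using mom by (auto simp: exp_moments_def)
  show ?thesis
    using mom j unfolding exp_moments_def
    by (intro mgf_class_bernstein f_meas less_imp_le[OF \<tau>W(1)] \<tau>W(3) A m) auto
qed

section \<open>Uniform control under factorial moments\<close>

lemma exp_moments_bounded: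
  assumes mom: "exp_moments A"
    and rate: "filterlim (\<lambda>n. real n * h n / logs n) at_top sequentially"
  shows "\<exists>C\<ge>0. \<forall>\<epsilon>>0. \<forall>\<^sub>F n in sequentially. holds_off (M n) \<epsilon>
    (\<lambda>\<omega>. \<forall>k\<in>{1..n}. \<forall>j\<in>J n. \<bar>total n (f n j) k \<omega>\<bar> \<le> real n * h n * C)"
proof -
  have A: "0 \<le> A" using mom by (auto simp: exp_moments_def)
  define m where "m = W * (cV * B + 2 * A)"
  have m: "0 \<le> m" using consts_pos A by (simp add: m_def less_imp_le)
  have "filterlim (\<lambda>n. \<tau>W * (real n * h n / logs n)) at_top sequentially"
    using \<tau>W rate by (intro filterlim_tendsto_pos_mult_at_top[OF tendsto_const]) auto
  then have "filterlim (\<lambda>n. real n * h n * \<tau>W / logs n) at_top sequentially" by (simp add: mult_ac)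
  from total_bounded_in_prob[OF exp_moments_mclass[OF mom] _ this _ m] exp_moments_abs_expectation_le[OF mom]
  have "\<forall>\<epsilon>>0. \<forall>\<^sub>F n in sequentially. holds_off (M n) \<epsilon>
    (\<lambda>\<omega>. \<forall>k\<in>{1..n}. \<forall>j\<in>J n. \<bar>total n (f n j) k \<omega>\<bar> \<le> real n * h n * (W\<^sup>2 * (2 * A) + m + 1))"
    using \<tau>W A by (auto simp: m_def)
  then show ?thesis using m A by (intro exI[of _ "W\<^sup>2 * (2 * A) + m + 1"]) auto
qed

lemma exp_moments_small:
  assumes mom: "exp_moments A" and c: centred and lam: "\<And>n. 0 < lam n" and lam0: "lam \<longlonglongrightarrow> 0"
    and rate: "filterlim (\<lambda>n. real n * h n * (lam n)\<^sup>2 / logs n) at_top sequentially"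
    and \<epsilon>: "0 < \<epsilon>" and \<eta>: "0 < \<eta>"
  shows "\<forall>\<^sub>F n in sequentially. holds_off (M n) \<epsilon>
    (\<lambda>\<omega>. \<forall>k\<in>{1..n}. \<forall>j\<in>J n. \<bar>total n (f n j) k \<omega>\<bar> \<le> real n * h n * (\<eta> * lam n))"
proof -
  have A: "0 \<le> A" using mom by (auto simp: exp_moments_def)
  \<comment> \<open>As \<open>lam\<close> tends to 0, the constant cap \<open>\<tau>W\<close> is
    eventually inactive and the gain is quadratic in \<open>lam\<close>.\<close>
  have "\<forall>\<^sub>F n in sequentially. lam n < \<tau>W" using lam0 \<tau>W by (intro order_tendstoD(2)[where y=0]) auto
  then have "\<forall>\<^sub>F n in sequentially. real n * h n * (lam n)\<^sup>2 / logs n = real n * h n * lam n * min (lam n) \<tau>W / logs n"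
    by eventually_elim (simp add: power2_eq_square)
  then have rate': "filterlim (\<lambda>n. real n * h n * lam n * min (lam n) \<tau>W / logs n) at_top sequentially"
    by (rule filterlim_cong[OF refl refl, THEN iffD1, OF _ rate])
  show ?thesis
    by (rule total_small_in_prob[where \<theta>="\<lambda>_. \<tau>W" and m="\<lambda>_. 0", OF exp_moments_mclass[OF mom]])
      (use c rate' lam \<tau>W A \<epsilon> \<eta> in \<open>auto simp: centred_def less_imp_le\<close>)
qed

section \<open>Uniform control under polynomial moments, by truncation\<close>

lemma poly_moments_trunc_tail:
  assumes mom: "poly_moments m0 A" and \<epsilon>: "0 < \<epsilon>"
  shows "\<exists>L>0. \<forall>n\<ge>1. holds_off (M n) \<epsilon> (\<lambda>\<omega>. \<forall>i\<in>{1..n}. \<forall>j\<in>J n. \<bar>f n j (Z n i \<omega>)\<bar> \<le> L * G m0 n)"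
proof -
  have A: "0 \<le> A" and m0: "2 < m0" using mom by (auto simp: poly_moments_def)
  \<comment> \<open>Chosen so that the union bound n d^3 A / (L G)^m0 equals \<epsilon> A / (A + 1):
    the power G^m0 cancels the number of variables exactly.\<close>
  define L where "L = ((A + 1) / \<epsilon>) powr (1 / m0)"
  have L: "0 < L" using A \<epsilon> by (simp add: L_def)
  have Lm: "L powr m0 = (A + 1) / \<epsilon>" using A \<epsilon> m0 by (simp add: L_def powr_powr)
  have "holds_off (M n) \<epsilon> (\<lambda>\<omega>. \<forall>i\<in>{1..n}. \<forall>j\<in>J n. \<bar>f n j (Z n i \<omega>)\<bar> \<le> L * G m0 n)" if n: "1 \<le> n" for n
  proof -
    interpret kernel_sample "M n" "N n" "Z n" n V w W B "h n" cV by (rule sample)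
    have pos: "0 < real n * real (d n) ^ 3" using n d_ge[of n] by auto
    have nd: "0 < n \<and> 0 < d n" using n d_ge[of n] by auto
    then have G: "0 < G m0 n" by (simp add: G_def)
    have Gm: "G m0 n powr m0 = real n * real (d n) ^ 3"
      using m0 nd by (simp add: G_def powr_powr)
    show ?thesis
    proof (rule holds_off_mono[OF abs_le_powr_tail[OF J_fin J_card f_meas]])
      show "0 < L * G m0 n" using L G by simp
      show "0 < m0" using m0 by simp
      have "real n * real (d n) ^ 3 * (A / (L * G m0 n) powr m0) = A / (A + 1) * \<epsilon>"
        using nd A \<epsilon> unfolding powr_mult Lm Gm by auto
      also have "\<dots> \<le> 1 * \<epsilon>" using A \<epsilon> by (intro mult_right_mono) auto
      finally show "real n * real (d n) ^ 3 * (A / (L * G m0 n) powr m0) \<le> \<epsilon>" by simp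
    qed (use A mom in \<open>auto simp: poly_moments_def\<close>)
  qed
  then show ?thesis using L by blast
qed

lemma poly_moments_near:
  assumes "poly_moments m0 A" "j \<in> J n" "i \<in> {1..n}"
  shows "(\<integral>\<^sup>+\<omega>. ennreal (\<bar>f n j (Z n i \<omega>)\<bar> powr m0 * indicator (near_at n i u) \<omega>) \<partial>M n) \<le> ennreal (A * h n)"
  using assms unfolding poly_moments_def by blast

lemma G_pos: "1 \<le> n \<Longrightarrow> 0 < G m0 n"
  using d_ge[of n] by (simp add: G_def)

lemma G_lim:
  assumes "0 < m0"
  shows "filterlim (G m0) at_top sequentially"
proof (rule filterlim_at_top_mono)
  have "filterlim (\<lambda>x::real. x powr (1 / m0)) at_top at_top" using assms by real_asymp
  then show "filterlim (\<lambda>n. real n powr (1 / m0)) at_top sequentially"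
    by (rule filterlim_compose) (rule filterlim_real_sequentially)
  show "\<forall>\<^sub>F n in sequentially. real n powr (1 / m0) \<le> G m0 n"
  proof (rule always_eventually, rule allI)
    fix n
    have "real n * 1 \<le> real n * real (d n) ^ 3"
      using d_ge[of n] by (intro mult_left_mono) auto
    then show "real n powr (1 / m0) \<le> G m0 n"
      unfolding G_def using assms by (intro powr_mono2) auto
  qed
qed

text \<open>Truncation levels must be positive also for \<open>n = 0\<close>, where \<open>G\<close> vanishes.\<close>

definition level :: "real \<Rightarrow> real \<Rightarrow> nat \<Rightarrow> real" where
  "level m0 L n = (if n = 0 then 1 else L * G m0 n)"

lemma level_pos: "0 < L \<Longrightarrow> 0 < level m0 L n"
  using G_pos[of n m0] by (simp add: level_def)

abbreviation cut :: "real \<Rightarrow> real \<Rightarrow> nat \<Rightarrow> 'j \<Rightarrow> 'b \<Rightarrow> real" where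
  "cut m0 L n j \<equiv> kernel_sample.trunc (level m0 L n) (f n j)"

lemma poly_moments_mclass:
  assumes mom: "poly_moments m0 A" and L: "0 < L" and j: "j \<in> J n"
    and m: "\<And>i u. i \<in> {1..n} \<Longrightarrow> \<bar>integral\<^sup>L (M n) (term_at n (cut m0 L n j) i u)\<bar> \<le> m * h n"
  shows "mclass n (cut m0 L n j) (1 / (W * level m0 L n)) (W\<^sup>2 * (cV * B + A)) m (exp 1)"
proof -
  interpret kernel_sample "M n" "N n" "Z n" n V w W B "h n" cV by (rule sample)
  have A: "0 \<le> A" and m0: "2 < m0" using mom by (auto simp: poly_moments_def)
  show ?thesis
    by (rule mgf_class_trunc[OF f_meas[OF j] level_pos[OF L] A m0 poly_moments_near[OF mom j] m])
qed

lemma total_cut: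
  assumes "1 \<le> n" "\<forall>i\<in>{1..n}. \<forall>j\<in>J n. \<bar>f n j (Z n i \<omega>)\<bar> \<le> L * G m0 n" "j \<in> J n"
  shows "total n (cut m0 L n j) k \<omega> = total n (f n j) k \<omega>"
proof -
  interpret kernel_sample "M n" "N n" "Z n" n V w W B "h n" cV by (rule sample)
  show ?thesis using assms by (intro wsum_trunc) (auto simp: level_def)
qed

lemma level_lim:
  assumes "0 < L" "0 < m0"
  shows "\<forall>\<^sub>F n in sequentially. 1 / (W * level m0 L n) = 1 / (W * L) * (1 / G m0 n) \<and> 1 / (W * level m0 L n) \<le> 1"
proof -
  have "\<forall>\<^sub>F n in sequentially. 1 / (W * L) \<le> G m0 n" using G_lim[OF assms(2)] by (auto simp: filterlim_at_top)
  moreover have "\<forall>\<^sub>F n in sequentially. 1 \<le> n" by (rule eventually_ge_at_top)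
  ultimately show ?thesis
  proof eventually_elim
    case (elim n)
    have "1 \<le> W * L * G m0 n" using elim(1) assms consts_pos(1) by (simp add: field_simps)
    then show ?case using elim(2) by (simp add: level_def mult.assoc)
  qed
qed

text \<open>The truncation level depends on \<epsilon> through \<open>L\<close>, but
  \<open>L\<close> changes the rate only by a constant factor. The bound v + m + 1 is the same for
  every \<epsilon>, as the order of the quantifiers demands.\<close>

lemma poly_moments_bounded:
  assumes mom: "poly_moments m0 A"
    and rate: "filterlim (\<lambda>n. real n * h n / (G m0 n * logs n)) at_top sequentially"
  shows "\<exists>C\<ge>0. \<forall>\<epsilon>>0. \<forall>\<^sub>F n in sequentially. holds_off (M n) \<epsilon>
    (\<lambda>\<omega>. \<forall>k\<in>{1..n}. \<forall>j\<in>J n. \<bar>total n (f n j) k \<omega>\<bar> \<le> real n * h n * C)"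
proof -
  have A: "0 \<le> A" and m0: "2 < m0" using mom by (auto simp: poly_moments_def)
  define m where "m = W * (cV * B + A)"
  define v where "v = W\<^sup>2 * (cV * B + A)"
  have mv: "0 \<le> m" "0 \<le> v" using consts_pos A by (simp_all add: m_def v_def less_imp_le)
  have "\<forall>\<^sub>F n in sequentially. holds_off (M n) \<epsilon>
    (\<lambda>\<omega>. \<forall>k\<in>{1..n}. \<forall>j\<in>J n. \<bar>total n (f n j) k \<omega>\<bar> \<le> real n * h n * (v + m + 1))"
    if \<epsilon>: "0 < \<epsilon>" for \<epsilon>
  proof -
    obtain L where L: "0 < L" and tail: "\<And>n. 1 \<le> n \<Longrightarrow>
        holds_off (M n) (\<epsilon> / 2) (\<lambda>\<omega>. \<forall>i\<in>{1..n}. \<forall>j\<in>J n. \<bar>f n j (Z n i \<omega>)\<bar> \<le> L * G m0 n)"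
      using poly_moments_trunc_tail[OF mom, of "\<epsilon> / 2"] \<epsilon> by auto
    have lev: "\<forall>\<^sub>F n in sequentially. 1 / (W * level m0 L n) = 1 / (W * L) * (1 / G m0 n) \<and> 1 / (W * level m0 L n) \<le> 1"
      using L m0 by (intro level_lim) auto
    have "filterlim (\<lambda>n. 1 / (W * L) * (real n * h n / (G m0 n * logs n))) at_top sequentially"
      using L consts_pos rate by (intro filterlim_tendsto_pos_mult_at_top[OF tendsto_const]) auto
    moreover have "\<forall>\<^sub>F n in sequentially. 1 / (W * L) * (real n * h n / (G m0 n * logs n))
        = real n * h n * (1 / (W * level m0 L n)) / logs n"
    proof (rule eventually_mono[OF lev])
      fix n assume "1 / (W * level m0 L n) = 1 / (W * L) * (1 / G m0 n) \<and> 1 / (W * level m0 L n) \<le> 1"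
      then have e: "1 / (W * level m0 L n) = 1 / (W * L) * (1 / G m0 n)" ..
      show "1 / (W * L) * (real n * h n / (G m0 n * logs n)) = real n * h n * (1 / (W * level m0 L n)) / logs n"
        unfolding e by simp
    qed
    ultimately have rate': "filterlim (\<lambda>n. real n * h n * (1 / (W * level m0 L n)) / logs n) at_top sequentially"
      by (rule filterlim_cong[OF refl refl, THEN iffD1, rotated])
    have "\<forall>\<^sub>F n in sequentially. holds_off (M n) (\<epsilon> / 2)
      (\<lambda>\<omega>. \<forall>k\<in>{1..n}. \<forall>j\<in>J n. \<bar>total n (cut m0 L n j) k \<omega>\<bar> \<le> real n * h n * (v + m + 1))"
    proof (rule total_bounded_in_prob[OF poly_moments_mclass[OF mom L, folded v_def] _ rate' mv(2,1)])
      show "\<bar>integral\<^sup>L (M n) (term_at n (cut m0 L n j) i u)\<bar> \<le> m * h n" if "j \<in> J n" "i \<in> {1..n}" for n j i u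
      proof -
        interpret kernel_sample "M n" "N n" "Z n" n V w W B "h n" cV by (rule sample)
        show ?thesis unfolding m_def
          by (rule expectation_wterm_trunc_le[OF f_meas[OF that(1)] A m0 that(2) poly_moments_near[OF mom that]])
      qed
      show "\<forall>\<^sub>F n in sequentially. 0 \<le> 1 / (W * level m0 L n) \<and> 1 / (W * level m0 L n) \<le> 1"
        using lev by eventually_elim (use level_pos[OF L] consts_pos(1) in \<open>auto simp: less_imp_le\<close>)
    qed (use \<epsilon> in auto)
    moreover have "\<forall>\<^sub>F n in sequentially. 1 \<le> n" by (rule eventually_ge_at_top)
    ultimately show ?thesis
    proof eventually_elim
      case (elim n)
      interpret kernel_sample "M n" "N n" "Z n" n V w W B "h n" cV by (rule sample)
      show ?case
        by (rule holds_off_mono[OF holds_off_conj[OF elim(1) tail[OF elim(2)]]])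
          (use total_cut[OF elim(2)] in auto)
    qed
  qed
  then show ?thesis using mv by (intro exI[of _ "v + m + 1"]) auto
qed

text \<open>Truncation trades centring for boundedness: \<open>rate\<close> says that the level is
  low enough for the exponential bound, \<open>bias\<close> that it is high enough for the lost mean
  to be o(lam).\<close>

lemma poly_moments_small:
  assumes mom: "poly_moments m0 A" and c: centred and lam: "\<And>n. 0 < lam n"
    and rate: "filterlim (\<lambda>n. real n * h n * lam n * min (lam n) (1 / G m0 n) / logs n) at_top sequentially"
    and bias: "(\<lambda>n. G m0 n powr (1 - m0) / lam n) \<longlonglongrightarrow> 0"
    and \<epsilon>: "0 < \<epsilon>" and \<eta>: "0 < \<eta>"
  shows "\<forall>\<^sub>F n in sequentially. holds_off (M n) \<epsilon>
    (\<lambda>\<omega>. \<forall>k\<in>{1..n}. \<forall>j\<in>J n. \<bar>total n (f n j) k \<omega>\<bar> \<le> real n * h n * (\<eta> * lam n))"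
proof -
  have A: "0 \<le> A" and m0: "2 < m0" using mom by (auto simp: poly_moments_def)
  define v where "v = W\<^sup>2 * (cV * B + A)"
  have v: "0 \<le> v" using consts_pos A by (simp add: v_def less_imp_le)
  obtain L where L: "0 < L" and tail: "\<And>n. 1 \<le> n \<Longrightarrow>
      holds_off (M n) (\<epsilon> / 2) (\<lambda>\<omega>. \<forall>i\<in>{1..n}. \<forall>j\<in>J n. \<bar>f n j (Z n i \<omega>)\<bar> \<le> L * G m0 n)"
    using poly_moments_trunc_tail[OF mom, of "\<epsilon> / 2"] \<epsilon> by auto
  have lev: "\<forall>\<^sub>F n in sequentially. 1 / (W * level m0 L n) = 1 / (W * L) * (1 / G m0 n) \<and> 1 / (W * level m0 L n) \<le> 1"
    using L m0 by (intro level_lim) auto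
  have n1: "\<forall>\<^sub>F n in sequentially. 2 \<le> (n::nat)" by (rule eventually_ge_at_top)
  \<comment> \<open>The smaller of the factors 1 and 1 / (W L) survives when the cap 1 / (W level)
    is compared with 1 / G inside the minimum.\<close>
  define r where "r = min 1 (1 / (W * L))"
  have r: "0 < r" using L consts_pos by (simp add: r_def)
  have "filterlim (\<lambda>n. r * (real n * h n * lam n * min (lam n) (1 / G m0 n) / logs n)) at_top sequentially"
    using r rate by (intro filterlim_tendsto_pos_mult_at_top[OF tendsto_const]) auto
  then have rate': "filterlim (\<lambda>n. real n * h n * lam n * min (lam n) (1 / (W * level m0 L n)) / logs n) at_top sequentially"
  proof (rule filterlim_at_top_mono)
    show "\<forall>\<^sub>F n in sequentially. r * (real n * h n * lam n * min (lam n) (1 / G m0 n) / logs n)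
        \<le> real n * h n * lam n * min (lam n) (1 / (W * level m0 L n)) / logs n"
      using lev n1
    proof eventually_elim
      case (elim n)
      have G: "0 < G m0 n" using elim(2) by (intro G_pos) auto
      have "r * min (lam n) (1 / G m0 n) \<le> 1 * lam n"
        using lam[of n] r G by (intro mult_mono) (auto simp: r_def)
      moreover have "r * min (lam n) (1 / G m0 n) \<le> 1 / (W * L) * (1 / G m0 n)"
        using lam[of n] r G L consts_pos by (intro mult_mono) (auto simp: r_def)
      ultimately have "r * min (lam n) (1 / G m0 n) \<le> min (lam n) (1 / (W * level m0 L n))"
        using elim(1) by (metis min.boundedI mult_1)
      then have "real n * h n * lam n * (r * min (lam n) (1 / G m0 n)) / logs n
          \<le> real n * h n * lam n * min (lam n) (1 / (W * level m0 L n)) / logs n"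
        using consts_pos(3)[of n] lam[of n] d_ge[of n] elim(2)
        by (intro divide_right_mono mult_left_mono) (auto intro!: add_nonneg_nonneg)
      then show ?case by (simp add: mult_ac)
    qed
  qed
  define m where "m n = W * A * level m0 L n powr (1 - m0)" for n
  have "(\<lambda>n. W * A * L powr (1 - m0) * (G m0 n powr (1 - m0) / lam n)) \<longlonglongrightarrow> W * A * L powr (1 - m0) * 0"
    by (intro tendsto_mult_left bias)
  moreover have "\<forall>\<^sub>F n in sequentially. W * A * L powr (1 - m0) * (G m0 n powr (1 - m0) / lam n) = m n / lam n"
    using n1 by eventually_elim (use L G_pos in \<open>auto simp: m_def level_def powr_mult less_imp_le\<close>)
  ultimately have "(\<lambda>n. m n / lam n) \<longlonglongrightarrow> W * A * L powr (1 - m0) * 0"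
    by (rule filterlim_cong[OF refl refl, THEN iffD1, rotated])
  then have mlim: "(\<lambda>n. m n / lam n) \<longlonglongrightarrow> 0" by simp
  have "\<forall>\<^sub>F n in sequentially. holds_off (M n) (\<epsilon> / 2)
    (\<lambda>\<omega>. \<forall>k\<in>{1..n}. \<forall>j\<in>J n. \<bar>total n (cut m0 L n j) k \<omega>\<bar> \<le> real n * h n * (\<eta> * lam n))"
  proof (rule total_small_in_prob[OF poly_moments_mclass[OF mom L, folded v_def] _ lam rate' mlim _ v])
    show "\<bar>integral\<^sup>L (M n) (term_at n (cut m0 L n j) i u)\<bar> \<le> m n * h n" if "j \<in> J n" "i \<in> {1..n}" for n j i u
    proof -
      interpret kernel_sample "M n" "N n" "Z n" n V w W B "h n" cV by (rule sample)
      show ?thesis unfolding m_def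
        by (rule expectation_wterm_trunc_centred_le[OF f_meas[OF that(1)] level_pos[OF L] A m0 that(2)
              poly_moments_near[OF mom that]])
          (use c that in \<open>auto simp: centred_def\<close>)
    qed
    show "0 \<le> 1 / (W * level m0 L n)" for n
      using level_pos[OF L, of m0 n] consts_pos(1) by (simp add: less_imp_le)
    show "0 \<le> m n" for n using A consts_pos(1) by (simp add: m_def less_imp_le)
  qed (use \<epsilon> \<eta> in auto)
  then show ?thesis using n1
  proof eventually_elim
    case (elim n)
    interpret kernel_sample "M n" "N n" "Z n" n V w W B "h n" cV by (rule sample)
    have n: "1 \<le> n" using elim by simp
    show ?case
      by (rule holds_off_mono[OF holds_off_conj[OF elim(1) tail[OF n]]])
        (use total_cut[OF n] in auto)
  qed
qed

end

section \<open>Penalised likelihood: the deterministic estimate\<close>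

text \<open>The expansion is around \<open>s\<close>, but the second derivative is Lipschitz only
  relative to \<open>r\<close>; comparing its value at the intermediate point with that at
  \<open>r\<close> costs the distance |s - r| + |\<delta>|. An upper bound suffices because the
  likelihood of a competitor of \<theta> is to be bounded from above.\<close>

lemma taylor2_upper:
  fixes f f1 f2 :: "real \<Rightarrow> real"
  assumes f: "\<And>x. (f has_real_derivative f1 x) (at x)" and f1: "\<And>x. (f1 has_real_derivative f2 x) (at x)"
    and lip: "\<And>e. \<bar>f2 (r + e) - f2 r\<bar> \<le> M * \<bar>e\<bar>" and M: "0 \<le> M"
  shows "f (s + \<delta>) \<le> f s + f1 s * \<delta> + 1/2 * (f2 r + M * (\<bar>s - r\<bar> + \<bar>\<delta>\<bar>)) * \<delta>\<^sup>2"
proof (cases "\<delta> = 0")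
  case False
  define diff where "diff m = (if m = 0 then f else if m = Suc 0 then f1 else f2)" for m
  have "\<exists>t. (if s + \<delta> < s then s + \<delta> < t \<and> t < s else s < t \<and> t < s + \<delta>) \<and>
      f (s + \<delta>) = (\<Sum>m<2. (diff m s / fact m) * (s + \<delta> - s) ^ m) + (diff 2 t / fact 2) * (s + \<delta> - s) ^ 2"
    by (rule Taylor[where a="s - \<bar>\<delta>\<bar>" and b="s + \<bar>\<delta>\<bar>"])
      (use False f f1 in \<open>auto simp: diff_def less_Suc_eq numeral_2_eq_2\<close>)
  then obtain t where t0: "if s + \<delta> < s then s + \<delta> < t \<and> t < s else s < t \<and> t < s + \<delta>"
    and eq0: "f (s + \<delta>) = (\<Sum>m<2. (diff m s / fact m) * (s + \<delta> - s) ^ m) + (diff 2 t / fact 2) * (s + \<delta> - s) ^ 2"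
    by blast
  have t: "\<bar>t - s\<bar> \<le> \<bar>\<delta>\<bar>" using t0 by (auto split: if_splits)
  have eq: "f (s + \<delta>) = f s + f1 s * \<delta> + f2 t / 2 * \<delta>\<^sup>2"
    using eq0 by (simp add: diff_def numeral_2_eq_2)
  have "f2 t - f2 r \<le> M * \<bar>t - r\<bar>" using lip[of "t - r"] by (simp add: abs_le_iff)
  also have "\<dots> \<le> M * (\<bar>s - r\<bar> + \<bar>\<delta>\<bar>)" using t M by (intro mult_left_mono) auto
  finally have "1/2 * f2 t * \<delta>\<^sup>2 \<le> 1/2 * (f2 r + M * (\<bar>s - r\<bar> + \<bar>\<delta>\<bar>)) * \<delta>\<^sup>2"
    by (intro mult_right_mono mult_left_mono) auto
  then show ?thesis using eq by simp
qed simp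

lemma taylor1_remainder:
  fixes f1 f2 :: "real \<Rightarrow> real"
  assumes f1: "\<And>x. (f1 has_real_derivative f2 x) (at x)"
    and lip: "\<And>e. \<bar>f2 (r + e) - f2 r\<bar> \<le> M * \<bar>e\<bar>" and M: "0 \<le> M"
  shows "\<bar>f1 s - f1 r - f2 r * (s - r)\<bar> \<le> M * (s - r)\<^sup>2"
proof (cases "s = r")
  case False
  have "\<exists>t. \<bar>t - r\<bar> \<le> \<bar>s - r\<bar> \<and> f1 s - f1 r = (s - r) * f2 t"
  proof (cases "r < s")
    case True
    then show ?thesis using MVT2[of r s f1 f2] f1 by (metis abs_of_nonneg diff_ge_0_iff_ge diff_right_mono less_imp_le)
  next
    case False
    with \<open>s \<noteq> r\<close> have "s < r" by simp
    then obtain t where "s < t" "t < r" "f1 r - f1 s = (r - s) * f2 t" using MVT2[of s r f1 f2] f1 by blast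
    then show ?thesis by (intro exI[of _ t]) (auto simp: algebra_simps)
  qed
  then obtain t where t: "\<bar>t - r\<bar> \<le> \<bar>s - r\<bar>" "f1 s - f1 r = (s - r) * f2 t" by blast
  have "\<bar>f1 s - f1 r - f2 r * (s - r)\<bar> = \<bar>f2 t - f2 r\<bar> * \<bar>s - r\<bar>"
    unfolding t(2) by (simp add: abs_mult[symmetric] algebra_simps)
  also have "\<dots> \<le> (M * \<bar>s - r\<bar>) * \<bar>s - r\<bar>"
    using lip[of "t - r"] t(1) M by (intro mult_right_mono) (auto intro: order_trans[OF _ mult_left_mono])
  finally show ?thesis by (simp add: power2_eq_square)
qed simp

lemma sum_abs_le_sqrt_card:
  fixes v :: "'p \<Rightarrow> real"
  shows "(\<Sum>p\<in>S. \<bar>v p\<bar>) \<le> sqrt (real (card S)) * L2_set v S"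
  using L2_set_mult_ineq[of "\<lambda>_. 1" v S] by (simp add: L2_set_constant)

text \<open>
  In the application \<open>P = {1, 2} \<times> {1..d}\<close> indexes the coordinates of \<open>(a\<^sub>k, h b\<^sub>k)\<close>, \<open>S = {1, 2} \<times> {1..s}\<close>
  and \<open>z i (l + 1, j) = x\<^sub>i\<^sub>j ((U\<^sub>i - U\<^sub>k) / h)\<^sup>l\<close>; the true predictor \<open>r i\<close> differs from
  its local linear approximation by the smoothing bias.
\<close>

locale local_lasso =
  fixes I :: "'i set" and P S :: "'p set" and w r Mv :: "'i \<Rightarrow> real" and f f1 f2 :: "'i \<Rightarrow> real \<Rightarrow> real"
    and z c :: "'i \<Rightarrow> 'p \<Rightarrow> real" and \<theta> lam :: "'p \<Rightarrow> real" and lmin lmax B D g C2 C3 \<kappa> \<rho> :: real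
  assumes fin: "finite I" "finite P" "S \<subseteq> P"
    and w: "\<And>i. i \<in> I \<Longrightarrow> 0 \<le> w i"
    and f: "\<And>i x. i \<in> I \<Longrightarrow> (f i has_real_derivative f1 i x) (at x)"
    and f1: "\<And>i x. i \<in> I \<Longrightarrow> (f1 i has_real_derivative f2 i x) (at x)"
    and f2: "\<And>i x. i \<in> I \<Longrightarrow> f2 i x \<le> 0"
    and lip: "\<And>i e. i \<in> I \<Longrightarrow> \<bar>f2 i (r i + e) - f2 i (r i)\<bar> \<le> Mv i * \<bar>e\<bar>"
    and Mv: "\<And>i. i \<in> I \<Longrightarrow> 0 \<le> Mv i"
    and c: "\<And>i p. i \<in> I \<Longrightarrow> p \<in> P \<Longrightarrow> 0 \<le> c i p"
    and z: "\<And>i p. i \<in> I \<Longrightarrow> p \<in> P \<Longrightarrow> w i \<noteq> 0 \<Longrightarrow> \<bar>z i p\<bar> \<le> B * c i p"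
    and bias: "\<And>i. i \<in> I \<Longrightarrow> w i \<noteq> 0 \<Longrightarrow> \<bar>(\<Sum>p\<in>P. \<theta> p * z i p) - r i\<bar> \<le> D * (\<Sum>p\<in>S. c i p)"
    and sparse: "\<And>p. p \<in> P - S \<Longrightarrow> \<theta> p = 0"
    and lam: "\<And>p. p \<in> P \<Longrightarrow> lmin \<le> lam p \<and> lam p \<le> lmax" and lmin: "0 < lmin" "lmin \<le> lmax"
    and const_nonneg: "0 \<le> B" "0 \<le> D" "0 \<le> g" "0 \<le> C2" "0 \<le> C3" "0 < \<rho>"
    and score: "\<And>p. p \<in> P \<Longrightarrow> \<bar>\<Sum>i\<in>I. w i * (f1 i (r i) * z i p)\<bar> \<le> g"
    and curv: "\<And>p q. p \<in> P \<Longrightarrow> q \<in> P \<Longrightarrow> (\<Sum>i\<in>I. w i * (\<bar>f2 i (r i)\<bar> * c i p * c i q)) \<le> C2"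
    and third: "\<And>p q t. p \<in> P \<Longrightarrow> q \<in> P \<Longrightarrow> t \<in> P \<Longrightarrow> (\<Sum>i\<in>I. w i * (Mv i * c i p * c i q * c i t)) \<le> C3"
    and \<kappa>: "2 * lmax / lmin + 2 \<le> \<kappa>"
    and restr: "\<And>v. L2_set v P = 1 \<Longrightarrow> (\<Sum>p\<in>P. \<bar>v p\<bar>) \<le> \<kappa> * (\<Sum>p\<in>S. \<bar>v p\<bar>) \<Longrightarrow>
      \<rho> \<le> (\<Sum>i\<in>I. w i * (- f2 i (r i) * (\<Sum>p\<in>P. v p * z i p)\<^sup>2))"
    and grad_small: "g + B * C2 * D * real (card S) + B * C3 * D\<^sup>2 * (real (card S))\<^sup>2 \<le> lmin / 2"
begin

definition pen :: "('p \<Rightarrow> real) \<Rightarrow> real" where "pen \<beta> = (\<Sum>p\<in>P. lam p * \<bar>\<beta> p\<bar>)"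
definition lik :: "('p \<Rightarrow> real) \<Rightarrow> real" where "lik \<beta> = (\<Sum>i\<in>I. w i * f i (\<Sum>p\<in>P. \<beta> p * z i p))"
definition lp :: "('p \<Rightarrow> real) \<Rightarrow> 'i \<Rightarrow> real" where "lp \<beta> i = (\<Sum>p\<in>P. \<beta> p * z i p)"

lemma kappa_pos: "0 < \<kappa>"
proof -
  have "0 \<le> 2 * lmax / lmin" using lmin by auto
  then show ?thesis using \<kappa> by linarith
qed

text \<open>Bounds on the summands are available only where the kernel weight does not vanish, that
  is, for observations close to the centre.\<close>

lemma w_sum_mono:
  assumes "\<And>i. i \<in> I \<Longrightarrow> w i \<noteq> 0 \<Longrightarrow> F i \<le> G i"
  shows "(\<Sum>i\<in>I. w i * F i) \<le> (\<Sum>i\<in>I. w i * G i)"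
proof (rule sum_mono)
  show "w i * F i \<le> w i * G i" if "i \<in> I" for i
    using assms[OF that] w[OF that] by (cases "w i = 0") (auto intro: mult_left_mono)
qed

lemma w_sum_abs:
  assumes "\<And>i. i \<in> I \<Longrightarrow> w i \<noteq> 0 \<Longrightarrow> \<bar>F i\<bar> \<le> G i"
  shows "\<bar>\<Sum>i\<in>I. w i * F i\<bar> \<le> (\<Sum>i\<in>I. w i * G i)"
proof -
  have "\<bar>\<Sum>i\<in>I. w i * F i\<bar> \<le> (\<Sum>i\<in>I. w i * \<bar>F i\<bar>)"
    by (rule order_trans[OF sum_abs]) (use w in \<open>auto simp: abs_mult intro!: sum_mono\<close>)
  then show ?thesis using w_sum_mono[of "\<lambda>i. \<bar>F i\<bar>" G] assms by fastforce
qed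

lemma third_S:
  assumes "p \<in> P"
  shows "(\<Sum>i\<in>I. w i * (Mv i * c i p * (\<Sum>q\<in>S. c i q)\<^sup>2)) \<le> C3 * (real (card S))\<^sup>2"
proof -
  have "(\<Sum>i\<in>I. w i * (Mv i * c i p * (\<Sum>q\<in>S. c i q)\<^sup>2))
      = (\<Sum>q\<in>S. \<Sum>t\<in>S. \<Sum>i\<in>I. w i * (Mv i * c i p * c i q * c i t))"
    by (subst (2) sum.swap, subst sum.swap, subst sum.swap)
      (simp add: power2_eq_square sum_product sum_distrib_left sum_distrib_right mult_ac sum.swap[of _ S I])
  also have "\<dots> \<le> (\<Sum>q\<in>S. \<Sum>t\<in>S. C3)"
    using assms fin by (intro sum_mono third) auto
  finally show ?thesis by (simp add: power2_eq_square mult_ac)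
qed

lemma curv_S:
  assumes "p \<in> P"
  shows "(\<Sum>i\<in>I. w i * (\<bar>f2 i (r i)\<bar> * c i p * (\<Sum>q\<in>S. c i q))) \<le> C2 * real (card S)"
proof -
  have "(\<Sum>i\<in>I. w i * (\<bar>f2 i (r i)\<bar> * c i p * (\<Sum>q\<in>S. c i q)))
      = (\<Sum>q\<in>S. \<Sum>i\<in>I. w i * (\<bar>f2 i (r i)\<bar> * c i p * c i q))"
    by (subst sum.swap) (simp add: sum_distrib_left sum_distrib_right mult_ac)
  also have "\<dots> \<le> (\<Sum>q\<in>S. C2)"
    using assms fin by (intro sum_mono curv) auto
  finally show ?thesis by (simp add: mult_ac)
qed

lemma c_S: "i \<in> I \<Longrightarrow> 0 \<le> (\<Sum>q\<in>S. c i q)"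
  using c fin by (intro sum_nonneg) auto

text \<open>The score is controlled at the true predictor \<open>r\<close>, while the comparison
  point \<theta> is its local linear approximation. Expanding \<open>f1\<close> around
  \<open>r\<close> gives a part linear in the bias and a quadratic remainder; together with the
  score these are the three terms of \<open>grad_small\<close>.\<close>

lemma gradient_le:
  assumes p: "p \<in> P"
  shows "\<bar>\<Sum>i\<in>I. w i * (f1 i (lp \<theta> i) * z i p)\<bar> \<le> lmin / 2"
proof -
  define e where "e i = f1 i (lp \<theta> i) - f1 i (r i) - f2 i (r i) * (lp \<theta> i - r i)" for i
  have e: "\<bar>e i\<bar> \<le> Mv i * (lp \<theta> i - r i)\<^sup>2" if "i \<in> I" for i
    unfolding e_def by (rule taylor1_remainder[OF f1[OF that] lip[OF that] Mv[OF that]])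
  have b: "\<bar>lp \<theta> i - r i\<bar> \<le> D * (\<Sum>q\<in>S. c i q)" if "i \<in> I" "w i \<noteq> 0" for i
    using bias[OF that] by (simp add: lp_def)
  have "(\<Sum>i\<in>I. w i * (f1 i (lp \<theta> i) * z i p)) = (\<Sum>i\<in>I. w i * (f1 i (r i) * z i p))
      + (\<Sum>i\<in>I. w i * (f2 i (r i) * (lp \<theta> i - r i) * z i p)) + (\<Sum>i\<in>I. w i * (e i * z i p))"
    by (simp add: e_def sum.distrib[symmetric] algebra_simps)
  moreover have "\<bar>\<Sum>i\<in>I. w i * (f1 i (r i) * z i p)\<bar> \<le> g" by (rule score[OF p])
  moreover have "\<bar>\<Sum>i\<in>I. w i * (f2 i (r i) * (lp \<theta> i - r i) * z i p)\<bar> \<le> B * C2 * D * real (card S)"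
  proof -
    have "\<bar>\<Sum>i\<in>I. w i * (f2 i (r i) * (lp \<theta> i - r i) * z i p)\<bar>
        \<le> (\<Sum>i\<in>I. w i * (\<bar>f2 i (r i)\<bar> * (D * (\<Sum>q\<in>S. c i q)) * (B * c i p)))"
      by (rule w_sum_abs) (use z b p const_nonneg c_S in \<open>auto simp: abs_mult intro!: mult_mono mult_nonneg_nonneg\<close>)
    also have "\<dots> = B * D * (\<Sum>i\<in>I. w i * (\<bar>f2 i (r i)\<bar> * c i p * (\<Sum>q\<in>S. c i q)))"
      by (simp add: sum_distrib_left sum_distrib_right mult_ac)
    also have "\<dots> \<le> B * D * (C2 * real (card S))" using const_nonneg by (intro mult_left_mono curv_S p) auto
    finally show ?thesis by (simp add: mult_ac)
  qed
  moreover have "\<bar>\<Sum>i\<in>I. w i * (e i * z i p)\<bar> \<le> B * C3 * D\<^sup>2 * (real (card S))\<^sup>2"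
  proof -
    have "\<bar>\<Sum>i\<in>I. w i * (e i * z i p)\<bar> \<le> (\<Sum>i\<in>I. w i * ((Mv i * (D * (\<Sum>q\<in>S. c i q))\<^sup>2) * (B * c i p)))"
    proof (rule w_sum_abs)
      fix i assume i: "i \<in> I" "w i \<noteq> 0"
      have "\<bar>lp \<theta> i - r i\<bar>\<^sup>2 \<le> (D * (\<Sum>q\<in>S. c i q))\<^sup>2" by (rule power_mono[OF b[OF i]]) auto
      then have "\<bar>e i\<bar> \<le> Mv i * (D * (\<Sum>q\<in>S. c i q))\<^sup>2"
        using e[OF i(1)] Mv[OF i(1)] by (auto intro: order_trans[OF _ mult_left_mono])
      then show "\<bar>e i * z i p\<bar> \<le> (Mv i * (D * (\<Sum>q\<in>S. c i q))\<^sup>2) * (B * c i p)"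
        unfolding abs_mult using z[OF i(1) p i(2)] Mv[OF i(1)] by (intro mult_mono) auto
    qed
    also have "\<dots> = B * D\<^sup>2 * (\<Sum>i\<in>I. w i * (Mv i * c i p * (\<Sum>q\<in>S. c i q)\<^sup>2))"
      unfolding sum_distrib_left[of "B * D\<^sup>2"] power_mult_distrib by (simp add: mult_ac)
    also have "\<dots> \<le> B * D\<^sup>2 * (C3 * (real (card S))\<^sup>2)" using const_nonneg by (intro mult_left_mono third_S p) auto
    finally show ?thesis by (simp add: mult_ac)
  qed
  ultimately show ?thesis using grad_small by linarith
qed

lemma linear_le:
  "(\<Sum>i\<in>I. w i * (f1 i (lp \<theta> i) * lp \<Delta> i)) \<le> lmin / 2 * (\<Sum>p\<in>P. \<bar>\<Delta> p\<bar>)"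
proof -
  have "(\<Sum>i\<in>I. w i * (f1 i (lp \<theta> i) * lp \<Delta> i)) = (\<Sum>p\<in>P. \<Delta> p * (\<Sum>i\<in>I. w i * (f1 i (lp \<theta> i) * z i p)))"
    unfolding lp_def[of \<Delta>] by (simp add: sum_distrib_left mult_ac) (rule sum.swap)
  also have "\<dots> \<le> (\<Sum>p\<in>P. \<bar>\<Delta> p\<bar> * (lmin / 2))"
  proof (rule sum_mono)
    fix p assume p: "p \<in> P"
    have "\<Delta> p * (\<Sum>i\<in>I. w i * (f1 i (lp \<theta> i) * z i p)) \<le> \<bar>\<Delta> p\<bar> * \<bar>\<Sum>i\<in>I. w i * (f1 i (lp \<theta> i) * z i p)\<bar>"
      unfolding abs_mult[symmetric] by (rule abs_ge_self)
    also have "\<dots> \<le> \<bar>\<Delta> p\<bar> * (lmin / 2)" by (intro mult_left_mono gradient_le p) auto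
    finally show "\<Delta> p * (\<Sum>i\<in>I. w i * (f1 i (lp \<theta> i) * z i p)) \<le> \<bar>\<Delta> p\<bar> * (lmin / 2)" .
  qed
  also have "\<dots> = lmin / 2 * (\<Sum>p\<in>P. \<bar>\<Delta> p\<bar>)" by (simp add: sum_distrib_left mult_ac)
  finally show ?thesis .
qed

text \<open>Off \<open>S\<close> the target vanishes, so the penalty grows there by the full size of
  \<Delta>; on \<open>S\<close> the triangle inequality bounds the loss.\<close>

lemma pen_diff:
  "lmin * (\<Sum>p\<in>P - S. \<bar>\<Delta> p\<bar>) - lmax * (\<Sum>p\<in>S. \<bar>\<Delta> p\<bar>) \<le> pen (\<lambda>p. \<theta> p + \<Delta> p) - pen \<theta>"
proof -
  have "pen (\<lambda>p. \<theta> p + \<Delta> p) - pen \<theta> = (\<Sum>p\<in>P. lam p * (\<bar>\<theta> p + \<Delta> p\<bar> - \<bar>\<theta> p\<bar>))"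
    by (simp add: pen_def sum_subtractf algebra_simps)
  also have "\<dots> = (\<Sum>p\<in>P - S. lam p * (\<bar>\<theta> p + \<Delta> p\<bar> - \<bar>\<theta> p\<bar>)) + (\<Sum>p\<in>S. lam p * (\<bar>\<theta> p + \<Delta> p\<bar> - \<bar>\<theta> p\<bar>))"
    using fin by (intro sum.subset_diff) auto
  also have "\<dots> \<ge> (\<Sum>p\<in>P - S. lmin * \<bar>\<Delta> p\<bar>) + (\<Sum>p\<in>S. - (lmax * \<bar>\<Delta> p\<bar>))"
  proof (intro add_mono sum_mono)
    show "lmin * \<bar>\<Delta> p\<bar> \<le> lam p * (\<bar>\<theta> p + \<Delta> p\<bar> - \<bar>\<theta> p\<bar>)" if "p \<in> P - S" for p
      using that sparse[OF that] lam[of p] by (auto intro: mult_right_mono)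
    show "- (lmax * \<bar>\<Delta> p\<bar>) \<le> lam p * (\<bar>\<theta> p + \<Delta> p\<bar> - \<bar>\<theta> p\<bar>)" if "p \<in> S" for p
    proof -
      have l: "lmin \<le> lam p" "lam p \<le> lmax" using that fin lam[of p] by auto
      have "lam p * (- \<bar>\<Delta> p\<bar>) \<le> lam p * (\<bar>\<theta> p + \<Delta> p\<bar> - \<bar>\<theta> p\<bar>)"
        using l lmin by (intro mult_left_mono) auto
      moreover have "lam p * \<bar>\<Delta> p\<bar> \<le> lmax * \<bar>\<Delta> p\<bar>" using l by (intro mult_right_mono) auto
      ultimately show ?thesis by simp
    qed
  qed
  finally show ?thesis by (simp add: sum_distrib_left sum_negf)
qed

lemma l1_split: "(\<Sum>p\<in>P. \<bar>\<Delta> p :: real\<bar>) = (\<Sum>p\<in>P - S. \<bar>\<Delta> p\<bar>) + (\<Sum>p\<in>S. \<bar>\<Delta> p\<bar>)"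
  using fin by (intro sum.subset_diff) auto

text \<open>Concavity alone. The restricted eigenvalue bound cannot be used yet, since it becomes
  available only after the cone condition has been derived from this estimate.\<close>

lemma lik_diff_le_linear:
  "lik (\<lambda>p. \<theta> p + \<Delta> p) - lik \<theta> \<le> (\<Sum>i\<in>I. w i * (f1 i (lp \<theta> i) * lp \<Delta> i))"
proof -
  have "f i (lp \<theta> i + lp \<Delta> i) \<le> f i (lp \<theta> i) + f1 i (lp \<theta> i) * lp \<Delta> i" if "i \<in> I" for i
  proof -
    have "convex_on UNIV (\<lambda>x. - f i x)"
      by (rule f''_ge0_imp_convex[where f'="\<lambda>x. - f1 i x" and f''="\<lambda>x. - f2 i x"])
        (use f[OF that] f1[OF that] f2[OF that] in \<open>auto intro!: derivative_eq_intros\<close>)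
    then have "- f1 i (lp \<theta> i) * ((lp \<theta> i + lp \<Delta> i) - lp \<theta> i) \<le> - f i (lp \<theta> i + lp \<Delta> i) - - f i (lp \<theta> i)"
      by (rule convex_on_imp_above_tangent) (use f[OF that] in \<open>auto intro!: derivative_eq_intros\<close>)
    then show ?thesis by simp
  qed
  then have "(\<Sum>i\<in>I. w i * f i (lp \<theta> i + lp \<Delta> i)) \<le> (\<Sum>i\<in>I. w i * (f i (lp \<theta> i) + f1 i (lp \<theta> i) * lp \<Delta> i))"
    by (intro w_sum_mono) auto
  then show ?thesis
    by (simp add: lik_def lp_def sum.distrib algebra_simps)
qed

text \<open>Half of the penalty gained off \<open>S\<close> outweighs the linear term there. What
  remains gives N \<le> (2 lmax / lmin + 1) A, and adding A itself produces the constant below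
  \<kappa>.\<close>

lemma cone:
  assumes "lik \<theta> - pen \<theta> \<le> lik (\<lambda>p. \<theta> p + \<Delta> p) - pen (\<lambda>p. \<theta> p + \<Delta> p)"
  shows "(\<Sum>p\<in>P. \<bar>\<Delta> p\<bar>) \<le> \<kappa> * (\<Sum>p\<in>S. \<bar>\<Delta> p\<bar>)"
proof -
  define A where "A = (\<Sum>p\<in>S. \<bar>\<Delta> p\<bar>)"
  define N where "N = (\<Sum>p\<in>P - S. \<bar>\<Delta> p\<bar>)"
  have A: "0 \<le> A" by (auto simp: A_def sum_nonneg)
  have "lmin * N - lmax * A \<le> lmin / 2 * (N + A)"
    using assms pen_diff[of \<Delta>] lik_diff_le_linear[of \<Delta>] linear_le[of \<Delta>] l1_split[of \<Delta>]
    by (simp add: A_def N_def)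
  then have "lmin * N \<le> (2 * lmax + lmin) * A" by (simp add: algebra_simps)
  then have "N \<le> (2 * lmax / lmin + 1) * A" using lmin by (simp add: field_simps)
  then have "N + A \<le> (2 * lmax / lmin + 2) * A" by (simp add: algebra_simps)
  also have "\<dots> \<le> \<kappa> * A" using \<kappa> A by (intro mult_right_mono)
  finally show ?thesis using l1_split[of \<Delta>] by (simp add: A_def N_def)
qed

lemma abs_lp_le:
  assumes "i \<in> I" "w i \<noteq> 0"
  shows "\<bar>lp \<Delta> i\<bar> \<le> B * (\<Sum>p\<in>P. \<bar>\<Delta> p\<bar> * c i p)"
proof -
  have "\<bar>lp \<Delta> i\<bar> \<le> (\<Sum>p\<in>P. \<bar>\<Delta> p\<bar> * (B * c i p))"
    unfolding lp_def by (rule order_trans[OF sum_abs]) (auto simp: abs_mult intro!: sum_mono mult_left_mono z assms)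
  then show ?thesis by (simp add: sum_distrib_left mult_ac)
qed

text \<open>The third-order weights are controlled for each triple of coordinates separately, so the
  l1 norm of \<Delta> governs the cubic term; the cone condition will make it comparable to sqrt |S|
  times the Euclidean norm. The term with D comes from the distance between \<theta>'s predictor and
  the true one.\<close>

lemma third_order_le:
  "(\<Sum>i\<in>I. w i * (Mv i * (\<bar>lp \<theta> i - r i\<bar> + \<bar>lp \<Delta> i\<bar>) * (lp \<Delta> i)\<^sup>2))
    \<le> C3 * B\<^sup>2 * (\<Sum>p\<in>P. \<bar>\<Delta> p\<bar>)\<^sup>2 * (D * real (card S) + B * (\<Sum>p\<in>P. \<bar>\<Delta> p\<bar>))"
proof -
  define n1 where "n1 = (\<Sum>p\<in>P. \<bar>\<Delta> p\<bar>)"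
  define T where "T i = (\<Sum>p\<in>P. \<bar>\<Delta> p\<bar> * c i p)" for i
  have n1: "0 \<le> n1" by (auto simp: n1_def sum_nonneg)
  have T: "0 \<le> T i" if "i \<in> I" for i using c that by (auto simp: T_def intro!: sum_nonneg)
  have b: "\<bar>lp \<theta> i - r i\<bar> \<le> D * (\<Sum>q\<in>S. c i q)" if "i \<in> I" "w i \<noteq> 0" for i
    using bias[OF that] by (simp add: lp_def)
  have quad: "(\<Sum>i\<in>I. w i * (Mv i * c i t * (T i)\<^sup>2)) \<le> C3 * n1\<^sup>2" if t: "t \<in> P" for t
  proof -
    have "(\<Sum>i\<in>I. w i * (Mv i * c i t * (T i)\<^sup>2))
        = (\<Sum>i\<in>I. \<Sum>p\<in>P. \<Sum>q\<in>P. \<bar>\<Delta> p\<bar> * \<bar>\<Delta> q\<bar> * (w i * (Mv i * c i p * c i q * c i t)))"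
      by (simp add: T_def power2_eq_square sum_product sum_distrib_left mult_ac)
    also have "\<dots> = (\<Sum>p\<in>P. \<Sum>i\<in>I. \<Sum>q\<in>P. \<bar>\<Delta> p\<bar> * \<bar>\<Delta> q\<bar> * (w i * (Mv i * c i p * c i q * c i t)))"
      by (rule sum.swap)
    also have "\<dots> = (\<Sum>p\<in>P. \<Sum>q\<in>P. \<Sum>i\<in>I. \<bar>\<Delta> p\<bar> * \<bar>\<Delta> q\<bar> * (w i * (Mv i * c i p * c i q * c i t)))"
      by (intro sum.cong refl sum.swap)
    also have "\<dots> = (\<Sum>p\<in>P. \<Sum>q\<in>P. \<bar>\<Delta> p\<bar> * \<bar>\<Delta> q\<bar> * (\<Sum>i\<in>I. w i * (Mv i * c i p * c i q * c i t)))"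
      by (simp add: sum_distrib_left)
    also have "\<dots> \<le> (\<Sum>p\<in>P. \<Sum>q\<in>P. \<bar>\<Delta> p\<bar> * \<bar>\<Delta> q\<bar> * C3)"
      using t by (intro sum_mono mult_left_mono third) auto
    also have "\<dots> = C3 * n1\<^sup>2"
      by (simp add: n1_def power2_eq_square sum_product sum_distrib_left mult_ac)
    finally show ?thesis .
  qed
  have 1: "(\<Sum>i\<in>I. w i * (Mv i * (\<Sum>q\<in>S. c i q) * (T i)\<^sup>2)) \<le> real (card S) * (C3 * n1\<^sup>2)"
  proof -
    have "(\<Sum>i\<in>I. w i * (Mv i * (\<Sum>q\<in>S. c i q) * (T i)\<^sup>2)) = (\<Sum>q\<in>S. \<Sum>i\<in>I. w i * (Mv i * c i q * (T i)\<^sup>2))"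
      by (subst sum.swap) (simp add: sum_distrib_left sum_distrib_right mult_ac)
    also have "\<dots> \<le> (\<Sum>q\<in>S. C3 * n1\<^sup>2)" using fin by (intro sum_mono quad) auto
    finally show ?thesis by simp
  qed
  have 2: "(\<Sum>i\<in>I. w i * (Mv i * T i * (T i)\<^sup>2)) \<le> n1 * (C3 * n1\<^sup>2)"
  proof -
    have "(\<Sum>i\<in>I. w i * (Mv i * T i * (T i)\<^sup>2)) = (\<Sum>p\<in>P. \<Sum>i\<in>I. \<bar>\<Delta> p\<bar> * (w i * (Mv i * c i p * (T i)\<^sup>2)))"
      by (subst sum.swap) (simp add: T_def[of i for i] sum_distrib_left sum_distrib_right mult_ac)
    also have "\<dots> = (\<Sum>p\<in>P. \<bar>\<Delta> p\<bar> * (\<Sum>i\<in>I. w i * (Mv i * c i p * (T i)\<^sup>2)))"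
      by (simp add: sum_distrib_left)
    also have "\<dots> \<le> (\<Sum>p\<in>P. \<bar>\<Delta> p\<bar> * (C3 * n1\<^sup>2))" by (intro sum_mono mult_left_mono quad) auto
    finally show ?thesis by (simp add: n1_def sum_distrib_right)
  qed
  have "(\<Sum>i\<in>I. w i * (Mv i * (\<bar>lp \<theta> i - r i\<bar> + \<bar>lp \<Delta> i\<bar>) * (lp \<Delta> i)\<^sup>2))
      \<le> (\<Sum>i\<in>I. w i * (Mv i * (D * (\<Sum>q\<in>S. c i q) + B * T i) * (B * T i)\<^sup>2))"
  proof (rule w_sum_mono)
    fix i assume i: "i \<in> I" "w i \<noteq> 0"
    have l: "\<bar>lp \<Delta> i\<bar> \<le> B * T i" using abs_lp_le[OF i] by (simp add: T_def)
    then have "\<bar>lp \<Delta> i\<bar>\<^sup>2 \<le> (B * T i)\<^sup>2" by (intro power_mono) auto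
    then show "Mv i * (\<bar>lp \<theta> i - r i\<bar> + \<bar>lp \<Delta> i\<bar>) * (lp \<Delta> i)\<^sup>2 \<le> Mv i * (D * (\<Sum>q\<in>S. c i q) + B * T i) * (B * T i)\<^sup>2"
      using l b[OF i] Mv[OF i(1)] by (intro mult_mono mult_left_mono add_mono) (auto intro!: mult_nonneg_nonneg)
  qed
  also have "\<dots> = B\<^sup>2 * (D * (\<Sum>i\<in>I. w i * (Mv i * (\<Sum>q\<in>S. c i q) * (T i)\<^sup>2)) + B * (\<Sum>i\<in>I. w i * (Mv i * T i * (T i)\<^sup>2)))"
  proof -
    have id: "w * (M * (D * C + B * T) * (B * T)\<^sup>2) = B\<^sup>2 * (D * (w * (M * C * T\<^sup>2)) + B * (w * (M * T * T\<^sup>2)))"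
      for w M C T :: real by (simp add: power2_eq_square algebra_simps)
    show ?thesis by (simp only: id sum.distrib sum_distrib_left[symmetric])
  qed
  also have "\<dots> \<le> B\<^sup>2 * (D * (real (card S) * (C3 * n1\<^sup>2)) + B * (n1 * (C3 * n1\<^sup>2)))"
    using const_nonneg by (intro mult_left_mono add_mono 1 2) auto
  finally show ?thesis by (simp add: n1_def[symmetric] algebra_simps)
qed

lemma lik_diff_le_quadratic:
  "lik (\<lambda>p. \<theta> p + \<Delta> p) - lik \<theta> \<le> (\<Sum>i\<in>I. w i * (f1 i (lp \<theta> i) * lp \<Delta> i))
     - 1/2 * (\<Sum>i\<in>I. w i * (- f2 i (r i) * (lp \<Delta> i)\<^sup>2))
     + 1/2 * (\<Sum>i\<in>I. w i * (Mv i * (\<bar>lp \<theta> i - r i\<bar> + \<bar>lp \<Delta> i\<bar>) * (lp \<Delta> i)\<^sup>2))"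
proof -
  have "(\<Sum>i\<in>I. w i * f i (lp \<theta> i + lp \<Delta> i)) \<le> (\<Sum>i\<in>I. w i * (f i (lp \<theta> i) + f1 i (lp \<theta> i) * lp \<Delta> i
      + 1/2 * (f2 i (r i) + Mv i * (\<bar>lp \<theta> i - r i\<bar> + \<bar>lp \<Delta> i\<bar>)) * (lp \<Delta> i)\<^sup>2))"
    by (intro w_sum_mono taylor2_upper f f1 lip Mv)
  also have "\<dots> = (\<Sum>i\<in>I. w i * f i (lp \<theta> i)) + (\<Sum>i\<in>I. w i * (f1 i (lp \<theta> i) * lp \<Delta> i))
     - 1/2 * (\<Sum>i\<in>I. w i * (- f2 i (r i) * (lp \<Delta> i)\<^sup>2))
     + 1/2 * (\<Sum>i\<in>I. w i * (Mv i * (\<bar>lp \<theta> i - r i\<bar> + \<bar>lp \<Delta> i\<bar>) * (lp \<Delta> i)\<^sup>2))"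
    by (simp only: sum_distrib_left sum.distrib[symmetric] sum_subtractf[symmetric])
      (intro sum.cong refl, simp add: algebra_simps)
  finally show ?thesis by (simp add: lik_def lp_def algebra_simps sum.distrib)
qed

lemma lp_scale: "lp (\<lambda>p. t * \<Delta> p) i = t * lp \<Delta> i"
  by (simp add: lp_def sum_distrib_left mult_ac)

text \<open>Of the quadratic gain \<rho> R^2 / 2 the cubic remainder may consume one half. What
  remains is at most (lmax + lmin / 2) times the l1 norm, and this norm is at most \<kappa> sqrt |S|
  R on the cone; \<open>large\<close> says that R is too big for that.\<close>

lemma no_ascent_on_sphere:
  fixes R :: real
  assumes R: "0 < R" "L2_set \<Delta> P = R"
    and asc: "lik \<theta> - pen \<theta> \<le> lik (\<lambda>p. \<theta> p + \<Delta> p) - pen (\<lambda>p. \<theta> p + \<Delta> p)"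
    and small: "C3 * B\<^sup>2 * (\<kappa>\<^sup>2 * real (card S)) * (D * real (card S) + B * (\<kappa> * sqrt (real (card S)) * R)) \<le> \<rho> / 2"
    and large: "6 * lmax * \<kappa> * sqrt (real (card S)) < \<rho> * R"
  shows False
proof -
  define n1 where "n1 = (\<Sum>p\<in>P. \<bar>\<Delta> p\<bar>)"
  have n1: "0 \<le> n1" by (auto simp: n1_def sum_nonneg)
  have cone': "n1 \<le> \<kappa> * (\<Sum>p\<in>S. \<bar>\<Delta> p\<bar>)" unfolding n1_def by (rule cone[OF asc])
  have "L2_set \<Delta> S \<le> R"
    unfolding R(2)[symmetric] L2_set_def using fin by (intro real_sqrt_le_mono sum_mono2) auto
  then have "(\<Sum>p\<in>S. \<bar>\<Delta> p\<bar>) \<le> sqrt (real (card S)) * R"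
    using sum_abs_le_sqrt_card[where v=\<Delta> and S=S] by (auto intro: order_trans[OF _ mult_left_mono])
  then have n1_le: "n1 \<le> \<kappa> * sqrt (real (card S)) * R"
    using cone' kappa_pos by (auto simp: mult.assoc intro: order_trans[OF _ mult_left_mono])
  \<comment> \<open>The restricted eigenvalue bound lives on the unit sphere; normalising \<Delta>
    does not leave the cone.\<close>
  define v where "v p = \<Delta> p / R" for p
  have vs: "v = (\<lambda>p. (1 / R) * \<Delta> p)" by (auto simp: v_def)
  have "L2_set v P = 1 / R * L2_set \<Delta> P"
    unfolding vs using R by (intro L2_set_right_distrib[symmetric]) auto
  then have v1: "L2_set v P = 1" using R by simp
  have "(\<Sum>p\<in>P. \<bar>v p\<bar>) \<le> \<kappa> * (\<Sum>p\<in>S. \<bar>v p\<bar>)"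
    using cone' R by (simp add: v_def n1_def sum_divide_distrib[symmetric] divide_right_mono)
  from restr[OF v1 this] have "\<rho> \<le> (\<Sum>i\<in>I. w i * (- f2 i (r i) * (lp v i)\<^sup>2))" by (simp add: lp_def)
  also have "\<dots> = (\<Sum>i\<in>I. w i * (- f2 i (r i) * (lp \<Delta> i)\<^sup>2)) / R\<^sup>2"
    unfolding vs lp_scale by (simp add: sum_divide_distrib power_divide)
  finally have rho: "\<rho> * R\<^sup>2 \<le> (\<Sum>i\<in>I. w i * (- f2 i (r i) * (lp \<Delta> i)\<^sup>2))"
    using R by (simp add: field_simps)
  have "(\<Sum>i\<in>I. w i * (Mv i * (\<bar>lp \<theta> i - r i\<bar> + \<bar>lp \<Delta> i\<bar>) * (lp \<Delta> i)\<^sup>2))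
      \<le> C3 * B\<^sup>2 * n1\<^sup>2 * (D * real (card S) + B * n1)"
    unfolding n1_def by (rule third_order_le)
  also have "\<dots> \<le> C3 * B\<^sup>2 * (\<kappa> * sqrt (real (card S)) * R)\<^sup>2 * (D * real (card S) + B * (\<kappa> * sqrt (real (card S)) * R))"
    using const_nonneg n1 n1_le kappa_pos R by (intro mult_mono mult_left_mono power_mono add_mono) auto
  also have "\<dots> = C3 * B\<^sup>2 * (\<kappa>\<^sup>2 * real (card S)) * (D * real (card S) + B * (\<kappa> * sqrt (real (card S)) * R)) * R\<^sup>2"
    by (simp add: power_mult_distrib mult_ac)
  also have "\<dots> \<le> \<rho> / 2 * R\<^sup>2" using small by (intro mult_right_mono) auto
  finally have th: "(\<Sum>i\<in>I. w i * (Mv i * (\<bar>lp \<theta> i - r i\<bar> + \<bar>lp \<Delta> i\<bar>) * (lp \<Delta> i)\<^sup>2)) \<le> \<rho> / 2 * R\<^sup>2" .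
  have "lmax * n1 \<ge> lmax * (\<Sum>p\<in>S. \<bar>\<Delta> p\<bar>) - lmin * (\<Sum>p\<in>P - S. \<bar>\<Delta> p\<bar>)"
  proof -
    have "lmax * (\<Sum>p\<in>S. \<bar>\<Delta> p\<bar>) \<le> lmax * n1"
      unfolding n1_def using fin lmin by (intro mult_left_mono sum_mono2) auto
    moreover have "0 \<le> lmin * (\<Sum>p\<in>P - S. \<bar>\<Delta> p\<bar>)" using lmin by (intro mult_nonneg_nonneg sum_nonneg) auto
    ultimately show ?thesis by linarith
  qed
  then have "- (lmax * n1) \<le> lmin / 2 * n1 - 1/2 * (\<rho> * R\<^sup>2) + 1/2 * (\<rho> / 2 * R\<^sup>2)"
    using asc pen_diff[of \<Delta>] lik_diff_le_quadratic[of \<Delta>] linear_le[of \<Delta>] rho th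
    unfolding n1_def by linarith
  then have "\<rho> * R\<^sup>2 \<le> (4 * lmax + 2 * lmin) * n1" by (simp add: algebra_simps)
  also have "\<dots> \<le> 6 * lmax * n1" using lmin n1 by (intro mult_right_mono) auto
  also have "\<dots> \<le> 6 * lmax * (\<kappa> * sqrt (real (card S)) * R)" using lmin by (intro mult_left_mono n1_le) auto
  finally have "\<rho> * R * R \<le> (6 * lmax * \<kappa> * sqrt (real (card S))) * R" by (simp add: power2_eq_square mult_ac)
  then show False using large R by simp
qed

text \<open>Nothing bounds the error a priori, so the cubic remainder could not be controlled at the
  maximiser itself. Concavity of the likelihood and convexity of the penalty pass the ascent
  inequality from the end point to every point of the segment from \<theta>.\<close>

theorem maximiser_error_le:
  fixes R :: real
  assumes R: "0 < R" and max: "lik \<theta> - pen \<theta> \<le> lik \<beta> - pen \<beta>"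
    and small: "C3 * B\<^sup>2 * (\<kappa>\<^sup>2 * real (card S)) * (D * real (card S) + B * (\<kappa> * sqrt (real (card S)) * R)) \<le> \<rho> / 2"
    and large: "6 * lmax * \<kappa> * sqrt (real (card S)) < \<rho> * R"
  shows "L2_set (\<lambda>p. \<beta> p - \<theta> p) P \<le> R"
proof (rule ccontr)
  assume neg: "\<not> ?thesis"
  define E where "E = L2_set (\<lambda>p. \<beta> p - \<theta> p) P"
  have E: "R < E" using neg by (simp add: E_def)
  define t where "t = R / E"
  have t: "0 < t" "t \<le> 1" using R E by (auto simp: t_def)
  define \<Delta> where "\<Delta> p = t * (\<beta> p - \<theta> p)" for p
  have "L2_set \<Delta> P = t * E"
    unfolding \<Delta>_def E_def using t by (intro L2_set_right_distrib[symmetric]) auto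
  then have \<Delta>R: "L2_set \<Delta> P = R" using R E by (simp add: t_def)
  have pt: "\<theta> p + \<Delta> p = (1 - t) * \<theta> p + t * \<beta> p" for p by (simp add: \<Delta>_def algebra_simps)
  have lpt: "lp (\<lambda>p. \<theta> p + \<Delta> p) i = (1 - t) * lp \<theta> i + t * lp \<beta> i" for i
    unfolding pt lp_def by (simp add: sum_distrib_left sum.distrib[symmetric] algebra_simps)
  have "(\<Sum>i\<in>I. w i * ((1 - t) * f i (lp \<theta> i) + t * f i (lp \<beta> i))) \<le> (\<Sum>i\<in>I. w i * f i (lp (\<lambda>p. \<theta> p + \<Delta> p) i))"
  proof (rule w_sum_mono)
    fix i assume i: "i \<in> I"
    have "convex_on UNIV (\<lambda>x. - f i x)"
      by (rule f''_ge0_imp_convex[where f'="\<lambda>x. - f1 i x" and f''="\<lambda>x. - f2 i x"])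
        (use f[OF i] f1[OF i] f2[OF i] in \<open>auto intro!: derivative_eq_intros\<close>)
    from convex_onD[OF this, of t "lp \<theta> i" "lp \<beta> i"] t
    show "(1 - t) * f i (lp \<theta> i) + t * f i (lp \<beta> i) \<le> f i (lp (\<lambda>p. \<theta> p + \<Delta> p) i)"
      unfolding lpt by simp
  qed
  moreover have "(\<Sum>i\<in>I. w i * ((1 - t) * f i (lp \<theta> i) + t * f i (lp \<beta> i))) = (1 - t) * lik \<theta> + t * lik \<beta>"
    by (simp only: lik_def lp_def[symmetric] sum_distrib_left sum.distrib[symmetric])
      (intro sum.cong refl, simp add: algebra_simps)
  ultimately have 1: "(1 - t) * lik \<theta> + t * lik \<beta> \<le> lik (\<lambda>p. \<theta> p + \<Delta> p)"
    by (simp add: lik_def lp_def)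
  have "pen (\<lambda>p. \<theta> p + \<Delta> p) \<le> (\<Sum>p\<in>P. lam p * ((1 - t) * \<bar>\<theta> p\<bar> + t * \<bar>\<beta> p\<bar>))"
    unfolding pen_def
  proof (intro sum_mono mult_left_mono)
    fix p assume p: "p \<in> P"
    show "\<bar>\<theta> p + \<Delta> p\<bar> \<le> (1 - t) * \<bar>\<theta> p\<bar> + t * \<bar>\<beta> p\<bar>"
      unfolding pt using t by (intro order_trans[OF abs_triangle_ineq]) (simp add: abs_mult)
    show "0 \<le> lam p" using lam[OF p] lmin by linarith
  qed
  also have "\<dots> = (1 - t) * pen \<theta> + t * pen \<beta>"
    by (simp only: pen_def sum_distrib_left sum.distrib[symmetric])
      (intro sum.cong refl, simp add: algebra_simps)
  finally have 2: "pen (\<lambda>p. \<theta> p + \<Delta> p) \<le> (1 - t) * pen \<theta> + t * pen \<beta>" .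
  have "t * (lik \<theta> - pen \<theta>) \<le> t * (lik \<beta> - pen \<beta>)" using max t by (intro mult_left_mono) auto
  then have "lik \<theta> - pen \<theta> \<le> lik (\<lambda>p. \<theta> p + \<Delta> p) - pen (\<lambda>p. \<theta> p + \<Delta> p)"
    using 1 2 by (simp add: algebra_simps)
  from no_ascent_on_sphere[OF R \<Delta>R this small large] show False .
qed

end

section \<open>Measurability and conditional moments\<close>

text \<open>A derivative is the pointwise limit of difference quotients along one fixed null
  sequence of steps, each of them measurable. The indicator removes the responses for which
  differentiability is not assumed.\<close>

lemma borel_measurable_deriv_indicator:
  fixes F :: "real \<Rightarrow> real \<Rightarrow> real"
  assumes F: "(\<lambda>(s, t). F s t * indicator Y t) \<in> borel_measurable (borel \<Otimes>\<^sub>M borel)"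
    and diff: "\<And>s t. t \<in> Y \<Longrightarrow> (\<lambda>s. F s t) differentiable at s"
  shows "(\<lambda>(s, t). deriv (\<lambda>s. F s t) s * indicator Y t) \<in> borel_measurable (borel \<Otimes>\<^sub>M borel)"
proof (rule borel_measurable_LIMSEQ_real)
  define e where "e m = inverse (real (Suc m))" for m
  have e: "e \<longlonglongrightarrow> 0" "e m \<noteq> 0" for m
    unfolding e_def using LIMSEQ_inverse_real_of_nat by auto
  have "(\<lambda>m. (F (s + e m) t * indicator Y t - F s t * indicator Y t) / e m) \<longlonglongrightarrow> deriv (\<lambda>s. F s t) s * indicator Y t" for s t
  proof (cases "t \<in> Y")
    case True
    have "((\<lambda>s. F s t) has_real_derivative deriv (\<lambda>s. F s t) s) (at s)"
      using diff[OF True] by (simp add: DERIV_deriv_iff_real_differentiable)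
    then have "((\<lambda>h. (F (s + h) t - F s t) / h) \<longlongrightarrow> deriv (\<lambda>s. F s t) s) (at 0)"
      by (simp add: DERIV_def)
    moreover have "filterlim e (at 0) sequentially"
      using e by (auto simp: filterlim_at)
    ultimately have "(\<lambda>m. (F (s + e m) t - F s t) / e m) \<longlonglongrightarrow> deriv (\<lambda>s. F s t) s"
      by (rule filterlim_compose)
    then show ?thesis using True by simp
  qed simp
  then show "(\<lambda>m. (case p of (s, t) \<Rightarrow> (F (s + e m) t * indicator Y t - F s t * indicator Y t) / e m))
      \<longlonglongrightarrow> (case p of (s, t) \<Rightarrow> deriv (\<lambda>s. F s t) s * indicator Y t)" for p
    by (cases p) simp
  show "(\<lambda>p. case p of (s, t) \<Rightarrow> (F (s + e m) t * indicator Y t - F s t * indicator Y t) / e m)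
      \<in> borel_measurable (borel \<Otimes>\<^sub>M borel)" for m
  proof -
    have "(\<lambda>p. (fst p + e m, snd p)) \<in> measurable (borel \<Otimes>\<^sub>M borel) (borel \<Otimes>\<^sub>M borel :: (real \<times> real) measure)"
      by measurable
    from measurable_compose[OF this F] F show ?thesis
      by (simp add: case_prod_beta borel_measurable_divide borel_measurable_diff)
  qed
qed

section \<open>Conditional expectations tested against functions of the conditioning
  variable\<close>

lemma (in prob_space) finite_measure_subalgebra_vimage:
  assumes "V \<in> measurable M N"
  shows "finite_measure_subalgebra M (vimage_algebra (space M) V N)"
proof
  show "subalgebra M (vimage_algebra (space M) V N)"
    unfolding subalgebra_def using assms
    by (auto simp: sets_vimage_algebra2 measurable_space intro: measurable_sets)
qed

text \<open>The conditional bound is tested against an indicator. With an interval around the centre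
  for \<open>A\<close>, a uniform conditional moment bound becomes a local moment bound proportional
  to the probability of the interval.\<close>

lemma (in prob_space) nn_integral_le_of_cond_exp_le:
  fixes F :: "'a \<Rightarrow> real" and V :: "'a \<Rightarrow> real"
  assumes V: "V \<in> borel_measurable M" and F: "F \<in> borel_measurable M"
    and le: "AE \<omega> in M. nn_cond_exp_given M borel V F \<omega> \<le> C" and A: "A \<in> sets borel"
  shows "(\<integral>\<^sup>+\<omega>. ennreal (F \<omega>) * indicator A (V \<omega>) \<partial>M) \<le> C * (\<integral>\<^sup>+\<omega>. indicator A (V \<omega>) \<partial>M)"
proof -
  define S where "S = vimage_algebra (space M) V (borel :: real measure)"
  interpret S: finite_measure_subalgebra M S
    unfolding S_def by (rule finite_measure_subalgebra_vimage[OF V])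
  have VS: "V \<in> borel_measurable S" unfolding S_def by (rule measurable_vimage_algebra1) simp
  have "(\<lambda>\<omega>. indicator A (V \<omega>) :: ennreal) \<in> borel_measurable S"
    by (rule measurable_compose[OF VS borel_measurable_indicator[OF A]])
  then have "(\<integral>\<^sup>+\<omega>. indicator A (V \<omega>) * ennreal (F \<omega>) \<partial>M)
      = (\<integral>\<^sup>+\<omega>. indicator A (V \<omega>) * nn_cond_exp M S (\<lambda>\<omega>. ennreal (F \<omega>)) \<omega> \<partial>M)"
    using F by (intro S.nn_cond_exp_intg[symmetric]) auto
  also have "\<dots> \<le> (\<integral>\<^sup>+\<omega>. C * indicator A (V \<omega>) \<partial>M)"
    using le by (intro nn_integral_mono_AE)
      (auto simp: nn_cond_exp_given_def S_def[symmetric] indicator_def)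
  also have "\<dots> = C * (\<integral>\<^sup>+\<omega>. indicator A (V \<omega>) \<partial>M)"
    by (rule nn_integral_cmult) (rule measurable_compose[OF V borel_measurable_indicator[OF A]])
  finally show ?thesis by (simp add: mult.commute)
qed

lemma (in prob_space) integral_mult_eq_0_of_cond_exp_eq_0:
  fixes F :: "'a \<Rightarrow> real"
  assumes V: "V \<in> measurable M N" and F: "F \<in> borel_measurable M"
    and zero: "AE \<omega> in M. cond_exp M N V F \<omega> = 0"
    and g: "g \<in> borel_measurable N" and int: "integrable M (\<lambda>\<omega>. g (V \<omega>) * F \<omega>)"
  shows "(\<integral>\<omega>. g (V \<omega>) * F \<omega> \<partial>M) = 0"
proof -
  define S where "S = vimage_algebra (space M) V N"
  interpret S: finite_measure_subalgebra M S
    unfolding S_def by (rule finite_measure_subalgebra_vimage[OF V])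
  have VS: "V \<in> measurable S N" unfolding S_def
    by (rule measurable_vimage_algebra1) (use measurable_space[OF V] in auto)
  have "(\<integral>\<omega>. g (V \<omega>) * F \<omega> \<partial>M) = (\<integral>\<omega>. g (V \<omega>) * real_cond_exp M S F \<omega> \<partial>M)"
    by (rule S.real_cond_exp_intg(2)[symmetric, OF int measurable_compose[OF VS g] F])
  also have "\<dots> = (\<integral>\<omega>. 0 \<partial>M)"
  proof (rule integral_cong_AE)
    show "(\<lambda>\<omega>. g (V \<omega>) * real_cond_exp M S F \<omega>) \<in> borel_measurable M"
      by (rule borel_measurable_times[OF measurable_compose[OF V g] borel_measurable_cond_exp2])
    show "AE \<omega> in M. g (V \<omega>) * real_cond_exp M S F \<omega> = 0"
      using zero by (auto simp: cond_exp_def S_def)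
  qed simp
  finally show ?thesis by simp
qed

text \<open>The mean value inequality is applied twice, first to f' and then to f minus its tangent
  on the segment between \<open>u\<close> and \<open>v\<close>; derivatives within [0,1] suffice, so
  end points are covered. The constant C in place of C / 2 is immaterial here.\<close>

lemma C2_second_order_bound:
  assumes C2: "C2_unit_interval f f' f''" and b: "\<And>u. u \<in> {0..1} \<Longrightarrow> \<bar>f'' u\<bar> \<le> C"
    and uv: "u \<in> {0..1}" "v \<in> {0..1}"
  shows "\<bar>f v - f u - f' u * (v - u)\<bar> \<le> C * (v - u)\<^sup>2"
proof -
  have f': "\<bar>f' x - f' u\<bar> \<le> C * \<bar>x - u\<bar>" if "x \<in> {0..1}" for x
    using field_differentiable_bound[of "{0..1}" f' f'' C x u] C2 b that uv
    by (auto simp: C2_unit_interval_def)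
  define T where "T = closed_segment u v"
  have T: "T \<subseteq> {0..1}" unfolding T_def by (rule closed_segment_subset) (use uv in auto)
  have "norm ((\<lambda>x. f x - f' u * x) v - (\<lambda>x. f x - f' u * x) u) \<le> (C * \<bar>v - u\<bar>) * norm (v - u)"
  proof (rule field_differentiable_bound[of T _ "\<lambda>x. f' x - f' u"])
    show "convex T" by (simp add: T_def)
    show "((\<lambda>x. f x - f' u * x) has_field_derivative f' x - f' u) (at x within T)" if "x \<in> T" for x
    proof -
      have "(f has_real_derivative f' x) (at x within T)"
        using C2 that T by (auto simp: C2_unit_interval_def intro: DERIV_subset)
      then show ?thesis by (auto intro!: derivative_eq_intros)
    qed
    show "norm (f' x - f' u) \<le> C * \<bar>v - u\<bar>" if "x \<in> T" for x
    proof -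
      have "\<bar>x - u\<bar> \<le> \<bar>v - u\<bar>" using segment_bound1[of x u v] that by (simp add: T_def)
      moreover have "0 \<le> C" using b[OF uv(1)] by linarith
      ultimately have "C * \<bar>x - u\<bar> \<le> C * \<bar>v - u\<bar>" by (intro mult_left_mono)
      then show ?thesis using f'[of x] that T by auto
    qed
  qed (auto simp: T_def)
  then show ?thesis by (simp add: power2_eq_square algebra_simps abs_mult)
qed

lemma compact_support_bound:
  fixes K :: "real \<Rightarrow> real"
  assumes "continuous_on UNIV K" "compact (closure {t. K t \<noteq> 0})"
  shows "\<exists>B C. 1 \<le> B \<and> 1 \<le> C \<and> (\<forall>t. \<bar>K t\<bar> \<le> C) \<and> (\<forall>t. B < \<bar>t\<bar> \<longrightarrow> K t = 0)"
proof -
  let ?S = "closure {t. K t \<noteq> 0}"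
  obtain B where "\<forall>t\<in>?S. norm t \<le> B"
    using compact_imp_bounded[OF assms(2)] unfolding bounded_iff by blast
  then have B: "\<bar>t\<bar> \<le> B" if "t \<in> ?S" for t using that by simp
  have "compact (K ` ?S)"
    by (rule compact_continuous_image[OF continuous_on_subset[OF assms(1) subset_UNIV] assms(2)])
  then obtain C where "\<forall>x\<in>K ` ?S. norm x \<le> C"
    using compact_imp_bounded[of "K ` ?S"] unfolding bounded_iff by blast
  then have C: "\<bar>K t\<bar> \<le> C" if "t \<in> ?S" for t using that by simp
  have S: "t \<in> ?S" if "K t \<noteq> 0" for t
    by (rule subsetD[OF closure_subset]) (use that in simp)
  have "\<bar>K t\<bar> \<le> max 1 C" for t
  proof (cases "K t = 0")
    case False
    from C[OF S[OF this]] show ?thesis by simp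
  qed simp
  moreover have "K t = 0" if "max 1 B < \<bar>t\<bar>" for t
  proof (rule ccontr)
    assume "K t \<noteq> 0"
    from B[OF S[OF this]] that show False by simp
  qed
  \<comment> \<open>Both constants are enlarged to at least 1; for \<open>B\<close> this lets it
    bound the powers 0 and 1 of |t| on the support alike.\<close>
  ultimately show ?thesis by (intro exI[of _ "max 1 B"] exI[of _ "max 1 C"] conjI allI impI) simp_all
qed

section \<open>The semi-varying coefficient model\<close>

context kernel_array
begin

lemma cond_moment_bounds:
  fixes F :: "'b \<Rightarrow> real"
  assumes i: "i \<in> {1..n}" and F: "F \<in> borel_measurable (N n)"
    and le: "AE \<omega> in M n. nn_cond_exp_given (M n) borel (\<lambda>\<omega>. V (Z n i \<omega>)) (\<lambda>\<omega>. F (Z n i \<omega>)) \<omega> \<le> ennreal C"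
    and C: "0 \<le> C"
  shows "(\<integral>\<^sup>+\<omega>. ennreal (F (Z n i \<omega>)) \<partial>M n) \<le> ennreal C"
    and "(\<integral>\<^sup>+\<omega>. ennreal (F (Z n i \<omega>) * indicator (near_at n i u) \<omega>) \<partial>M n) \<le> ennreal (C * (cV * B) * h n)"
proof -
  interpret kernel_sample "M n" "N n" "Z n" n V w W B "h n" cV by (rule sample)
  note base = nn_integral_le_of_cond_exp_le[OF VZ_meas[OF i] fZ_meas[OF i F] le]
  show "(\<integral>\<^sup>+\<omega>. ennreal (F (Z n i \<omega>)) \<partial>M n) \<le> ennreal C"
    using base[of UNIV] by (simp add: emeasure_space_1)
  have eq: "indicator {u - B * h n..u + B * h n} (V (Z n i \<omega>)) = (indicator (near_at n i u) \<omega> :: ennreal)" for \<omega>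
    by (auto simp: indicator_def abs_le_iff)
  have "(\<integral>\<^sup>+\<omega>. ennreal (F (Z n i \<omega>) * indicator (near_at n i u) \<omega>) \<partial>M n)
      = (\<integral>\<^sup>+\<omega>. ennreal (F (Z n i \<omega>)) * indicator (near_at n i u) \<omega> \<partial>M n)"
    by (intro nn_integral_cong) (auto simp: indicator_def)
  also have "\<dots> \<le> ennreal C * (\<integral>\<^sup>+\<omega>. indicator (near_at n i u) \<omega> \<partial>M n)"
    using base[of "{u - B * h n..u + B * h n}"] unfolding eq by simp
  also have "\<dots> \<le> ennreal C * ennreal (cV * B * h n)" by (intro mult_left_mono near_prob i) auto
  also have "\<dots> = ennreal (C * (cV * B) * h n)"
    using C cV_pos B_pos h_pos by (simp add: ennreal_mult[symmetric] mult_ac)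
  finally show "(\<integral>\<^sup>+\<omega>. ennreal (F (Z n i \<omega>) * indicator (near_at n i u) \<omega>) \<partial>M n) \<le> ennreal (C * (cV * B) * h n)" .
qed

lemma poly_momentsI:
  assumes m0: "2 < m0" and C: "0 \<le> C"
    and le: "\<And>n j i. j \<in> J n \<Longrightarrow> i \<in> {1..n} \<Longrightarrow> AE \<omega> in M n.
      nn_cond_exp_given (M n) borel (\<lambda>\<omega>. V (Z n i \<omega>)) (\<lambda>\<omega>. \<bar>f n j (Z n i \<omega>)\<bar> powr m0) \<omega> \<le> ennreal C"
  shows "poly_moments m0 (max C (C * (cV * B)))"
  unfolding poly_moments_def
proof (intro conjI allI ballI m0)
  fix n j i u assume j: "j \<in> J n" and i: "i \<in> {1..n}"
  have F: "(\<lambda>z. \<bar>f n j z\<bar> powr m0) \<in> borel_measurable (N n)" using f_meas[OF j] by measurable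
  note b = cond_moment_bounds[OF i F le[OF j i] C]
  show "(\<integral>\<^sup>+\<omega>. ennreal (\<bar>f n j (Z n i \<omega>)\<bar> powr m0) \<partial>M n) \<le> ennreal (max C (C * (cV * B)))"
    by (rule order_trans[OF b(1)]) (auto intro: ennreal_leI)
  show "(\<integral>\<^sup>+\<omega>. ennreal (\<bar>f n j (Z n i \<omega>)\<bar> powr m0 * indicator (near_at n i u) \<omega>) \<partial>M n)
      \<le> ennreal (max C (C * (cV * B)) * h n)"
    by (rule order_trans[OF b(2)]) (use consts_pos(3)[of n] in \<open>auto intro!: ennreal_leI mult_right_mono\<close>)
qed (use C in auto)

lemma exp_momentsI:
  fixes C :: real
  assumes C: "0 \<le> C"
    and le: "\<And>q n j i. 2 \<le> q \<Longrightarrow> j \<in> J n \<Longrightarrow> i \<in> {1..n} \<Longrightarrow> AE \<omega> in M n.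
      nn_cond_exp_given (M n) borel (\<lambda>\<omega>. V (Z n i \<omega>)) (\<lambda>\<omega>. \<bar>f n j (Z n i \<omega>)\<bar> ^ q) \<omega> \<le> ennreal (C * fact q)"
  shows "exp_moments (max C (C * (cV * B)))"
  unfolding exp_moments_def
proof (intro conjI allI ballI impI)
  fix n j i u and q :: nat assume j: "j \<in> J n" and i: "i \<in> {1..n}" and q: "2 \<le> q"
  have F: "(\<lambda>z. \<bar>f n j z\<bar> ^ q) \<in> borel_measurable (N n)" using f_meas[OF j] by measurable
  have C': "0 \<le> C * fact q" using C by simp
  note b = cond_moment_bounds[OF i F le[OF q j i] C']
  show "(\<integral>\<^sup>+\<omega>. ennreal (\<bar>f n j (Z n i \<omega>)\<bar> ^ q) \<partial>M n) \<le> ennreal (max C (C * (cV * B)) * fact q)"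
    by (rule order_trans[OF b(1)]) (auto intro!: ennreal_leI mult_right_mono)
  have "C * fact q * (cV * B) * h n \<le> max C (C * (cV * B)) * fact q * h n"
    using consts_pos(3)[of n] by (simp add: mult_ac)
  then show "(\<integral>\<^sup>+\<omega>. ennreal (\<bar>f n j (Z n i \<omega>)\<bar> ^ q * indicator (near_at n i u) \<omega>) \<partial>M n)
      \<le> ennreal (max C (C * (cV * B)) * fact q * h n)"
    by (intro order_trans[OF b(2)] ennreal_leI)
qed (use C in auto)

text \<open>Serves the integrability of the score terms. Both regimes are treated at once through a
  dominating function \<open>p\<close> with |x| \<le> 1 + p x.\<close>

lemma finite_first_moment:
  assumes "j \<in> J n" "i \<in> {1..n}" "poly_moments m0 A \<or> exp_moments A"
  shows "(\<integral>\<^sup>+\<omega>. ennreal \<bar>f n j (Z n i \<omega>)\<bar> \<partial>M n) < \<infinity>"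
proof -
  interpret kernel_sample "M n" "N n" "Z n" n V w W B "h n" cV by (rule sample)
  obtain p :: "real \<Rightarrow> real" and C :: real where p: "p \<in> borel_measurable borel" "\<And>x. 0 \<le> p x" "\<And>x. \<bar>x\<bar> \<le> 1 + p x"
    and C: "(\<integral>\<^sup>+\<omega>. ennreal (p (f n j (Z n i \<omega>))) \<partial>M n) \<le> ennreal C"
    using assms(3)
  proof
    assume mom: "poly_moments m0 A"
    then have m0: "2 < m0" by (simp add: poly_moments_def)
    have "\<bar>x\<bar> \<le> 1 + \<bar>x\<bar> powr m0" for x :: real
      using m0 by (intro abs_le_1_plus_powr) simp
    with mom assms(1,2) show ?thesis
      by (intro that[of "\<lambda>x. \<bar>x\<bar> powr m0" A]) (auto simp: poly_moments_def)
  next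
    assume mom: "exp_moments A"
    have "(\<integral>\<^sup>+\<omega>. ennreal (\<bar>f n j (Z n i \<omega>)\<bar> ^ q) \<partial>M n) \<le> ennreal (A * fact q)" if "2 \<le> q" for q
      using mom assms(1,2) that unfolding exp_moments_def by blast
    from this[of 2] have "(\<integral>\<^sup>+\<omega>. ennreal (\<bar>f n j (Z n i \<omega>)\<bar>\<^sup>2) \<partial>M n) \<le> ennreal (A * fact 2)" by simp
    then show ?thesis by (intro that[of "\<lambda>x. \<bar>x\<bar>\<^sup>2" "A * fact 2"] abs_le_1_plus_square) auto
  qed
  note [measurable] = fZ_meas[OF assms(2) f_meas[OF assms(1)]] p(1)
  have "(\<integral>\<^sup>+\<omega>. ennreal \<bar>f n j (Z n i \<omega>)\<bar> \<partial>M n) \<le> (\<integral>\<^sup>+\<omega>. 1 + ennreal (p (f n j (Z n i \<omega>))) \<partial>M n)"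
    using p(2,3) by (intro nn_integral_mono) (simp flip: ennreal_plus ennreal_1 add: ennreal_leI)
  also have "\<dots> = 1 + (\<integral>\<^sup>+\<omega>. ennreal (p (f n j (Z n i \<omega>))) \<partial>M n)"
    by (subst nn_integral_add) (auto simp: emeasure_space_1)
  also have "\<dots> \<le> 1 + ennreal C" by (intro add_left_mono C)
  also have "\<dots> < \<infinity>" by simp
  finally show ?thesis .
qed

end

locale svc_model =
  fixes M :: "nat \<Rightarrow> 'a measure" and U y :: "nat \<Rightarrow> nat \<Rightarrow> 'a \<Rightarrow> real"
    and X :: "nat \<Rightarrow> nat \<Rightarrow> 'a \<Rightarrow> nat \<Rightarrow> real" and d :: "nat \<Rightarrow> nat" and a :: "nat \<Rightarrow> nat \<Rightarrow> real \<Rightarrow> real"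
    and \<Y> :: "real set" and ell :: "real \<Rightarrow> real \<Rightarrow> real" and ginv :: "real \<Rightarrow> real"
    and Mf :: "nat \<Rightarrow> (nat \<Rightarrow> real) \<Rightarrow> real \<Rightarrow> real \<Rightarrow> real" and h :: "nat \<Rightarrow> real" and cU :: real
    and Q1 Q2 :: "nat \<Rightarrow> nat \<Rightarrow> 'a \<Rightarrow> real"
  assumes prob: "\<And>n. prob_space (M n)"
    and indep: "\<And>n. prob_space.indep_vars (M n) (\<lambda>i. obs_space (d n))
                  (\<lambda>i \<omega>. (U n i \<omega>, X n i \<omega>, y n i \<omega>)) {1..n}"
    and U_range: "\<And>n i \<omega>. i \<in> {1..n} \<Longrightarrow> \<omega> \<in> space (M n) \<Longrightarrow> U n i \<omega> \<in> {0..1}"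
    and y_range: "\<And>n i \<omega>. i \<in> {1..n} \<Longrightarrow> \<omega> \<in> space (M n) \<Longrightarrow> y n i \<omega> \<in> \<Y>"
    and Y_meas: "\<Y> \<in> sets borel"
    and lik_meas: "(\<lambda>(s, t). ell (ginv s) t) \<in> borel_measurable (borel \<Otimes>\<^sub>M borel)"
    and lik_diff1: "\<And>s t. t \<in> \<Y> \<Longrightarrow> (\<lambda>s. ell (ginv s) t) differentiable at s"
    and lik_diff2: "\<And>s t. t \<in> \<Y> \<Longrightarrow> (\<lambda>s. q1 ell ginv s t) differentiable at s"
    and d_pos: "\<And>n. 1 \<le> d n"
    and Q1: "Q1 = (\<lambda>n i \<omega>. q1 ell ginv (lin_pred (d n) (a n) (U n i \<omega>) (X n i \<omega>)) (y n i \<omega>))"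
    and Q2: "Q2 = (\<lambda>n i \<omega>. q2 ell ginv (lin_pred (d n) (a n) (U n i \<omega>) (X n i \<omega>)) (y n i \<omega>))"
    and h_pos: "\<And>n. 0 < h n" and cU_pos: "0 < cU"
    and Q1_int: "\<And>n i. i \<in> {1..n} \<Longrightarrow> integrable (M n) (Q1 n i)"
    and Q1_mean: "\<And>n i. i \<in> {1..n} \<Longrightarrow>
                    AE \<omega> in M n. cond_exp (M n) (cov_space (d n)) (\<lambda>\<omega>. (U n i \<omega>, X n i \<omega>)) (Q1 n i) \<omega> = 0"
    and Mf_meas: "\<And>n. (\<lambda>(x, u, t). Mf n x u t) \<in>
                    borel_measurable ((\<Pi>\<^sub>M j\<in>{1..d n}. borel) \<Otimes>\<^sub>M (borel \<Otimes>\<^sub>M borel))"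
    and U_dens: "\<And>n i u r. i \<in> {1..n} \<Longrightarrow> 0 \<le> r \<Longrightarrow>
      (\<integral>\<^sup>+\<omega>. indicator {\<omega>. \<bar>U n i \<omega> - u\<bar> \<le> r} \<omega> \<partial>M n) \<le> ennreal (cU * r)"
    and a_cont: "\<And>n j. j \<in> {1..d n} \<Longrightarrow> continuous_on {0..1} (a n j)"
begin

definition obs :: "nat \<Rightarrow> nat \<Rightarrow> 'a \<Rightarrow> real \<times> (nat \<Rightarrow> real) \<times> real" where
  "obs n i \<omega> = (U n i \<omega>, X n i \<omega>, y n i \<omega>)"

text \<open>
  The indicators make the following functions Borel on all of the observation space; they
  equal 1 at every observation.
\<close>

definition rpred :: "nat \<Rightarrow> real \<Rightarrow> (nat \<Rightarrow> real) \<Rightarrow> real" where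
  "rpred n u x = (\<Sum>j=1..d n. (indicator {0..1} u * a n j u) * x j)"

definition score_fn :: "nat \<Rightarrow> nat \<Rightarrow> real \<times> (nat \<Rightarrow> real) \<times> real \<Rightarrow> real" where
  "score_fn n j = (\<lambda>(u, x, t). q1 ell ginv (rpred n u x) t * indicator \<Y> t * x j)"

text \<open>These sums will serve as upper bounds for terms of arbitrary sign, so absolute values
  are taken per observation; absolute moments do not notice the difference.\<close>

definition curv_fn :: "nat \<Rightarrow> nat \<times> nat \<Rightarrow> real \<times> (nat \<Rightarrow> real) \<times> real \<Rightarrow> real" where
  "curv_fn n = (\<lambda>(j, k) (u, x, t). \<bar>q2 ell ginv (rpred n u x) t * indicator \<Y> t * x j * x k\<bar>)"

definition third_fn :: "nat \<Rightarrow> nat \<times> nat \<times> nat \<Rightarrow> real \<times> (nat \<Rightarrow> real) \<times> real \<Rightarrow> real" where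
  "third_fn n = (\<lambda>(j, k, l) (u, x, t). \<bar>x j * x k * x l * Mf n x u t\<bar>)"

lemma obs_simps:
  assumes "i \<in> {1..n}" "\<omega> \<in> space (M n)"
  shows "score_fn n j (obs n i \<omega>) = Q1 n i \<omega> * X n i \<omega> j"
    and "curv_fn n (j, k) (obs n i \<omega>) = \<bar>Q2 n i \<omega> * X n i \<omega> j * X n i \<omega> k\<bar>"
    and "third_fn n (j, k, l) (obs n i \<omega>)
      = \<bar>X n i \<omega> j * X n i \<omega> k * X n i \<omega> l * Mf n (X n i \<omega>) (U n i \<omega>) (y n i \<omega>)\<bar>"
  using U_range[OF assms] y_range[OF assms]
  by (simp_all add: score_fn_def curv_fn_def third_fn_def obs_def rpred_def Q1 Q2 lin_pred_def)

lemma q1_meas: "(\<lambda>(s, t). q1 ell ginv s t * indicator \<Y> t) \<in> borel_measurable (borel \<Otimes>\<^sub>M borel)"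
  unfolding q1_def
proof (rule borel_measurable_deriv_indicator)
  have "(\<lambda>p. indicator \<Y> (snd p) :: real) \<in> borel_measurable (borel \<Otimes>\<^sub>M borel :: (real \<times> real) measure)"
    by (rule measurable_compose[OF measurable_snd borel_measurable_indicator[OF Y_meas]])
  with lik_meas show "(\<lambda>(s, t). ell (ginv s) t * indicator \<Y> t) \<in> borel_measurable (borel \<Otimes>\<^sub>M borel)"
    unfolding case_prod_beta by (rule borel_measurable_times)
qed (rule lik_diff1)

lemma q2_meas: "(\<lambda>(s, t). q2 ell ginv s t * indicator \<Y> t) \<in> borel_measurable (borel \<Otimes>\<^sub>M borel)"
  unfolding q2_def by (rule borel_measurable_deriv_indicator[OF q1_meas lik_diff2])

lemma proj_meas:
  "fst \<in> borel_measurable (obs_space D)"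
  "(\<lambda>z. fst (snd z)) \<in> measurable (obs_space D) (\<Pi>\<^sub>M j\<in>{1..D}. borel)"
  "(\<lambda>z. snd (snd z)) \<in> borel_measurable (obs_space D)"
  unfolding obs_space_def by measurable

lemma coord_meas: "j \<in> {1..D} \<Longrightarrow> (\<lambda>z. fst (snd z) j) \<in> borel_measurable (obs_space D)"
  by (rule measurable_compose[OF proj_meas(2) measurable_component_singleton])

lemma rpred_meas: "(\<lambda>z. rpred n (fst z) (fst (snd z))) \<in> borel_measurable (obs_space (d n))"
  unfolding rpred_def
proof (rule borel_measurable_sum)
  fix j assume j: "j \<in> {1..d n}"
  have "(\<lambda>u. indicator {0..1} u *\<^sub>R a n j u) \<in> borel_measurable borel"
    by (rule borel_measurable_continuous_on_indicator[OF _ a_cont[OF j]]) auto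
  then have "(\<lambda>u. indicator {0..1} u * a n j u) \<in> borel_measurable borel" by simp
  from borel_measurable_times[OF measurable_compose[OF proj_meas(1) this] coord_meas[OF j]]
  show "(\<lambda>z. indicator {0..1} (fst z) * a n j (fst z) * fst (snd z) j) \<in> borel_measurable (obs_space (d n))" .
qed

lemma pred_resp_meas:
  "(\<lambda>z. (rpred n (fst z) (fst (snd z)), snd (snd z))) \<in> measurable (obs_space (d n)) (borel \<Otimes>\<^sub>M borel)"
  by (rule measurable_Pair[OF rpred_meas proj_meas(3)])

lemma score_fn_meas: "j \<in> {1..d n} \<Longrightarrow> score_fn n j \<in> borel_measurable (obs_space (d n))"
  using borel_measurable_times[OF measurable_compose[OF pred_resp_meas q1_meas] coord_meas]
  by (simp add: score_fn_def case_prod_beta)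

lemma curv_fn_meas:
  assumes "p \<in> {1..d n} \<times> {1..d n}"
  shows "curv_fn n p \<in> borel_measurable (obs_space (d n))"
proof -
  have "(\<lambda>z. q2 ell ginv (rpred n (fst z) (fst (snd z))) (snd (snd z)) * indicator \<Y> (snd (snd z)))
      \<in> borel_measurable (obs_space (d n))"
    using measurable_compose[OF pred_resp_meas q2_meas] by (simp add: case_prod_beta)
  then show ?thesis
    unfolding curv_fn_def case_prod_beta using assms
    by (intro borel_measurable_abs borel_measurable_times[OF borel_measurable_times] coord_meas) auto
qed

lemma third_fn_meas:
  assumes "p \<in> {1..d n} \<times> {1..d n} \<times> {1..d n}"
  shows "third_fn n p \<in> borel_measurable (obs_space (d n))"
proof -
  have "(\<lambda>z. (fst (snd z), fst z, snd (snd z))) \<in> measurable (obs_space (d n))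
      ((\<Pi>\<^sub>M j\<in>{1..d n}. borel) \<Otimes>\<^sub>M (borel \<Otimes>\<^sub>M borel))"
    by (intro measurable_Pair proj_meas)
  from measurable_compose[OF this Mf_meas]
  have "(\<lambda>z. Mf n (fst (snd z)) (fst z) (snd (snd z))) \<in> borel_measurable (obs_space (d n))" by simp
  then show ?thesis
    unfolding third_fn_def case_prod_beta using assms
    by (intro borel_measurable_abs borel_measurable_times[of _ "obs_space (d n)"] coord_meas) auto
qed

lemma obs_meas: "i \<in> {1..n} \<Longrightarrow> obs n i \<in> measurable (M n) (obs_space (d n))"
  using indep[of n] unfolding prob_space.indep_vars_def[OF prob] obs_def[abs_def] by auto

lemma obs_sample:
  assumes "w \<in> borel_measurable borel" "\<And>t. \<bar>w t\<bar> \<le> W * indicator {-B..B} t" "0 < W" "0 < B"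
  shows "kernel_sample (M n) (obs_space (d n)) (obs n) n fst w W B (h n) cU"
proof -
  interpret prob_space "M n" by (rule prob)
  show ?thesis
    by unfold_locales
      (use assms indep[of n] U_dens h_pos cU_pos proj_meas(1) in \<open>auto simp: obs_def[abs_def]\<close>)
qed

lemma score_array:
  assumes "w \<in> borel_measurable borel" "\<And>t. \<bar>w t\<bar> \<le> W * indicator {-B..B} t" "0 < W" "0 < B"
  shows "kernel_array M (\<lambda>n. obs_space (d n)) obs fst w W B h cU d (\<lambda>n. {1..d n}) score_fn"
proof (rule kernel_array.intro)
  show "kernel_sample (M n) (obs_space (d n)) (obs n) n fst w W B (h n) cU" for n by (rule obs_sample[OF assms])
  show "real (card {1..d n}) \<le> real (d n) ^ 3" for n
    using d_pos[of n] self_le_power[of "real (d n)" 3] by simp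
qed (use d_pos score_fn_meas in auto)

lemma curv_array:
  assumes "w \<in> borel_measurable borel" "\<And>t. \<bar>w t\<bar> \<le> W * indicator {-B..B} t" "0 < W" "0 < B"
  shows "kernel_array M (\<lambda>n. obs_space (d n)) obs fst w W B h cU d (\<lambda>n. {1..d n} \<times> {1..d n}) curv_fn"
proof (rule kernel_array.intro)
  show "kernel_sample (M n) (obs_space (d n)) (obs n) n fst w W B (h n) cU" for n by (rule obs_sample[OF assms])
  show "real (card ({1..d n} \<times> {1..d n})) \<le> real (d n) ^ 3" for n
    using d_pos[of n] power_increasing[of 2 3 "real (d n)"] by (simp add: card_cartesian_product power2_eq_square)
qed (use d_pos curv_fn_meas in auto)

lemma third_array:
  assumes "w \<in> borel_measurable borel" "\<And>t. \<bar>w t\<bar> \<le> W * indicator {-B..B} t" "0 < W" "0 < B"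
  shows "kernel_array M (\<lambda>n. obs_space (d n)) obs fst w W B h cU d
    (\<lambda>n. {1..d n} \<times> {1..d n} \<times> {1..d n}) third_fn"
proof (rule kernel_array.intro)
  show "kernel_sample (M n) (obs_space (d n)) (obs n) n fst w W B (h n) cU" for n by (rule obs_sample[OF assms])
  show "real (card ({1..d n} \<times> {1..d n} \<times> {1..d n})) \<le> real (d n) ^ 3" for n
    by (simp add: card_cartesian_product power3_eq_cube)
qed (use d_pos third_fn_meas in auto)

text \<open>At a fixed centre a term is Q1 times a function of (U, X), namely the coordinate times
  the kernel weight, so its mean vanishes by the conditional mean zero of Q1. At the random centre
  this would fail to be a statement about one observation, which is why centring is formulated for
  fixed \<open>u\<close>.\<close>

lemma score_centred:
  assumes w: "w \<in> borel_measurable borel" "\<And>t. \<bar>w t\<bar> \<le> W * indicator {-B..B} t" "0 < W" "0 < B"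
    and fin: "\<And>n j i. j \<in> {1..d n} \<Longrightarrow> i \<in> {1..n} \<Longrightarrow> (\<integral>\<^sup>+\<omega>. ennreal \<bar>score_fn n j (obs n i \<omega>)\<bar> \<partial>M n) < \<infinity>"
  shows "kernel_array.centred M obs fst w h (\<lambda>n. {1..d n}) score_fn"
proof -
  interpret kernel_array M "\<lambda>n. obs_space (d n)" obs fst w W B h cU d "\<lambda>n. {1..d n}" score_fn
    by (rule score_array[OF w])
  show ?thesis unfolding centred_def
  proof (intro allI ballI)
    fix n j i u assume j: "j \<in> {1..d n}" and i: "i \<in> {1..n}"
    interpret kernel_sample "M n" "obs_space (d n)" "obs n" n fst w W B "h n" cU by (rule obs_sample[OF w])
    have int1: "integrable (M n) (\<lambda>\<omega>. score_fn n j (obs n i \<omega>))"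
      by (rule integrableI_bounded) (use fZ_meas[OF i score_fn_meas[OF j]] fin[OF j i] in auto)
    have wm: "(\<lambda>\<omega>. w ((U n i \<omega> - u) / h n)) \<in> borel_measurable (M n)"
      using VZ_meas[OF i] w(1) by (auto simp: obs_def intro!: measurable_compose[OF _ w(1)])
    have "integrable (M n) (\<lambda>\<omega>. W * \<bar>score_fn n j (obs n i \<omega>)\<bar>)" using int1 by auto
    then have int: "integrable (M n) (term_at n (score_fn n j) i u)"
    proof (rule Bochner_Integration.integrable_bound)
      show "AE \<omega> in M n. norm (term_at n (score_fn n j) i u \<omega>) \<le> norm (W * \<bar>score_fn n j (obs n i \<omega>)\<bar>)"
      proof (rule AE_I2)
        fix \<omega>
        show "norm (term_at n (score_fn n j) i u \<omega>) \<le> norm (W * \<bar>score_fn n j (obs n i \<omega>)\<bar>)"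
          using w_abs_le[of "(fst (obs n i \<omega>) - u) / h n"] w(3)
          by (simp add: wterm_def abs_mult mult.commute mult_right_mono)
      qed
    qed (rule wterm_meas[OF i score_fn_meas[OF j]])
    define g where "g = (\<lambda>(u', x). x j * w ((u' - u) / h n))"
    have gm: "g \<in> borel_measurable (cov_space (d n))"
    proof -
      have "(\<lambda>p. snd p j) \<in> borel_measurable (cov_space (d n))"
        unfolding cov_space_def using j by (intro measurable_compose[OF measurable_snd measurable_component_singleton])
      moreover have "(\<lambda>p. w ((fst p - u) / h n)) \<in> borel_measurable (cov_space (d n))"
        unfolding cov_space_def by (intro measurable_compose[OF _ w(1)]) measurable
      ultimately show ?thesis unfolding g_def case_prod_beta by (rule borel_measurable_times)
    qed
    have eq: "term_at n (score_fn n j) i u \<omega> = g (U n i \<omega>, X n i \<omega>) * Q1 n i \<omega>" if "\<omega> \<in> space (M n)" for \<omega>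
      using obs_simps(1)[OF i that, of j] by (simp add: wterm_def g_def obs_def)
    have Vm: "(\<lambda>\<omega>. (U n i \<omega>, X n i \<omega>)) \<in> measurable (M n) (cov_space (d n))"
    proof -
      have "(\<lambda>z. (fst z, fst (snd z))) \<in> measurable (obs_space (d n)) (cov_space (d n))"
        unfolding cov_space_def by (intro measurable_Pair proj_meas)
      from measurable_compose[OF obs_meas[OF i] this] show ?thesis by (simp add: obs_def)
    qed
    have int': "integrable (M n) (\<lambda>\<omega>. g (U n i \<omega>, X n i \<omega>) * Q1 n i \<omega>)"
      using int by (subst (asm) Bochner_Integration.integrable_cong[OF refl eq]) auto
    have "integral\<^sup>L (M n) (term_at n (score_fn n j) i u) = (\<integral>\<omega>. g (U n i \<omega>, X n i \<omega>) * Q1 n i \<omega> \<partial>M n)"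
      by (rule Bochner_Integration.integral_cong[OF refl eq])
    also have "\<dots> = 0"
      by (rule integral_mult_eq_0_of_cond_exp_eq_0[OF Vm _ Q1_mean[OF i] gm int']) (use Q1_int[OF i] in auto)
    finally show "integrable (M n) (term_at n (score_fn n j) i u) \<and> integral\<^sup>L (M n) (term_at n (score_fn n j) i u) = 0"
      using int by simp
  qed
qed

end

text \<open>The Borel versions of the variables agree with the original ones only on the sample
  space, so conditional bounds have to be transported between them.\<close>

lemma (in prob_space) nn_cond_exp_given_cong_le:
  fixes V V' :: "'a \<Rightarrow> real"
  assumes V: "V \<in> borel_measurable M" and F: "F \<in> borel_measurable M"
    and eq: "\<And>\<omega>. \<omega> \<in> space M \<Longrightarrow> F \<omega> = F' \<omega>" and le: "AE \<omega> in M. nn_cond_exp_given M borel V F' \<omega> \<le> C"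
  shows "AE \<omega> in M. nn_cond_exp_given M borel V F \<omega> \<le> C"
proof -
  define S where "S = vimage_algebra (space M) V (borel :: real measure)"
  interpret S: finite_measure_subalgebra M S
    unfolding S_def by (rule finite_measure_subalgebra_vimage[OF V])
  have F': "F' \<in> borel_measurable M" using F eq by (simp cong: measurable_cong)
  have "AE \<omega> in M. nn_cond_exp M S (\<lambda>\<omega>. ennreal (F \<omega>)) \<omega> = nn_cond_exp M S (\<lambda>\<omega>. ennreal (F' \<omega>)) \<omega>"
    by (rule S.nn_cond_exp_cong) (use F F' eq in auto)
  then show ?thesis using le by eventually_elim (simp add: nn_cond_exp_given_def S_def)
qed

lemma Max_image_le:
  fixes F :: "'j \<Rightarrow> ennreal"
  assumes "finite A" "j \<in> A" "Max (F ` A) \<le> C"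
  shows "F j \<le> C"
  using assms by (auto intro: order_trans[OF Max_ge])

section \<open>The event on which the deterministic estimate applies\<close>

context svc_model
begin

text \<open>The power \<open>l\<close> is kept in the score, where cancellation matters. In the
  other two sums the slope weight is bounded by a constant on the support of the kernel and has been
  dropped.\<close>

definition good :: "(real \<Rightarrow> real) \<Rightarrow> nat \<Rightarrow> real \<Rightarrow> real \<Rightarrow> 'a \<Rightarrow> bool" where
  "good K n C g \<omega> \<longleftrightarrow> (\<forall>k\<in>{1..n}.
     (\<forall>j\<in>{1..d n}. \<forall>l\<in>{0, 1}. \<bar>\<Sum>i=1..n. Q1 n i \<omega> * X n i \<omega> j *
        (((U n i \<omega> - U n k \<omega>) / h n) ^ l * K ((U n i \<omega> - U n k \<omega>) / h n))\<bar> \<le> real n * h n * g) \<and>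
     (\<forall>j\<in>{1..d n}. \<forall>j'\<in>{1..d n}. (\<Sum>i=1..n. \<bar>Q2 n i \<omega> * X n i \<omega> j * X n i \<omega> j'\<bar> *
        K ((U n i \<omega> - U n k \<omega>) / h n)) \<le> real n * h n * C) \<and>
     (\<forall>j\<in>{1..d n}. \<forall>j'\<in>{1..d n}. \<forall>j''\<in>{1..d n}.
        (\<Sum>i=1..n. \<bar>X n i \<omega> j * X n i \<omega> j' * X n i \<omega> j'' * Mf n (X n i \<omega>) (U n i \<omega>) (y n i \<omega>)\<bar> *
        K ((U n i \<omega> - U n k \<omega>) / h n)) \<le> real n * h n * C))"

lemma total_eq:
  assumes "kernel_sample (M n) (obs_space (d n)) (obs n) n fst w W B (h n) cU"
  shows "kernel_sample.wsum (obs n) n fst w (h n) F k \<omega> = (\<Sum>i=1..n. F (obs n i \<omega>) * w ((U n i \<omega> - U n k \<omega>) / h n))"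
proof -
  interpret kernel_sample "M n" "obs_space (d n)" "obs n" n fst w W B "h n" cU by (rule assms)
  show ?thesis by (simp add: wsum_def wterm_def obs_def)
qed

lemma cond_exp_le_obs:
  assumes i: "i \<in> {1..n}" and F: "F \<in> borel_measurable (obs_space (d n))"
    and eq: "\<And>\<omega>. \<omega> \<in> space (M n) \<Longrightarrow> F (obs n i \<omega>) = F' \<omega>"
    and le: "AE \<omega> in M n. nn_cond_exp_given (M n) borel (U n i) F' \<omega> \<le> C"
  shows "AE \<omega> in M n. nn_cond_exp_given (M n) borel (\<lambda>\<omega>. fst (obs n i \<omega>)) (\<lambda>\<omega>. F (obs n i \<omega>)) \<omega> \<le> C"
proof -
  interpret prob_space "M n" by (rule prob)
  have fst: "(\<lambda>\<omega>. fst (obs n i \<omega>)) = U n i" by (auto simp: obs_def)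
  have "(\<lambda>\<omega>. fst (obs n i \<omega>)) \<in> borel_measurable (M n)"
    by (rule measurable_compose[OF obs_meas[OF i] proj_meas(1)])
  then show ?thesis unfolding fst
    by (rule nn_cond_exp_given_cong_le[OF _ measurable_compose[OF obs_meas[OF i] F] eq le])
qed

lemma good_eventI:
  fixes C C' \<epsilon> g :: real
  assumes K: "kernel_sample (M n) (obs_space (d n)) (obs n) n fst K W B (h n) cU" "0 \<le> C" "0 \<le> C'"
    and K1: "kernel_sample (M n) (obs_space (d n)) (obs n) n fst (\<lambda>t. t * K t) W B (h n) cU"
    and score0: "holds_off (M n) (\<epsilon> / 4) (\<lambda>\<omega>. \<forall>k\<in>{1..n}. \<forall>j\<in>{1..d n}.
        \<bar>kernel_sample.wsum (obs n) n fst K (h n) (score_fn n j) k \<omega>\<bar> \<le> real n * h n * g)"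
    and score1: "holds_off (M n) (\<epsilon> / 4) (\<lambda>\<omega>. \<forall>k\<in>{1..n}. \<forall>j\<in>{1..d n}.
        \<bar>kernel_sample.wsum (obs n) n fst (\<lambda>t. t * K t) (h n) (score_fn n j) k \<omega>\<bar> \<le> real n * h n * g)"
    and curv: "holds_off (M n) (\<epsilon> / 4) (\<lambda>\<omega>. \<forall>k\<in>{1..n}. \<forall>j\<in>{1..d n} \<times> {1..d n}.
        \<bar>kernel_sample.wsum (obs n) n fst K (h n) (curv_fn n j) k \<omega>\<bar> \<le> real n * h n * C)"
    and third: "holds_off (M n) (\<epsilon> / 4) (\<lambda>\<omega>. \<forall>k\<in>{1..n}. \<forall>j\<in>{1..d n} \<times> {1..d n} \<times> {1..d n}.
        \<bar>kernel_sample.wsum (obs n) n fst K (h n) (third_fn n j) k \<omega>\<bar> \<le> real n * h n * C')"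
  shows "holds_off (M n) \<epsilon> (good K n (max C C') g)"
proof -
  interpret prob_space "M n" by (rule prob)
  note all = holds_off_conj[OF holds_off_conj[OF score0 score1] holds_off_conj[OF curv third]]
  show ?thesis
  proof (rule holds_off_mono[OF all])
    fix \<omega> assume \<omega>: "\<omega> \<in> space (M n)" and H: "((\<forall>k\<in>{1..n}. \<forall>j\<in>{1..d n}.
        \<bar>kernel_sample.wsum (obs n) n fst K (h n) (score_fn n j) k \<omega>\<bar> \<le> real n * h n * g) \<and>
      (\<forall>k\<in>{1..n}. \<forall>j\<in>{1..d n}.
        \<bar>kernel_sample.wsum (obs n) n fst (\<lambda>t. t * K t) (h n) (score_fn n j) k \<omega>\<bar> \<le> real n * h n * g)) \<and>
      (\<forall>k\<in>{1..n}. \<forall>j\<in>{1..d n} \<times> {1..d n}.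
        \<bar>kernel_sample.wsum (obs n) n fst K (h n) (curv_fn n j) k \<omega>\<bar> \<le> real n * h n * C) \<and>
      (\<forall>k\<in>{1..n}. \<forall>j\<in>{1..d n} \<times> {1..d n} \<times> {1..d n}.
        \<bar>kernel_sample.wsum (obs n) n fst K (h n) (third_fn n j) k \<omega>\<bar> \<le> real n * h n * C')"
    have mx: "real n * h n * C \<le> real n * h n * max C C'" "real n * h n * C' \<le> real n * h n * max C C'"
      using h_pos[of n] by (auto intro!: mult_left_mono)
    note H' = H[unfolded total_eq[OF K(1)] total_eq[OF K1]]
    have s: "(\<Sum>i=1..n. score_fn n j (obs n i \<omega>) * F i) = (\<Sum>i=1..n. Q1 n i \<omega> * X n i \<omega> j * F i)"
      "(\<Sum>i=1..n. curv_fn n (j, j') (obs n i \<omega>) * F i) = (\<Sum>i=1..n. \<bar>Q2 n i \<omega> * X n i \<omega> j * X n i \<omega> j'\<bar> * F i)"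
      "(\<Sum>i=1..n. third_fn n (j, j', j'') (obs n i \<omega>) * F i)
        = (\<Sum>i=1..n. \<bar>X n i \<omega> j * X n i \<omega> j' * X n i \<omega> j'' * Mf n (X n i \<omega>) (U n i \<omega>) (y n i \<omega>)\<bar> * F i)"
      for j j' j'' and F :: "nat \<Rightarrow> real"
      by (auto intro!: sum.cong simp: obs_simps \<omega>)
    show "good K n (max C C') g \<omega>"
      unfolding good_def
    proof (intro ballI conjI)
      fix k j l assume "k \<in> {1..n}" "j \<in> {1..d n}" "l \<in> {0, 1 :: nat}"
      then show "\<bar>\<Sum>i=1..n. Q1 n i \<omega> * X n i \<omega> j *
        (((U n i \<omega> - U n k \<omega>) / h n) ^ l * K ((U n i \<omega> - U n k \<omega>) / h n))\<bar> \<le> real n * h n * g"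
        using conjunct1[OF H'] unfolding s by auto
    next
      fix k j j' assume k: "k \<in> {1..n}" "j \<in> {1..d n}" "j' \<in> {1..d n}"
      have "\<bar>\<Sum>i=1..n. curv_fn n (j, j') (obs n i \<omega>) * K ((U n i \<omega> - U n k \<omega>) / h n)\<bar> \<le> real n * h n * C"
        using H' k by blast
      then show "(\<Sum>i=1..n. \<bar>Q2 n i \<omega> * X n i \<omega> j * X n i \<omega> j'\<bar> *
        K ((U n i \<omega> - U n k \<omega>) / h n)) \<le> real n * h n * max C C'"
        unfolding s using mx(1) by linarith
    next
      fix k j j' j'' assume k: "k \<in> {1..n}" "j \<in> {1..d n}" "j' \<in> {1..d n}" "j'' \<in> {1..d n}"
      have "\<bar>\<Sum>i=1..n. third_fn n (j, j', j'') (obs n i \<omega>) * K ((U n i \<omega> - U n k \<omega>) / h n)\<bar> \<le> real n * h n * C'"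
        using H' k by blast
      then show "(\<Sum>i=1..n. \<bar>X n i \<omega> j * X n i \<omega> j' * X n i \<omega> j'' * Mf n (X n i \<omega>) (U n i \<omega>) (y n i \<omega>)\<bar> *
        K ((U n i \<omega> - U n k \<omega>) / h n)) \<le> real n * h n * max C C'"
        unfolding s using mx(2) by linarith
    qed
  qed simp
qed

text \<open>\<psi> stands for the absolute moment of order m0 or q, so one argument serves both
  regimes. \<open>F\<close> is the other maximum in the joint hypothesis and can only increase the
  left-hand side.\<close>

lemma score_cond_le:
  assumes i: "i \<in> {1..n}" and j: "j \<in> {1..d n}" and \<psi>: "\<psi> \<in> borel_measurable borel"
    and le: "AE \<omega> in M n.
      (MAX j\<in>{1..d n}. nn_cond_exp_given (M n) borel (U n i) (\<lambda>\<omega>. \<psi> (Q1 n i \<omega> * X n i \<omega> j)) \<omega>) + F \<omega> \<le> C"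
  shows "AE \<omega> in M n. nn_cond_exp_given (M n) borel (\<lambda>\<omega>. fst (obs n i \<omega>)) (\<lambda>\<omega>. \<psi> (score_fn n j (obs n i \<omega>))) \<omega> \<le> C"
proof (rule cond_exp_le_obs[OF i, where F="\<lambda>z. \<psi> (score_fn n j z)"])
  show "(\<lambda>z. \<psi> (score_fn n j z)) \<in> borel_measurable (obs_space (d n))"
    by (rule measurable_compose[OF score_fn_meas[OF j] \<psi>])
  show "AE \<omega> in M n. nn_cond_exp_given (M n) borel (U n i) (\<lambda>\<omega>. \<psi> (Q1 n i \<omega> * X n i \<omega> j)) \<omega> \<le> C"
    using le
  proof eventually_elim
    case (elim \<omega>)
    show ?case
      by (rule Max_image_le[OF _ j, where F="\<lambda>j. nn_cond_exp_given (M n) borel (U n i) (\<lambda>\<omega>. \<psi> (Q1 n i \<omega> * X n i \<omega> j)) \<omega>"])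
        (use order_trans[OF _ elim] in auto)
  qed
qed (simp add: obs_simps(1)[OF i])

text \<open>Invariance of \<psi> under the absolute value absorbs the one in
  \<open>curv_fn\<close>.\<close>

lemma curv_cond_le:
  assumes i: "i \<in> {1..n}" and p: "p \<in> {1..d n} \<times> {1..d n}" and \<psi>: "\<psi> \<in> borel_measurable borel" "\<And>x. \<psi> \<bar>x\<bar> = \<psi> x"
    and le: "AE \<omega> in M n. F \<omega> + (MAX (j, k)\<in>{1..d n} \<times> {1..d n}. nn_cond_exp_given (M n) borel (U n i)
      (\<lambda>\<omega>. \<psi> (Q2 n i \<omega> * X n i \<omega> j * X n i \<omega> k)) \<omega>) \<le> C"
  shows "AE \<omega> in M n. nn_cond_exp_given (M n) borel (\<lambda>\<omega>. fst (obs n i \<omega>)) (\<lambda>\<omega>. \<psi> (curv_fn n p (obs n i \<omega>))) \<omega> \<le> C"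
proof -
  obtain j k where jk: "p = (j, k)" by (cases p)
  show ?thesis
  proof (rule cond_exp_le_obs[OF i, where F="\<lambda>z. \<psi> (curv_fn n p z)"])
    show "(\<lambda>z. \<psi> (curv_fn n p z)) \<in> borel_measurable (obs_space (d n))"
      by (rule measurable_compose[OF curv_fn_meas[OF p] \<psi>(1)])
    show "AE \<omega> in M n. nn_cond_exp_given (M n) borel (U n i) (\<lambda>\<omega>. \<psi> (Q2 n i \<omega> * X n i \<omega> j * X n i \<omega> k)) \<omega> \<le> C"
      using le
    proof eventually_elim
      case (elim \<omega>)
      have "(case p of (j, k) \<Rightarrow> nn_cond_exp_given (M n) borel (U n i) (\<lambda>\<omega>. \<psi> (Q2 n i \<omega> * X n i \<omega> j * X n i \<omega> k)) \<omega>) \<le> C"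
        by (rule Max_image_le[OF _ p]) (use order_trans[OF _ elim] in auto)
      then show ?case by (simp add: jk)
    qed
  qed (simp add: obs_simps(2)[OF i] jk \<psi>(2))
qed

lemma third_cond_le:
  assumes i: "i \<in> {1..n}" and p: "p \<in> {1..d n} \<times> {1..d n} \<times> {1..d n}"
    and \<psi>: "\<psi> \<in> borel_measurable borel" "\<And>x. \<psi> \<bar>x\<bar> = \<psi> x"
    and le: "AE \<omega> in M n. (MAX (j, k, l)\<in>{1..d n} \<times> {1..d n} \<times> {1..d n}. nn_cond_exp_given (M n) borel (U n i)
      (\<lambda>\<omega>. \<psi> (X n i \<omega> j * X n i \<omega> k * X n i \<omega> l * Mf n (X n i \<omega>) (U n i \<omega>) (y n i \<omega>))) \<omega>) \<le> C"
  shows "AE \<omega> in M n. nn_cond_exp_given (M n) borel (\<lambda>\<omega>. fst (obs n i \<omega>)) (\<lambda>\<omega>. \<psi> (third_fn n p (obs n i \<omega>))) \<omega> \<le> C"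
proof -
  obtain j k l where jk: "p = (j, k, l)" by (cases p)
  show ?thesis
  proof (rule cond_exp_le_obs[OF i, where F="\<lambda>z. \<psi> (third_fn n p z)"])
    show "(\<lambda>z. \<psi> (third_fn n p z)) \<in> borel_measurable (obs_space (d n))"
      by (rule measurable_compose[OF third_fn_meas[OF p] \<psi>(1)])
    show "AE \<omega> in M n. nn_cond_exp_given (M n) borel (U n i)
        (\<lambda>\<omega>. \<psi> (X n i \<omega> j * X n i \<omega> k * X n i \<omega> l * Mf n (X n i \<omega>) (U n i \<omega>) (y n i \<omega>))) \<omega> \<le> C"
      using le
    proof eventually_elim
      case (elim \<omega>)
      have "(case p of (j, k, l) \<Rightarrow> nn_cond_exp_given (M n) borel (U n i)
        (\<lambda>\<omega>. \<psi> (X n i \<omega> j * X n i \<omega> k * X n i \<omega> l * Mf n (X n i \<omega>) (U n i \<omega>) (y n i \<omega>))) \<omega>) \<le> C"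
        by (rule Max_image_le[OF _ p elim]) auto
      then show ?case by (simp add: jk)
    qed
  qed (simp add: obs_simps(3)[OF i] jk \<psi>(2))
qed

end

text \<open>The local linear score has one component with weight K and one with weight t K(t). A
  common majorant lets both components and the curvature and third-order families share their
  constants.\<close>

locale svc_kernel = svc_model +
  fixes K :: "real \<Rightarrow> real" and W B :: real
  assumes K_meas: "K \<in> borel_measurable borel" and K_le: "\<And>t. \<bar>K t\<bar> \<le> W * indicator {-B..B} t"
    and tK_le: "\<And>t. \<bar>t * K t\<bar> \<le> W * indicator {-B..B} t" and W_pos: "0 < W" and B_pos: "0 < B"
begin

lemma tK_meas: "(\<lambda>t. t * K t) \<in> borel_measurable borel"
  using K_meas by measurable

sublocale S0: kernel_array M "\<lambda>n. obs_space (d n)" obs fst K W B h cU d "\<lambda>n. {1..d n}" score_fn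
  by (rule score_array[OF K_meas K_le W_pos B_pos])
sublocale S1: kernel_array M "\<lambda>n. obs_space (d n)" obs fst "\<lambda>t. t * K t" W B h cU d "\<lambda>n. {1..d n}" score_fn
  by (rule score_array[OF tK_meas tK_le W_pos B_pos])
sublocale C0: kernel_array M "\<lambda>n. obs_space (d n)" obs fst K W B h cU d "\<lambda>n. {1..d n} \<times> {1..d n}" curv_fn
  by (rule curv_array[OF K_meas K_le W_pos B_pos])
sublocale T0: kernel_array M "\<lambda>n. obs_space (d n)" obs fst K W B h cU d "\<lambda>n. {1..d n} \<times> {1..d n} \<times> {1..d n}" third_fn
  by (rule third_array[OF K_meas K_le W_pos B_pos])

text \<open>The bound on the curvature and third-order sums is fixed before \<epsilon> and \<eta>;
  only the score has to fall below an arbitrary multiple of \<open>lam\<close>.\<close>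

lemma good_poly:
  fixes m0 C D :: real
  assumes m0: "2 < m0"
    and mom1: "\<forall>n. \<forall>i\<in>{1..n}. AE \<omega> in M n.
           (MAX j\<in>{1..d n}. nn_cond_exp_given (M n) borel (U n i)
              (\<lambda>\<omega>. \<bar>Q1 n i \<omega> * X n i \<omega> j\<bar> powr m0) \<omega>) +
           (MAX (j, k)\<in>{1..d n} \<times> {1..d n}. nn_cond_exp_given (M n) borel (U n i)
              (\<lambda>\<omega>. \<bar>Q2 n i \<omega> * X n i \<omega> j * X n i \<omega> k\<bar> powr m0) \<omega>) \<le> ennreal C"
    and mom2: "\<forall>n. \<forall>i\<in>{1..n}. AE \<omega> in M n.
           (MAX (j, k, l)\<in>{1..d n} \<times> {1..d n} \<times> {1..d n}. nn_cond_exp_given (M n) borel (U n i)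
              (\<lambda>\<omega>. \<bar>X n i \<omega> j * X n i \<omega> k * X n i \<omega> l *
                     Mf n (X n i \<omega>) (U n i \<omega>) (y n i \<omega>)\<bar> powr m0) \<omega>) \<le> ennreal D"
    and lam: "\<And>n. 0 < lam n"
    and rate0: "filterlim (\<lambda>n. real n * h n / ((real n * real (d n) ^ 3) powr (1 / m0) * (ln (real n) + ln (real (d n))))) at_top sequentially"
    and rate1: "filterlim (\<lambda>n. real n * h n * lam n * min (lam n) (1 / (real n * real (d n) ^ 3) powr (1 / m0)) / (ln (real n) + ln (real (d n))))
      at_top sequentially"
    and bias: "(\<lambda>n. ((real n * real (d n) ^ 3) powr (1 / m0)) powr (1 - m0) / lam n) \<longlonglongrightarrow> 0"
  shows "\<exists>C\<ge>0. \<forall>\<epsilon>>0. \<forall>\<eta>>0. \<forall>\<^sub>F n in sequentially. holds_off (M n) \<epsilon> (good K n C (\<eta> * lam n))"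
proof -
  \<comment> \<open>The given constants may be negative, where \<open>ennreal\<close> is 0; the
    maximum with 0 yields a real bound that can be calculated with.\<close>
  define E where "E = max 0 (max C D)"
  have E: "0 \<le> E" "ennreal C \<le> ennreal E" "ennreal D \<le> ennreal E"
    unfolding E_def by (auto intro!: ennreal_leI)
  have \<psi>: "(\<lambda>x::real. \<bar>x\<bar> powr m0) \<in> borel_measurable borel" by measurable
  have mom1': "AE \<omega> in M n.
           (MAX j\<in>{1..d n}. nn_cond_exp_given (M n) borel (U n i)
              (\<lambda>\<omega>. \<bar>Q1 n i \<omega> * X n i \<omega> j\<bar> powr m0) \<omega>) +
           (MAX (j, k)\<in>{1..d n} \<times> {1..d n}. nn_cond_exp_given (M n) borel (U n i)
              (\<lambda>\<omega>. \<bar>Q2 n i \<omega> * X n i \<omega> j * X n i \<omega> k\<bar> powr m0) \<omega>) \<le> ennreal E" if "i \<in> {1..n}" for n i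
    by (rule eventually_mono[OF mom1[rule_format, OF that]]) (rule order_trans[OF _ E(2)])
  have mom2': "AE \<omega> in M n.
           (MAX (j, k, l)\<in>{1..d n} \<times> {1..d n} \<times> {1..d n}. nn_cond_exp_given (M n) borel (U n i)
              (\<lambda>\<omega>. \<bar>X n i \<omega> j * X n i \<omega> k * X n i \<omega> l *
                     Mf n (X n i \<omega>) (U n i \<omega>) (y n i \<omega>)\<bar> powr m0) \<omega>) \<le> ennreal E" if "i \<in> {1..n}" for n i
    by (rule eventually_mono[OF mom2[rule_format, OF that]]) (rule order_trans[OF _ E(3)])
  note sm = score_cond_le[OF _ _ \<psi> mom1'] and cm = curv_cond_le[OF _ _ \<psi> _ mom1'] and tm = third_cond_le[OF _ _ \<psi> _ mom2']
  have sp0: "S0.poly_moments m0 (max E (E * (cU * B)))" by (rule S0.poly_momentsI[OF m0 E(1)], rule sm) auto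
  have sp1: "S1.poly_moments m0 (max E (E * (cU * B)))" by (rule S1.poly_momentsI[OF m0 E(1)], rule sm) auto
  have cp: "C0.poly_moments m0 (max E (E * (cU * B)))" by (rule C0.poly_momentsI[OF m0 E(1)], rule cm) auto
  have tp: "T0.poly_moments m0 (max E (E * (cU * B)))" by (rule T0.poly_momentsI[OF m0 E(1)], rule tm) auto
  have c0: S0.centred by (rule score_centred[OF K_meas K_le W_pos B_pos]) (use S0.finite_first_moment sp0 in blast)
  have c1: S1.centred by (rule score_centred[OF tK_meas tK_le W_pos B_pos]) (use S1.finite_first_moment sp1 in blast)
  obtain C' where C': "0 \<le> C'" and Cb: "\<And>\<epsilon>. 0 < \<epsilon> \<Longrightarrow> \<forall>\<^sub>F n in sequentially. holds_off (M n) \<epsilon>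
    (\<lambda>\<omega>. \<forall>k\<in>{1..n}. \<forall>j\<in>{1..d n} \<times> {1..d n}. \<bar>C0.total n (curv_fn n j) k \<omega>\<bar> \<le> real n * h n * C')"
    using C0.poly_moments_bounded[OF cp] rate0 unfolding C0.G_def by blast
  obtain D' where D': "0 \<le> D'" and Db: "\<And>\<epsilon>. 0 < \<epsilon> \<Longrightarrow> \<forall>\<^sub>F n in sequentially. holds_off (M n) \<epsilon>
    (\<lambda>\<omega>. \<forall>k\<in>{1..n}. \<forall>j\<in>{1..d n} \<times> {1..d n} \<times> {1..d n}. \<bar>T0.total n (third_fn n j) k \<omega>\<bar> \<le> real n * h n * D')"
    using T0.poly_moments_bounded[OF tp] rate0 unfolding T0.G_def by blast
  show ?thesis
  proof (intro exI[of _ "max C' D'"] conjI allI impI)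
    fix \<epsilon> \<eta> :: real assume \<epsilon>: "0 < \<epsilon>" and \<eta>: "0 < \<eta>"
    have e4: "0 < \<epsilon> / 4" using \<epsilon> by simp
    note s0 = S0.poly_moments_small[OF sp0 c0 lam rate1[folded S0.G_def] bias[folded S0.G_def] e4 \<eta>]
      and s1 = S1.poly_moments_small[OF sp1 c1 lam rate1[folded S1.G_def] bias[folded S1.G_def] e4 \<eta>]
    show "\<forall>\<^sub>F n in sequentially. holds_off (M n) \<epsilon> (good K n (max C' D') (\<eta> * lam n))"
      using s0 s1 Cb[OF e4] Db[OF e4]
    proof eventually_elim
      case (elim n)
      show ?case by (rule good_eventI[OF S0.sample C' D' S1.sample elim])
    qed
  qed (use C' in auto)
qed

lemma good_exp:
  fixes C D :: real
  assumes mom1: "\<forall>q::nat\<ge>2. \<forall>n. \<forall>i\<in>{1..n}. AE \<omega> in M n.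
           (MAX j\<in>{1..d n}. nn_cond_exp_given (M n) borel (U n i)
              (\<lambda>\<omega>. \<bar>Q1 n i \<omega> * X n i \<omega> j\<bar> ^ q) \<omega>) +
           (MAX (j, k)\<in>{1..d n} \<times> {1..d n}. nn_cond_exp_given (M n) borel (U n i)
              (\<lambda>\<omega>. \<bar>Q2 n i \<omega> * X n i \<omega> j * X n i \<omega> k\<bar> ^ q) \<omega>) \<le> ennreal (C * fact q / 2)"
    and mom2: "\<forall>q::nat\<ge>2. \<forall>n. \<forall>i\<in>{1..n}. AE \<omega> in M n.
           (MAX (j, k, l)\<in>{1..d n} \<times> {1..d n} \<times> {1..d n}. nn_cond_exp_given (M n) borel (U n i)
              (\<lambda>\<omega>. \<bar>X n i \<omega> j * X n i \<omega> k * X n i \<omega> l *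
                     Mf n (X n i \<omega>) (U n i \<omega>) (y n i \<omega>)\<bar> ^ q) \<omega>) < ennreal (D * fact q / 2)"
    and lam: "\<And>n. 0 < lam n" and lam0: "lam \<longlonglongrightarrow> 0"
    and rate0: "filterlim (\<lambda>n. real n * h n / (ln (real n) + ln (real (d n)))) at_top sequentially"
    and rate1: "filterlim (\<lambda>n. real n * h n * (lam n)\<^sup>2 / (ln (real n) + ln (real (d n)))) at_top sequentially"
  shows "\<exists>C\<ge>0. \<forall>\<epsilon>>0. \<forall>\<eta>>0. \<forall>\<^sub>F n in sequentially. holds_off (M n) \<epsilon> (good K n C (\<eta> * lam n))"
proof -
  \<comment> \<open>The halves come from the normalisation q!/2 of the hypotheses; the moment
    classes use q! itself.\<close>
  define E where "E = max 0 (max (C / 2) (D / 2))"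
  have E: "0 \<le> E" "ennreal (C * fact q / 2) \<le> ennreal (E * fact q)" "ennreal (D * fact q / 2) \<le> ennreal (E * fact q)" for q
  proof -
    have "C / 2 * fact q \<le> E * fact q" "D / 2 * fact q \<le> E * fact q"
      unfolding E_def by (intro mult_right_mono; simp)+
    then show "0 \<le> E" "ennreal (C * fact q / 2) \<le> ennreal (E * fact q)" "ennreal (D * fact q / 2) \<le> ennreal (E * fact q)"
      by (auto simp: E_def intro!: ennreal_leI)
  qed
  have \<psi>: "(\<lambda>x::real. \<bar>x\<bar> ^ q) \<in> borel_measurable borel" for q :: nat by measurable
  have mom1': "AE \<omega> in M n.
           (MAX j\<in>{1..d n}. nn_cond_exp_given (M n) borel (U n i)
              (\<lambda>\<omega>. \<bar>Q1 n i \<omega> * X n i \<omega> j\<bar> ^ q) \<omega>) +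
           (MAX (j, k)\<in>{1..d n} \<times> {1..d n}. nn_cond_exp_given (M n) borel (U n i)
              (\<lambda>\<omega>. \<bar>Q2 n i \<omega> * X n i \<omega> j * X n i \<omega> k\<bar> ^ q) \<omega>) \<le> ennreal (E * fact q)" if "2 \<le> q" "i \<in> {1..n}" for q n i
    by (rule eventually_mono[OF mom1[rule_format, OF that]]) (rule order_trans[OF _ E(2)])
  have mom2': "AE \<omega> in M n.
           (MAX (j, k, l)\<in>{1..d n} \<times> {1..d n} \<times> {1..d n}. nn_cond_exp_given (M n) borel (U n i)
              (\<lambda>\<omega>. \<bar>X n i \<omega> j * X n i \<omega> k * X n i \<omega> l *
                     Mf n (X n i \<omega>) (U n i \<omega>) (y n i \<omega>)\<bar> ^ q) \<omega>) \<le> ennreal (E * fact q)" if "2 \<le> q" "i \<in> {1..n}" for q n i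
    by (rule eventually_mono[OF mom2[rule_format, OF that]]) (rule order_trans[OF less_imp_le E(3)])
  note sm = score_cond_le[OF _ _ \<psi> mom1'] and cm = curv_cond_le[OF _ _ \<psi> _ mom1'] and tm = third_cond_le[OF _ _ \<psi> _ mom2']
  have sp0: "S0.exp_moments (max E (E * (cU * B)))" by (rule S0.exp_momentsI[OF E(1)], rule sm) auto
  have sp1: "S1.exp_moments (max E (E * (cU * B)))" by (rule S1.exp_momentsI[OF E(1)], rule sm) auto
  have cp: "C0.exp_moments (max E (E * (cU * B)))" by (rule C0.exp_momentsI[OF E(1)], rule cm) auto
  have tp: "T0.exp_moments (max E (E * (cU * B)))" by (rule T0.exp_momentsI[OF E(1)], rule tm) auto
  have c0: S0.centred by (rule score_centred[OF K_meas K_le W_pos B_pos]) (use S0.finite_first_moment sp0 in blast)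
  have c1: S1.centred by (rule score_centred[OF tK_meas tK_le W_pos B_pos]) (use S1.finite_first_moment sp1 in blast)
  obtain C' where C': "0 \<le> C'" and Cb: "\<And>\<epsilon>. 0 < \<epsilon> \<Longrightarrow> \<forall>\<^sub>F n in sequentially. holds_off (M n) \<epsilon>
    (\<lambda>\<omega>. \<forall>k\<in>{1..n}. \<forall>j\<in>{1..d n} \<times> {1..d n}. \<bar>C0.total n (curv_fn n j) k \<omega>\<bar> \<le> real n * h n * C')"
    using C0.exp_moments_bounded[OF cp rate0] by blast
  obtain D' where D': "0 \<le> D'" and Db: "\<And>\<epsilon>. 0 < \<epsilon> \<Longrightarrow> \<forall>\<^sub>F n in sequentially. holds_off (M n) \<epsilon>
    (\<lambda>\<omega>. \<forall>k\<in>{1..n}. \<forall>j\<in>{1..d n} \<times> {1..d n} \<times> {1..d n}. \<bar>T0.total n (third_fn n j) k \<omega>\<bar> \<le> real n * h n * D')"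
    using T0.exp_moments_bounded[OF tp rate0] by blast
  show ?thesis
  proof (intro exI[of _ "max C' D'"] conjI allI impI)
    fix \<epsilon> \<eta> :: real assume \<epsilon>: "0 < \<epsilon>" and \<eta>: "0 < \<eta>"
    have e4: "0 < \<epsilon> / 4" using \<epsilon> by simp
    note s0 = S0.exp_moments_small[OF sp0 c0 lam lam0 rate1 e4 \<eta>]
      and s1 = S1.exp_moments_small[OF sp1 c1 lam lam0 rate1 e4 \<eta>]
    show "\<forall>\<^sub>F n in sequentially. holds_off (M n) \<epsilon> (good K n (max C' D') (\<eta> * lam n))"
      using s0 s1 Cb[OF e4] Db[OF e4]
    proof eventually_elim
      case (elim n)
      show ?case by (rule good_eventI[OF S0.sample C' D' S1.sample elim])
    qed
  qed (use C' in auto)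
qed

end

section \<open>Growth rates\<close>

lemma eventually_ge_of_at_top:
  fixes f :: "'a \<Rightarrow> real"
  assumes "filterlim f at_top F"
  shows "\<forall>\<^sub>F x in F. Z \<le> f x"
  using assms by (simp add: filterlim_at_top)

lemma powr_at_top: "0 < e \<Longrightarrow> filterlim (\<lambda>x::real. x powr e) at_top at_top"
  by real_asymp

text \<open>Half of the exponent \<delta> is given away to absorb the unknown constant in the size
  of \<open>h\<close>.\<close>

lemma eventually_ln_bandwidth:
  fixes h :: "nat \<Rightarrow> real"
  assumes h: "propto h (\<lambda>n. real n powr (- \<delta>))" "\<And>n. 0 < h n" and \<delta>: "0 < \<delta>"
  shows "\<forall>\<^sub>F n in sequentially. \<delta> / 2 * ln (real n) \<le> ln (inverse (h n))" and "h \<longlonglongrightarrow> 0"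
proof -
  obtain c1 c2 where c: "0 < c1" "c1 \<le> c2"
    and ev: "\<forall>\<^sub>F n in sequentially. c1 * real n powr (- \<delta>) \<le> h n \<and> h n \<le> c2 * real n powr (- \<delta>)"
    using h(1) unfolding propto_def by blast
  have c2: "0 < c2" using c by simp
  have "filterlim (\<lambda>n. \<delta> / 2 * ln (real n) - ln c2) at_top sequentially" using \<delta> by real_asymp
  then have "\<forall>\<^sub>F n in sequentially. 0 \<le> \<delta> / 2 * ln (real n) - ln c2" by (rule eventually_ge_of_at_top)
  then show "\<forall>\<^sub>F n in sequentially. \<delta> / 2 * ln (real n) \<le> ln (inverse (h n))"
    using ev eventually_gt_at_top[of 0]
  proof eventually_elim
    case (elim n)
    have "ln (h n) \<le> ln (c2 * real n powr (- \<delta>))" using elim h(2)[of n] by (subst ln_le_cancel_iff) auto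
    also have "\<dots> = ln c2 - \<delta> * ln (real n)" using elim c2 by (simp add: ln_mult ln_powr)
    finally show ?case using elim(1) h(2)[of n] by (simp add: ln_inverse)
  qed
  have "(\<lambda>n. c2 * real n powr (- \<delta>)) \<longlonglongrightarrow> 0" using \<delta> by real_asymp
  then show "h \<longlonglongrightarrow> 0"
  proof (rule tendsto_sandwich[of "\<lambda>_. 0", rotated 3])
    show "\<forall>\<^sub>F n in sequentially. 0 \<le> h n" using h(2) by (intro always_eventually allI less_imp_le)
    show "\<forall>\<^sub>F n in sequentially. h n \<le> c2 * real n powr (- \<delta>)" using ev by eventually_elim simp
  qed auto
qed

lemma ratio_at_top_of_smallo:
  fixes e lam s :: "nat \<Rightarrow> real"
  assumes "(\<lambda>n. s n + e n) \<in> o(lam)" "\<And>n. 0 \<le> s n" "\<And>n. 0 \<le> e n" "\<And>n. 0 < lam n" and C: "0 < C"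
  shows "\<forall>\<^sub>F n in sequentially. C * e n \<le> lam n"
proof -
  have "\<forall>\<^sub>F n in sequentially. norm (s n + e n) \<le> 1 / C * norm (lam n)"
    using C by (intro landau_o.smallD[OF assms(1)]) auto
  then show ?thesis
  proof eventually_elim
    case (elim n)
    then have "e n \<le> 1 / C * lam n" using assms(2)[of n] assms(3)[of n] assms(4)[of n] by simp
    then show ?case using C by (simp add: field_simps)
  qed
qed

lemma filterlim_at_top_of_le_const_mult:
  fixes f g :: "nat \<Rightarrow> real"
  assumes "filterlim f at_top sequentially" "0 < c" "\<forall>\<^sub>F n in sequentially. c * f n \<le> g n"
  shows "filterlim g at_top sequentially"
  by (rule filterlim_at_top_mono[OF filterlim_tendsto_pos_mult_at_top[OF tendsto_const assms(2,1)] assms(3)])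

context
  fixes d :: "nat \<Rightarrow> nat" and h lam s :: "nat \<Rightarrow> real" and \<delta>1 :: real
  assumes d: "\<And>n. 1 \<le> d n" and h: "\<And>n. 0 < h n" and lam: "\<And>n. 0 < lam n" and s: "\<And>n. 0 \<le> s n"
    and \<delta>1: "0 < \<delta>1" "\<delta>1 < 1" and hp: "propto h (\<lambda>n. real n powr (- \<delta>1))" and lam0: "lam \<longlonglongrightarrow> 0"
begin

private lemma logs_pos: "\<forall>\<^sub>F n in sequentially. 0 < ln (real n) + ln (real (d n)) \<and> 1 \<le> ln (real n)"
proof -
  have "\<forall>\<^sub>F n in sequentially. 1 \<le> ln (real n)" by real_asymp
  then show ?thesis
  proof eventually_elim
    case (elim n)
    have "0 \<le> ln (real (d n))" using d[of n] by simp
    then show ?case using elim by simp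
  qed
qed

private lemma log_h_ge_1: "\<forall>\<^sub>F n in sequentially. 1 \<le> ln (inverse (h n))"
proof -
  have "\<forall>\<^sub>F n in sequentially. 1 \<le> \<delta>1 / 2 * ln (real n)" using \<delta>1 by real_asymp
  then show ?thesis using eventually_ln_bandwidth(1)[OF hp h \<delta>1(1)] by eventually_elim simp
qed

text \<open>Put N = n h, b = ln (1 / h) and e = sqrt (b / N), so that N e^2 = b. The hypotheses say
  that Q = N / (G^2 b) tends to infinity and that \<open>lam\<close> eventually exceeds every
  multiple of e. Polynomial d and h make ln n + ln d at most a multiple of b, and the three rates
  become statements about these quantities.\<close>

lemma poly_rates:
  fixes m0 \<tau>1 :: real
  defines "G \<equiv> \<lambda>n. (real n * real (d n) ^ 3) powr (1 / m0)"
  defines "L \<equiv> \<lambda>n. ln (real n) + ln (real (d n))"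
  assumes m0: "2 < m0" and \<tau>1: "0 \<le> \<tau>1" and dp: "propto (\<lambda>n. real (d n)) (\<lambda>n. real n powr \<tau>1)"
    and q: "filterlim (\<lambda>n. real n * h n / ((real n * real (d n) ^ 3) powr (2 / m0) * ln (inverse (h n)))) at_top sequentially"
    and small: "(\<lambda>n. s n + (ln (inverse (h n)) / (real n * h n)) powr (1 / 2)) \<in> o(lam)"
  shows "filterlim (\<lambda>n. real n * h n / (G n * L n)) at_top sequentially"
    and "filterlim (\<lambda>n. real n * h n * lam n * min (lam n) (1 / G n) / L n) at_top sequentially"
    and "(\<lambda>n. G n powr (1 - m0) / lam n) \<longlonglongrightarrow> 0"
proof -
  define b where "b n = ln (inverse (h n))" for n
  define Q where "Q n = real n * h n / ((G n)\<^sup>2 * b n)" for n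
  define e where "e n = sqrt (b n / (real n * h n))" for n
  have G2: "(real n * real (d n) ^ 3) powr (2 / m0) = (G n)\<^sup>2" if "1 \<le> n" for n
  proof -
    have "0 < G n" using that d[of n] by (simp add: G_def)
    then have "(G n)\<^sup>2 = G n powr 2" by (simp add: powr_numeral)
    then show ?thesis by (simp add: G_def powr_powr)
  qed
  have n1: "\<forall>\<^sub>F n in sequentially. 1 \<le> (n::nat)" by (rule eventually_ge_at_top)
  have "\<forall>\<^sub>F n in sequentially. real n * h n / ((real n * real (d n) ^ 3) powr (2 / m0) * ln (inverse (h n))) = Q n"
    using n1 by eventually_elim (simp add: Q_def b_def G2)
  then have Q: "filterlim Q at_top sequentially" by (rule filterlim_cong[OF refl refl, THEN iffD1, OF _ q])
  have b1: "\<forall>\<^sub>F n in sequentially. 1 \<le> b n" unfolding b_def by (rule log_h_ge_1)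
  obtain c where c: "0 < c" and Lb: "\<forall>\<^sub>F n in sequentially. L n \<le> c * b n"
  proof -
    obtain c1 c2 where c12: "0 < c1" "c1 \<le> c2"
      and ev: "\<forall>\<^sub>F n in sequentially. c1 * real n powr \<tau>1 \<le> real (d n) \<and> real (d n) \<le> c2 * real n powr \<tau>1"
      using dp unfolding propto_def by blast
    have c2: "0 < c2" using c12 by simp
    \<comment> \<open>One extra ln n absorbs the constant \<open>c2\<close>; the factor 2 /
      \<delta>1 converts ln n into the logarithm of the inverse bandwidth.\<close>
    define c where "c = (\<tau>1 + 2) * (2 / \<delta>1)"
    have "filterlim (\<lambda>n. ln (real n) - ln c2) at_top sequentially" by real_asymp
    then have "\<forall>\<^sub>F n in sequentially. 0 \<le> ln (real n) - ln c2" by (rule eventually_ge_of_at_top)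
    then have "\<forall>\<^sub>F n in sequentially. L n \<le> c * b n"
      using ev eventually_ln_bandwidth(1)[OF hp h \<delta>1(1)] n1
    proof eventually_elim
      case (elim n)
      have "ln (real (d n)) \<le> ln (c2 * real n powr \<tau>1)"
        using elim d[of n] by (subst ln_le_cancel_iff) (auto simp: c2)
      also have "\<dots> = ln c2 + \<tau>1 * ln (real n)" using elim c2 by (simp add: ln_mult ln_powr)
      finally have "L n \<le> (\<tau>1 + 2) * ln (real n)" using elim(1) by (simp add: L_def algebra_simps)
      also have "\<dots> \<le> (\<tau>1 + 2) * (2 / \<delta>1 * b n)"
        using elim(3) \<tau>1 \<delta>1 by (intro mult_left_mono) (auto simp: b_def field_simps)
      also have "\<dots> = c * b n" unfolding c_def mult.assoc ..
      finally show ?case .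
    qed
    then show ?thesis using \<tau>1 \<delta>1 by (intro that[of c]) (auto simp: c_def)
  qed
  have e_eq: "(b n / (real n * h n)) powr (1 / 2) = e n" if "1 \<le> b n" for n
    unfolding e_def using that h[of n] by (intro powr_half_sqrt) auto
  have psi: "\<forall>\<^sub>F n in sequentially. C * e n \<le> lam n" if "0 < C" for C
    using ratio_at_top_of_smallo[OF small s powr_ge_zero lam that] b1
  proof eventually_elim
    case (elim n)
    then show ?case using e_eq[of n] by (simp add: b_def)
  qed
  have G1: "\<forall>\<^sub>F n in sequentially. 1 \<le> G n" using n1
  proof eventually_elim
    case (elim n)
    have "1 * 1 \<le> real n * real (d n) ^ 3" using elim d[of n] by (intro mult_mono) auto
    then show ?case unfolding G_def using m0 by (intro ge_one_powr_ge_zero) auto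
  qed
  have L0: "\<forall>\<^sub>F n in sequentially. 0 < L n \<and> 1 \<le> ln (real n)" unfolding L_def by (rule logs_pos)
  show "filterlim (\<lambda>n. real n * h n / (G n * L n)) at_top sequentially"
  proof (rule filterlim_at_top_of_le_const_mult[OF Q, of "1 / c"])
    show "\<forall>\<^sub>F n in sequentially. 1 / c * Q n \<le> real n * h n / (G n * L n)"
      using Lb G1 b1 L0
    proof eventually_elim
      case (elim n)
      have "G n * L n \<le> G n * (c * b n)" using elim by (intro mult_left_mono) auto
      also have "\<dots> \<le> (G n)\<^sup>2 * (c * b n)"
        using elim c by (intro mult_right_mono) (auto simp: power2_eq_square)
      finally have "real n * h n / ((G n)\<^sup>2 * (c * b n)) \<le> real n * h n / (G n * L n)"
        using elim h[of n] c by (intro divide_left_mono) (auto intro!: mult_pos_pos simp: power2_eq_square)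
      then show ?case by (simp add: Q_def mult_ac)
    qed
  qed (use c in auto)
  show "filterlim (\<lambda>n. real n * h n * lam n * min (lam n) (1 / G n) / L n) at_top sequentially"
    unfolding filterlim_at_top
  proof
    fix Z :: real
    \<comment> \<open>From Q \<ge> C^2 follows 1 / G \<ge> C e, and lam \<ge> C e holds as well.
      Hence lam min (lam, 1 / G) is at least C e^2, and N e^2 = b turns this into C b, which
      dominates Z L when Z \<ge> 0.\<close>
    define C where "C = max 1 (c * Z)"
    have C: "1 \<le> C" "c * Z \<le> C" by (auto simp: C_def)
    have "\<forall>\<^sub>F n in sequentially. C\<^sup>2 \<le> Q n" using Q by (auto simp: filterlim_at_top)
    moreover have "\<forall>\<^sub>F n in sequentially. C * e n \<le> lam n" by (rule psi) (use C in auto)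
    ultimately show "\<forall>\<^sub>F n in sequentially. Z \<le> real n * h n * lam n * min (lam n) (1 / G n) / L n"
      using Lb G1 b1 L0 n1
    proof eventually_elim
      case (elim n)
      define N where "N = real n * h n"
      have N: "0 < N" using elim h[of n] by (simp add: N_def)
      have e: "0 < e n" "N * (e n)\<^sup>2 = b n" using elim N by (auto simp: e_def N_def[symmetric])
      have el: "e n \<le> lam n"
      proof -
        have "1 * e n \<le> C * e n" using C(1) e(1) by (intro mult_right_mono) auto
        then show ?thesis using elim(2) by linarith
      qed
      have "(C * G n)\<^sup>2 * b n \<le> N" using elim by (simp add: Q_def N_def[symmetric] field_simps)
      moreover have "(C * G n * e n)\<^sup>2 * N = (C * G n)\<^sup>2 * (N * (e n)\<^sup>2)"
        by (simp add: power_mult_distrib mult_ac)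
      ultimately have "(C * G n * e n)\<^sup>2 * N \<le> 1 * N" using e(2) by simp
      then have "(C * G n * e n)\<^sup>2 \<le> 1" using N by (simp only: mult_le_cancel_right_pos)
      then have "C * G n * e n \<le> 1" using abs_square_le_1[of "C * G n * e n"] by simp
      then have Ge: "C * e n \<le> 1 / G n" using elim by (simp add: field_simps)
      have "c * Z * (e n)\<^sup>2 \<le> C * (e n)\<^sup>2" using C by (intro mult_right_mono) auto
      also have "\<dots> = e n * (C * e n)" by (simp add: power2_eq_square)
      also have "\<dots> \<le> lam n * min (lam n) (1 / G n)"
        using el Ge elim(2) e C by (intro mult_mono) auto
      finally have "N * (c * Z * (e n)\<^sup>2) \<le> N * (lam n * min (lam n) (1 / G n))"
        using N by (intro mult_left_mono) auto
      moreover have "N * (c * Z * (e n)\<^sup>2) = c * b n * Z" using e(2) by (simp add: mult_ac)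
      moreover have "Z * L n \<le> c * b n * Z" if "0 \<le> Z"
        using mult_left_mono[OF elim(3) that] by (simp add: mult_ac)
      ultimately have "Z * L n \<le> N * (lam n * min (lam n) (1 / G n))" if "0 \<le> Z" using that by linarith
      moreover have "Z * L n \<le> N * (lam n * min (lam n) (1 / G n))" if "Z < 0"
      proof -
        have "Z * L n \<le> 0" using that elim by (intro mult_nonpos_nonneg) auto
        also have "0 \<le> N * (lam n * min (lam n) (1 / G n))"
          using N lam[of n] elim by (intro mult_nonneg_nonneg) auto
        finally show ?thesis .
      qed
      ultimately have "Z * L n \<le> N * (lam n * min (lam n) (1 / G n))" by linarith
      then show ?case using elim by (simp add: N_def field_simps)
    qed
  qed
  show "(\<lambda>n. G n powr (1 - m0) / lam n) \<longlonglongrightarrow> 0"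
  \<comment> \<open>Since G^m0 = n d^3, the numerator G^(1 - m0) is at most G / n, and G \<le> sqrt
    N \<le> N lam = n h lam. Dividing by lam leaves the bandwidth, which tends to 0.\<close>
  proof (rule tendsto_sandwich[of "\<lambda>_. 0" _ _ h])
    show "h \<longlonglongrightarrow> 0" by (rule eventually_ln_bandwidth(2)[OF hp h \<delta>1(1)])
    show "\<forall>\<^sub>F n in sequentially. 0 \<le> G n powr (1 - m0) / lam n"
      by (intro always_eventually allI divide_nonneg_pos powr_ge_zero lam)
    have "\<forall>\<^sub>F n in sequentially. 1 \<le> Q n" using Q by (auto simp: filterlim_at_top)
    moreover have "\<forall>\<^sub>F n in sequentially. 1 * e n \<le> lam n" by (rule psi) auto
    ultimately show "\<forall>\<^sub>F n in sequentially. G n powr (1 - m0) / lam n \<le> h n"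
      using G1 b1 n1
    proof eventually_elim
      case (elim n)
      define N where "N = real n * h n"
      have N: "0 < N" using elim h[of n] by (simp add: N_def)
      have e: "0 < e n" "N * (e n)\<^sup>2 = b n" using elim N by (auto simp: e_def N_def[symmetric])
      have nd: "0 < real n * real (d n) ^ 3" using elim d[of n] by auto
      have "G n powr m0 = real n * real (d n) ^ 3"
        unfolding G_def powr_powr using m0 nd by simp
      then have "G n powr (1 - m0) = G n / (real n * real (d n) ^ 3)"
        using elim by (simp add: powr_diff)
      also have "\<dots> \<le> G n / real n"
        using elim d[of n] nd by (intro divide_left_mono) auto
      finally have g: "G n powr (1 - m0) \<le> G n / real n" .
      have "(G n)\<^sup>2 * b n \<le> N" using elim by (simp add: Q_def N_def[symmetric] field_simps)
      moreover have "(G n)\<^sup>2 * 1 \<le> (G n)\<^sup>2 * b n" using elim by (intro mult_left_mono) auto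
      ultimately have GN: "(G n)\<^sup>2 \<le> N" by simp
      have GsN: "G n \<le> sqrt N" using GN elim by (simp add: real_le_rsqrt)
      have "sqrt (1 / N) \<le> e n"
        unfolding e_def N_def[symmetric] using elim N by (intro real_sqrt_le_mono divide_right_mono) auto
      then have "1 / sqrt N \<le> lam n" using elim by (simp add: real_sqrt_divide)
      then have "sqrt N * (1 / sqrt N) \<le> sqrt N * lam n" using N by (intro mult_left_mono) auto
      then have "1 \<le> sqrt N * lam n" using N by simp
      then have "sqrt N * 1 \<le> sqrt N * (sqrt N * lam n)" using N by (intro mult_left_mono) auto
      moreover have "sqrt N * (sqrt N * lam n) = N * lam n" using N by (simp flip: mult.assoc)
      ultimately have "sqrt N \<le> N * lam n" by simp
      then have "G n \<le> N * lam n" using GsN by linarith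
      then have "G n / real n \<le> h n * lam n" using elim by (simp add: N_def field_simps)
      then have "G n powr (1 - m0) \<le> h n * lam n" using g by linarith
      then show ?case using lam[of n] by (simp add: field_simps)
    qed
  qed simp
qed

text \<open>Everything is expressed through N = n h: ln d is at most N^\<tau>2 up to a constant, ln
  n at most a multiple of ln N because N is at least a positive power of n, and lam^2 is at least
  N^(- \<tau>3).\<close>

lemma exp_rates:
  fixes \<tau>2 \<tau>3 :: real
  defines "L \<equiv> \<lambda>n. ln (real n) + ln (real (d n))"
  assumes \<tau>: "0 \<le> \<tau>2" "\<tau>2 < 1 - \<tau>3" "0 < \<tau>3"
    and dp: "propto (\<lambda>n. real (d n)) (\<lambda>n. exp ((real n * h n) powr \<tau>2))"
    and small: "(\<lambda>n. s n + (ln (inverse (h n)) / (real n * h n)) powr (\<tau>3 / 2)) \<in> o(lam)"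
  shows "filterlim (\<lambda>n. real n * h n / L n) at_top sequentially"
    and "filterlim (\<lambda>n. real n * h n * (lam n)\<^sup>2 / L n) at_top sequentially"
proof -
  define N where "N n = real n * h n" for n
  \<comment> \<open>Strictly between \<tau>2 and 1 - \<tau>3: the gap below makes room for ln n and
    the constants, also when \<tau>2 = 0, and the gap above keeps the exponent 1 - \<tau>3 - t
    positive.\<close>
  define t where "t = (\<tau>2 + (1 - \<tau>3)) / 2"
  have t: "0 < t" "\<tau>2 \<le> t" "t < 1 - \<tau>3" using \<tau> by (auto simp: t_def)
  have L0: "\<forall>\<^sub>F n in sequentially. 0 < L n \<and> 1 \<le> ln (real n)" unfolding L_def by (rule logs_pos)
  have n1: "\<forall>\<^sub>F n in sequentially. 1 \<le> (n::nat)" by (rule eventually_ge_at_top)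
  obtain c1 c1' where c1: "0 < c1" and hb:
    "\<forall>\<^sub>F n in sequentially. c1 * real n powr (- \<delta>1) \<le> h n \<and> h n \<le> c1' * real n powr (- \<delta>1)"
    using hp unfolding propto_def by blast
  have hN: "\<forall>\<^sub>F n in sequentially. c1 * real n powr (1 - \<delta>1) \<le> N n"
    using hb n1
  proof eventually_elim
    case (elim n)
    have "real n powr (1 - \<delta>1) = real n * real n powr (- \<delta>1)"
      using elim by (simp add: powr_diff powr_minus field_simps)
    then have "c1 * real n powr (1 - \<delta>1) = real n * (c1 * real n powr (- \<delta>1))" by simp
    also have "\<dots> \<le> real n * h n" using elim by (intro mult_left_mono) auto
    finally show ?case by (simp add: N_def)
  qed
  have "filterlim (\<lambda>n. c1 * real n powr (1 - \<delta>1)) at_top sequentially" using c1 \<delta>1 by real_asymp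
  then have Nlim: "filterlim N at_top sequentially" by (rule filterlim_at_top_mono[OF _ hN])
  have "\<forall>\<^sub>F n in sequentially. 0 \<le> (1 - \<delta>1) / 2 * ln (real n) + ln c1"
  proof -
    have "filterlim (\<lambda>n. (1 - \<delta>1) / 2 * ln (real n) + ln c1) at_top sequentially" using \<delta>1 by real_asymp
    then show ?thesis by (rule eventually_ge_of_at_top)
  qed
  then have lnN: "\<forall>\<^sub>F n in sequentially. ln (real n) \<le> 2 / (1 - \<delta>1) * ln (N n)"
    using hN n1
  proof eventually_elim
    case (elim n)
    have "ln (c1 * real n powr (1 - \<delta>1)) \<le> ln (N n)"
      using elim c1 h[of n] by (subst ln_le_cancel_iff) (auto simp: N_def)
    then have "ln c1 + (1 - \<delta>1) * ln (real n) \<le> ln (N n)" using elim c1 by (simp add: ln_mult ln_powr)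
    then have "(1 - \<delta>1) / 2 * ln (real n) \<le> ln (N n)" using elim(1) by (simp add: field_simps)
    then show ?case using \<delta>1 by (simp add: field_simps)
  qed
  obtain c2 where c2: "0 < c2" and dN: "\<forall>\<^sub>F n in sequentially. real (d n) \<le> c2 * exp (N n powr \<tau>2)"
  proof -
    obtain c c2 where c: "0 < c" "c \<le> c2"
      and ev: "\<forall>\<^sub>F n in sequentially. c * exp ((real n * h n) powr \<tau>2) \<le> real (d n) \<and> real (d n) \<le> c2 * exp ((real n * h n) powr \<tau>2)"
      using dp unfolding propto_def by blast
    show ?thesis
      by (rule that[of c2]) (use c ev in \<open>auto simp: N_def elim: eventually_mono\<close>)
  qed
  have "\<forall>\<^sub>F x in at_top. 2 / (1 - \<delta>1) * ln x + ln c2 + x powr t \<le> 2 * x powr t \<and> (1::real) \<le> x"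
  proof -
    have "filterlim (\<lambda>x::real. x powr t - (2 / (1 - \<delta>1) * ln x + ln c2)) at_top at_top" using t(1) by real_asymp
    then have "\<forall>\<^sub>F x in at_top. 0 \<le> x powr t - (2 / (1 - \<delta>1) * ln x + ln c2)" by (rule eventually_ge_of_at_top)
    then show ?thesis using eventually_ge_at_top[of 1] by eventually_elim simp
  qed
  then have "\<forall>\<^sub>F n in sequentially. 2 / (1 - \<delta>1) * ln (N n) + ln c2 + N n powr t \<le> 2 * N n powr t \<and> 1 \<le> N n"
    using Nlim by (rule eventually_compose_filterlim)
  then have LN: "\<forall>\<^sub>F n in sequentially. L n \<le> 2 * N n powr t \<and> 1 \<le> N n"
    using lnN dN
  proof eventually_elim
    case (elim n)
    have "ln (real (d n)) \<le> ln (c2 * exp (N n powr \<tau>2))"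
      using elim c2 d[of n] by (subst ln_le_cancel_iff) auto
    also have "\<dots> = ln c2 + N n powr \<tau>2" using c2 by (simp add: ln_mult)
    also have "N n powr \<tau>2 \<le> N n powr t" using elim t by (intro powr_mono) auto
    finally show ?case using elim by (simp add: L_def)
  qed
  have lamN: "\<forall>\<^sub>F n in sequentially. N n powr (- \<tau>3) \<le> (lam n)\<^sup>2"
    using ratio_at_top_of_smallo[OF small s powr_ge_zero lam zero_less_one] log_h_ge_1 LN
  proof eventually_elim
    case (elim n)
    have "(1 / N n) powr (\<tau>3 / 2) \<le> (ln (inverse (h n)) / (real n * h n)) powr (\<tau>3 / 2)"
      using elim \<tau> unfolding N_def[symmetric] by (intro powr_mono2 divide_right_mono) auto
    then have "(1 / N n) powr (\<tau>3 / 2) \<le> lam n" using elim by simp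
    then have "((1 / N n) powr (\<tau>3 / 2))\<^sup>2 \<le> (lam n)\<^sup>2" by (intro power_mono) auto
    moreover have "((1 / N n) powr (\<tau>3 / 2))\<^sup>2 = N n powr (- \<tau>3)"
    proof -
      have "((1 / N n) powr (\<tau>3 / 2))\<^sup>2 = ((1 / N n) powr (\<tau>3 / 2)) powr 2"
        using elim by (simp add: powr_numeral)
      also have "\<dots> = (1 / N n) powr \<tau>3" by (simp add: powr_powr)
      also have "\<dots> = N n powr (- \<tau>3)" by (simp only: powr_one_eq_one powr_divide powr_minus_divide)
      finally show ?thesis .
    qed
    ultimately show ?case by simp
  qed
  have "0 < 1 - \<tau>3 - t" using t(3) by linarith
  then have "filterlim (\<lambda>x::real. x powr (1 - \<tau>3 - t)) at_top at_top" by (rule powr_at_top)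
  then have base: "filterlim (\<lambda>n. N n powr (1 - \<tau>3 - t)) at_top sequentially"
    using Nlim by (rule filterlim_compose)
  show r1: "filterlim (\<lambda>n. real n * h n * (lam n)\<^sup>2 / L n) at_top sequentially"
  proof (rule filterlim_at_top_of_le_const_mult[OF base, of "1 / 2"])
    show "\<forall>\<^sub>F n in sequentially. 1 / 2 * N n powr (1 - \<tau>3 - t) \<le> real n * h n * (lam n)\<^sup>2 / L n"
      using LN lamN L0
    proof eventually_elim
      case (elim n)
      have p: "0 < N n" using elim by simp
      have "1 / 2 * N n powr (1 - \<tau>3 - t) = N n * N n powr (- \<tau>3) / (2 * N n powr t)"
        using p by (simp add: powr_diff powr_minus powr_add field_simps)
      also have "\<dots> \<le> N n * (lam n)\<^sup>2 / (2 * N n powr t)"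
        using elim p by (intro divide_right_mono mult_left_mono) auto
      also have "\<dots> \<le> N n * (lam n)\<^sup>2 / L n"
        using elim p by (intro divide_left_mono) auto
      finally show ?case by (simp add: N_def)
    qed
  qed auto
  \<comment> \<open>The rate without \<open>lam\<close> is the weaker one, since \<open>lam\<close>
    is eventually below 1.\<close>
  have "\<forall>\<^sub>F n in sequentially. lam n < 1" using lam0 by (intro order_tendstoD(2)[where y=0]) auto
  then have "\<forall>\<^sub>F n in sequentially. real n * h n * (lam n)\<^sup>2 / L n \<le> real n * h n / L n"
    using L0
  proof eventually_elim
    case (elim n)
    have "(lam n)\<^sup>2 \<le> 1" using elim lam[of n] by (intro power_le_one) auto
    then have "real n * h n * (lam n)\<^sup>2 \<le> real n * h n * 1" using h[of n] by (intro mult_left_mono) auto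
    then show ?case using elim by (intro divide_right_mono) auto
  qed
  then show "filterlim (\<lambda>n. real n * h n / L n) at_top sequentially"
    by (rule filterlim_at_top_mono[OF r1])
qed

end

section \<open>The estimation error\<close>

lemma sum_times_12: "(\<Sum>p\<in>{1, 2 :: nat} \<times> A. F p) = (\<Sum>j\<in>A. F (1, j)) + (\<Sum>j\<in>A. F (2, j))"
  for F :: "nat \<times> 'j \<Rightarrow> real"
proof -
  have "(\<Sum>p\<in>{1, 2 :: nat} \<times> A. F p) = (\<Sum>r\<in>{1, 2}. \<Sum>j\<in>A. F (r, j))"
    unfolding sum.cartesian_product by (simp add: case_prod_beta)
  then show ?thesis by simp
qed

text \<open>The function is known to vanish on [0,1] only, so at the end points it is the uniqueness
  of one-sided derivatives that decides.\<close>

lemma C2_zero_deriv: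
  assumes C2: "C2_unit_interval f f' f''" and zero: "\<And>u. u \<in> {0..1} \<Longrightarrow> f u = 0" and u: "u \<in> {0..1}"
  shows "f' u = 0"
proof -
  have "(f has_real_derivative f' u) (at u within {0..1})" using C2 u by (simp add: C2_unit_interval_def)
  then have 1: "((\<lambda>_. 0) has_real_derivative f' u) (at u within {0..1})"
    unfolding has_field_derivative_def by (rule has_derivative_transform[OF u, rotated]) (use zero in auto)
  have 2: "((\<lambda>_. 0) has_real_derivative 0) (at u within {0..1})" by simp
  show ?thesis
    using vector_derivative_unique_within_closed_interval[of 0 1 u "\<lambda>_. 0" "f' u" 0] u
      1[unfolded has_real_derivative_iff_has_vector_derivative] 2[unfolded has_real_derivative_iff_has_vector_derivative]
    by simp
qed

lemma sum_swap3: "(\<Sum>a\<in>A. \<Sum>b\<in>B. \<Sum>i\<in>I. F i a b) = (\<Sum>i\<in>I. \<Sum>a\<in>A. \<Sum>b\<in>B. F i a b)"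
  by (simp only: sum.swap[of _ I B]) (rule sum.swap)

text \<open>Block (r, c) carries the power r + c - 2 = (r - 1) + (c - 1), which splits into one
  factor for each index; for every observation the double sum is therefore a square.\<close>

lemma neg_hess_form_eq:
  "neg_hess_form K h n d U X Q u v =
    (\<Sum>i=1..n. kern K h (U i - u) / real n * (- Q i *
       (\<Sum>p\<in>{1, 2} \<times> {1..d}. v (fst p) (snd p) * (X i (snd p) * ((U i - u) / h) ^ (fst p - 1)))\<^sup>2))"
proof -
  define A where "A i r j = v r j * (X i j * ((U i - u) / h) ^ (r - 1))" for i r j
  define W where "W i = kern K h (U i - u) / real n * - Q i" for i
  have entry: "v r j * (- hess_entry K h n U X Q u (r + c - 2) j k) * v c k = (\<Sum>i=1..n. W i * (A i r j * A i c k))"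
    if "r \<in> {1, 2}" "c \<in> {1, 2}" for r c j k
  proof -
    have "((U i - u) / h) ^ (r + c - 2) = ((U i - u) / h) ^ (r - 1) * ((U i - u) / h) ^ (c - 1)" for i
      using that by (auto simp: power2_eq_square)
    then show ?thesis
      by (simp add: hess_entry_def A_def W_def sum_distrib_left sum_distrib_right sum_negf[symmetric] mult_ac)
  qed
  have "neg_hess_form K h n d U X Q u v = (\<Sum>r\<in>{1,2}. \<Sum>c\<in>{1,2}. \<Sum>j=1..d. \<Sum>k=1..d. \<Sum>i=1..n. W i * (A i r j * A i c k))"
    unfolding neg_hess_form_def by (intro sum.cong refl entry)
  also have "\<dots> = (\<Sum>r\<in>{1,2}. \<Sum>c\<in>{1,2}. \<Sum>i=1..n. \<Sum>j=1..d. \<Sum>k=1..d. W i * (A i r j * A i c k))"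
    by (intro sum.cong refl sum_swap3)
  also have "\<dots> = (\<Sum>i=1..n. \<Sum>r\<in>{1,2}. \<Sum>c\<in>{1,2}. \<Sum>j=1..d. \<Sum>k=1..d. W i * (A i r j * A i c k))"
    by (rule sum_swap3)
  also have "\<dots> = (\<Sum>i=1..n. W i * ((\<Sum>r\<in>{1,2}. \<Sum>j=1..d. A i r j) * (\<Sum>c\<in>{1,2}. \<Sum>k=1..d. A i c k)))"
  proof (intro sum.cong refl)
    fix i
    have "(\<Sum>r\<in>{1,2}. \<Sum>j=1..d. A i r j) * (\<Sum>c\<in>{1,2}. \<Sum>k=1..d. A i c k)
        = (\<Sum>r\<in>{1,2}. \<Sum>c\<in>{1,2}. \<Sum>j=1..d. \<Sum>k=1..d. A i r j * A i c k)"
      by (simp only: sum_product)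
    then show "(\<Sum>r\<in>{1,2}. \<Sum>c\<in>{1,2}. \<Sum>j=1..d. \<Sum>k=1..d. W i * (A i r j * A i c k))
        = W i * ((\<Sum>r\<in>{1,2}. \<Sum>j=1..d. A i r j) * (\<Sum>c\<in>{1,2}. \<Sum>k=1..d. A i c k))"
      by (simp only: sum_distrib_left)
  qed
  also have "\<dots> = (\<Sum>i=1..n. kern K h (U i - u) / real n * (- Q i *
       (\<Sum>p\<in>{1, 2} \<times> {1..d}. v (fst p) (snd p) * (X i (snd p) * ((U i - u) / h) ^ (fst p - 1)))\<^sup>2))"
  proof (intro sum.cong refl)
    fix i
    have "(\<Sum>p\<in>{1, 2} \<times> {1..d}. v (fst p) (snd p) * (X i (snd p) * ((U i - u) / h) ^ (fst p - 1)))
        = (\<Sum>r\<in>{1,2}. \<Sum>j=1..d. A i r j)"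
      unfolding sum.cartesian_product A_def by (simp add: case_prod_beta)
    then show "W i * ((\<Sum>r\<in>{1,2}. \<Sum>j=1..d. A i r j) * (\<Sum>c\<in>{1,2}. \<Sum>k=1..d. A i c k))
        = kern K h (U i - u) / real n * (- Q i *
       (\<Sum>p\<in>{1, 2} \<times> {1..d}. v (fst p) (snd p) * (X i (snd p) * ((U i - u) / h) ^ (fst p - 1)))\<^sup>2)"
      by (simp only: W_def power2_eq_square mult.assoc)
  qed
  finally show ?thesis .
qed

lemma L2_set_component_le:
  assumes "finite P" "inj_on i J" "i ` J \<subseteq> P"
  shows "L2_set (\<lambda>j. F (i j)) J \<le> L2_set F P"
proof -
  have "(\<Sum>j\<in>J. (F (i j))\<^sup>2) = (\<Sum>p\<in>i ` J. (F p)\<^sup>2)" by (rule sum.reindex_cong[OF assms(2), symmetric]) auto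
  also have "\<dots> \<le> (\<Sum>p\<in>P. (F p)\<^sup>2)" using assms by (intro sum_mono2) auto
  finally show ?thesis unfolding L2_set_def by simp
qed

section \<open>Reduction of the estimators to the abstract penalised problem\<close>

context svc_model
begin

definition curv_lipschitz :: "nat \<Rightarrow> nat \<Rightarrow> 'a \<Rightarrow> bool" where
  "curv_lipschitz n i \<omega> \<longleftrightarrow> 0 < Mf n (X n i \<omega>) (U n i \<omega>) (y n i \<omega>) \<and>
     (\<forall>\<delta>'. \<bar>q2 ell ginv (lin_pred (d n) (a n) (U n i \<omega>) (X n i \<omega>) + \<delta>') (y n i \<omega>)
        - q2 ell ginv (lin_pred (d n) (a n) (U n i \<omega>) (X n i \<omega>)) (y n i \<omega>)\<bar>
      \<le> Mf n (X n i \<omega>) (U n i \<omega>) (y n i \<omega>) * \<bar>\<delta>'\<bar>)"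

definition maximiser :: "(real \<Rightarrow> real) \<Rightarrow> real \<Rightarrow> real \<Rightarrow> nat \<Rightarrow> nat \<Rightarrow> 'a \<Rightarrow> (nat \<Rightarrow> real) \<times> (nat \<Rightarrow> real) \<Rightarrow> bool" where
  "maximiser K l1 l2 n k \<omega> = is_arg_max
     (\<lambda>(\<alpha>, \<beta>). penalised_loglik ell ginv K (h n) l1 l2 n (d n)
        (\<lambda>i. U n i \<omega>) (\<lambda>i. X n i \<omega>) (\<lambda>i. y n i \<omega>) k \<alpha> \<beta>) (\<lambda>_. True)"

text \<open>The lower half of the restricted eigenvalue event, stated pointwise in place of an
  infimum.\<close>

definition hess_ge :: "(real \<Rightarrow> real) \<Rightarrow> real \<Rightarrow> real \<Rightarrow> nat \<Rightarrow> nat \<Rightarrow> 'a \<Rightarrow> bool" where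
  "hess_ge K \<rho> b s n \<omega> \<longleftrightarrow> (\<forall>u\<in>{0..1}. \<forall>v\<in>Omega0 (d n) s b.
     \<rho> \<le> neg_hess_form K (h n) n (d n) (\<lambda>i. U n i \<omega>) (\<lambda>i. X n i \<omega>) (\<lambda>i. Q2 n i \<omega>) u v)"

text \<open>The abstract estimate at one centre. The support has 2 s elements because each
  coefficient contributes a level and a slope; \<kappa> = 2 (1 + b) is the factor in
  \<open>Omega0\<close>; D bounds the second-order Taylor error of the coefficients over the range B
  h of the kernel.\<close>

lemma estimator_error:
  fixes C g Ca B b l1 l2 \<rho> R :: real and s k n :: nat
  defines "D \<equiv> Ca * (B * h n)\<^sup>2" and "\<kappa> \<equiv> 2 * (1 + b)"
  assumes \<omega>: "\<omega> \<in> space (M n)" and k: "k \<in> {1..n}" and s: "s \<le> d n"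
    and K: "\<And>t. 0 \<le> K t" "\<And>t. B < \<bar>t\<bar> \<Longrightarrow> K t = 0" and B: "1 \<le> B"
    and good: "good K n C g \<omega>" and C: "0 \<le> C" and g: "0 \<le> g"
    and Mf: "\<And>i. i \<in> {1..n} \<Longrightarrow> curv_lipschitz n i \<omega>"
    and q2_neg: "\<And>s t. t \<in> \<Y> \<Longrightarrow> q2 ell ginv s t < 0"
    and a_C2: "\<And>j. j \<in> {1..d n} \<Longrightarrow> C2_unit_interval (a n j) (a' j) (a'' j)"
    and Ca: "\<And>j u. j \<in> {1..d n} \<Longrightarrow> u \<in> {0..1} \<Longrightarrow> \<bar>a'' j u\<bar> \<le> Ca" "0 \<le> Ca"
    and a_zero: "\<And>j u. j \<in> {s + 1..d n} \<Longrightarrow> u \<in> {0..1} \<Longrightarrow> a n j u = 0"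
    and l: "0 < l1" "0 < l2" and b: "max (l1 / l2) (l2 / l1) \<le> b" and \<rho>: "0 < \<rho>" and R: "0 < R"
    and max: "maximiser K l1 l2 n k \<omega> (\<alpha>h, \<beta>h)"
    and restr: "hess_ge K \<rho> b s n \<omega>"
    and grad_small: "g + B * C * D * (2 * real s) + B * C * D\<^sup>2 * (2 * real s)\<^sup>2 \<le> min l1 l2 / 2"
    and small: "C * B\<^sup>2 * (\<kappa>\<^sup>2 * (2 * real s)) * (D * (2 * real s) + B * (\<kappa> * sqrt (2 * real s) * R)) \<le> \<rho> / 2"
    and large: "6 * max l1 l2 * \<kappa> * sqrt (2 * real s) < \<rho> * R"
  shows "L2_set (\<lambda>j. \<alpha>h j - a n j (U n k \<omega>)) {1..d n} \<le> R \<and>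
    L2_set (\<lambda>j. h n * (\<beta>h j - a' j (U n k \<omega>))) {1..d n} \<le> R"
proof -
  define H where "H = h n"
  have H: "0 < H" using h_pos by (simp add: H_def)
  have n: "0 < n" using k by auto
  define u where "u = U n k \<omega>"
  have u: "u \<in> {0..1}" unfolding u_def by (rule U_range[OF k \<omega>])
  define t where "t i = (U n i \<omega> - u) / H" for i
  define P where "P = {1, 2 :: nat} \<times> {1..d n}"
  define S where "S = {1, 2 :: nat} \<times> {1..s}"
  define w where "w i = kern K H (U n i \<omega> - u) / n" for i
  define f where "f i x = ell (ginv x) (y n i \<omega>)" for i x
  define f1 where "f1 i x = q1 ell ginv x (y n i \<omega>)" for i x
  define f2 where "f2 i x = q2 ell ginv x (y n i \<omega>)" for i x
  define r where "r i = lin_pred (d n) (a n) (U n i \<omega>) (X n i \<omega>)" for i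
  define Mv where "Mv i = Mf n (X n i \<omega>) (U n i \<omega>) (y n i \<omega>)" for i
  define z where "z i p = X n i \<omega> (snd p) * t i ^ (fst p - 1)" for i and p :: "nat \<times> nat"
  define c where "c i p = \<bar>X n i \<omega> (snd p)\<bar>" for i and p :: "nat \<times> nat"
  \<comment> \<open>Slopes are multiplied by the bandwidth: the factors t^0 and t^1 of the
    regressors are then bounded on the support of the kernel, and the penalty on h |\<beta>| becomes
    an ordinary weighted l1 norm.\<close>
  define mk where "mk \<alpha> \<beta> p = (if fst p = 1 then \<alpha> (snd p) else H * \<beta> (snd p))"
    for \<alpha> \<beta> :: "nat \<Rightarrow> real" and p :: "nat \<times> nat"
  define \<theta> where "\<theta> = mk (\<lambda>j. a n j u) (\<lambda>j. a' j u)"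
  define lam where "lam p = (if fst p = 1 then l1 else l2)" for p :: "nat \<times> nat"
  have wK: "w i = K (t i) / (n * H)" for i
    by (simp add: w_def kern_def t_def field_simps)
  have w0: "0 \<le> w i" for i using K(1)[of "t i"] H by (simp add: wK)
  have tB: "\<bar>t i\<bar> \<le> B" if "w i \<noteq> 0" for i
  proof (rule ccontr)
    assume "\<not> \<bar>t i\<bar> \<le> B"
    then have "K (t i) = 0" by (intro K(2)) simp
    with that show False by (simp add: wK)
  qed
  have yY: "y n i \<omega> \<in> \<Y>" if "i \<in> {1..n}" for i by (rule y_range[OF that \<omega>])
  have lp_mk: "(\<Sum>p\<in>P. mk \<alpha> \<beta> p * z i p) = (\<Sum>j=1..d n. (\<alpha> j + \<beta> j * (U n i \<omega> - u)) * X n i \<omega> j)" for \<alpha> \<beta> i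
    unfolding P_def sum_times_12 sum.distrib[symmetric]
    using H by (intro sum.cong refl) (simp add: mk_def z_def t_def field_simps)
  have cardS: "real (card S) = 2 * real s" by (simp add: S_def card_cartesian_product)
  have sum_w: "(\<Sum>i=1..n. w i * F i) \<le> Q" if "(\<Sum>i=1..n. F i * K (t i)) \<le> real n * H * Q" for F Q
  proof -
    have "(\<Sum>i=1..n. w i * F i) = (\<Sum>i=1..n. F i * K (t i)) / (real n * H)"
      by (simp add: wK sum_divide_distrib mult_ac)
    also have "\<dots> \<le> Q" using that n H by (simp add: field_simps)
    finally show ?thesis .
  qed
  have bnd: "max l1 l2 / min l1 l2 \<le> b" using b l by (auto simp: max_def min_def split: if_splits)
  note good' = good[unfolded good_def, rule_format, OF k, folded u_def H_def, folded t_def]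
  interpret local_lasso "{1..n}" P S w r Mv f f1 f2 z c \<theta> lam "min l1 l2" "max l1 l2" B D g C C \<kappa> \<rho>
  proof
    show "finite P" "S \<subseteq> P" using s by (auto simp: P_def S_def)
    show "(f i has_real_derivative f1 i x) (at x)" if "i \<in> {1..n}" for i x
      using lik_diff1[OF yY[OF that]] unfolding f_def f1_def q1_def
      by (simp add: DERIV_deriv_iff_real_differentiable)
    show "(f1 i has_real_derivative f2 i x) (at x)" if "i \<in> {1..n}" for i x
      using lik_diff2[OF yY[OF that]] unfolding f1_def f2_def q2_def
      by (simp add: DERIV_deriv_iff_real_differentiable)
    show "f2 i x \<le> 0" if "i \<in> {1..n}" for i x
      using q2_neg[OF yY[OF that], of x] by (simp add: f2_def)
    show "\<bar>f2 i (r i + e) - f2 i (r i)\<bar> \<le> Mv i * \<bar>e\<bar>" "0 \<le> Mv i" if "i \<in> {1..n}" for i e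
      using Mf[OF that] by (simp_all add: curv_lipschitz_def f2_def r_def Mv_def)
    show "\<bar>z i p\<bar> \<le> B * c i p" if "i \<in> {1..n}" "p \<in> P" "w i \<noteq> 0" for i p
    proof -
      have "\<bar>t i\<bar> ^ (fst p - 1) \<le> B" using that(2) tB[OF that(3)] B by (auto simp: P_def)
      then have "\<bar>X n i \<omega> (snd p)\<bar> * \<bar>t i\<bar> ^ (fst p - 1) \<le> \<bar>X n i \<omega> (snd p)\<bar> * B"
        by (intro mult_left_mono) auto
      then show ?thesis by (simp add: z_def c_def abs_mult power_abs mult.commute)
    qed
    show "\<bar>(\<Sum>p\<in>P. \<theta> p * z i p) - r i\<bar> \<le> D * (\<Sum>p\<in>S. c i p)" if i: "i \<in> {1..n}" and wi: "w i \<noteq> 0" for i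
    proof -
      have ui: "U n i \<omega> \<in> {0..1}" by (rule U_range[OF i \<omega>])
      define e where "e j = a n j u + a' j u * (U n i \<omega> - u) - a n j (U n i \<omega>)" for j
      have dist: "\<bar>U n i \<omega> - u\<bar> \<le> B * H" using tB[OF wi] H by (simp add: t_def field_simps)
      have eD: "\<bar>e j\<bar> \<le> D" if "j \<in> {1..d n}" for j
      proof -
        have "\<bar>e j\<bar> \<le> Ca * (U n i \<omega> - u)\<^sup>2"
          using C2_second_order_bound[OF a_C2[OF that] Ca(1)[OF that] u ui] by (simp add: e_def abs_minus_commute algebra_simps)
        also have "\<dots> \<le> Ca * (B * H)\<^sup>2"
          using dist Ca(2) power_mono[OF dist, of 2] by (intro mult_left_mono) auto
        finally show ?thesis by (simp add: D_def H_def)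
      qed
      \<comment> \<open>Coefficients beyond \<open>s\<close> vanish on [0,1], hence so do their
        derivatives: the approximation error is carried by the support alone.\<close>
      have e0: "e j = 0" if "j \<in> {s + 1..d n}" for j
      proof -
        have j: "j \<in> {1..d n}" using that by auto
        have "a' j u = 0" by (rule C2_zero_deriv[OF a_C2[OF j] a_zero[OF that] u])
        then show ?thesis using a_zero[OF that] u ui by (simp add: e_def)
      qed
      have "(\<Sum>p\<in>P. \<theta> p * z i p) - r i = (\<Sum>j=1..d n. e j * X n i \<omega> j)"
        unfolding \<theta>_def lp_mk r_def lin_pred_def e_def sum_subtractf[symmetric]
        by (intro sum.cong refl) (simp add: algebra_simps)
      also have "\<dots> = (\<Sum>j=1..s. e j * X n i \<omega> j)"
        using s e0 by (intro sum.mono_neutral_right) auto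
      finally have "\<bar>(\<Sum>p\<in>P. \<theta> p * z i p) - r i\<bar> \<le> (\<Sum>j=1..s. \<bar>e j * X n i \<omega> j\<bar>)" by simp
      also have "\<dots> \<le> (\<Sum>j=1..s. D * c i (1, j))"
        using eD s by (intro sum_mono) (auto simp: c_def abs_mult intro!: mult_right_mono)
      \<comment> \<open>The slope coordinates are added for free, to match the sum over all of
        \<open>S\<close> in the abstract bias bound.\<close>
      also have "\<dots> \<le> (\<Sum>j=1..s. D * c i (1, j)) + (\<Sum>j=1..s. D * c i (2, j))"
        using Ca(2) by (simp add: sum_nonneg D_def c_def)
      also have "\<dots> = D * (\<Sum>p\<in>S. c i p)" unfolding S_def sum_times_12 by (simp add: sum_distrib_left distrib_left)
      finally show ?thesis .
    qed
    show "\<theta> p = 0" if "p \<in> P - S" for p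
    proof -
      have j: "snd p \<in> {1..d n}" "snd p \<in> {s + 1..d n}" using that by (auto simp: P_def S_def)
      show ?thesis
        using C2_zero_deriv[OF a_C2[OF j(1)] a_zero[OF j(2)] u] a_zero[OF j(2) u] by (simp add: \<theta>_def mk_def)
    qed
    show "\<bar>\<Sum>i=1..n. w i * (f1 i (r i) * z i p)\<bar> \<le> g" if p: "p \<in> P" for p
    proof -
      have l01: "fst p - 1 \<in> {0, 1}" and j: "snd p \<in> {1..d n}" using p by (auto simp: P_def)
      have "\<bar>\<Sum>i=1..n. Q1 n i \<omega> * X n i \<omega> (snd p) * (t i ^ (fst p - 1) * K (t i))\<bar> \<le> real n * H * g"
        using good' j l01 by blast
      moreover have "(\<Sum>i=1..n. w i * (f1 i (r i) * z i p))
          = (\<Sum>i=1..n. Q1 n i \<omega> * X n i \<omega> (snd p) * (t i ^ (fst p - 1) * K (t i))) / (real n * H)"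
        by (simp add: wK sum_divide_distrib f1_def r_def z_def Q1 mult_ac)
      moreover have "0 < real n * H" using n H by simp
      ultimately show ?thesis by (simp only: abs_divide abs_of_pos pos_divide_le_eq mult.commute[of g])
    qed
    show "(\<Sum>i=1..n. w i * (\<bar>f2 i (r i)\<bar> * c i p * c i q)) \<le> C" if "p \<in> P" "q \<in> P" for p q
    proof (rule sum_w)
      have "(\<Sum>i=1..n. \<bar>Q2 n i \<omega> * X n i \<omega> (snd p) * X n i \<omega> (snd q)\<bar> * K (t i)) \<le> real n * H * C"
        using good' that by (auto simp: P_def)
      then show "(\<Sum>i=1..n. \<bar>f2 i (r i)\<bar> * c i p * c i q * K (t i)) \<le> real n * H * C"
        by (simp add: f2_def r_def c_def Q2 abs_mult)
    qed
    show "(\<Sum>i=1..n. w i * (Mv i * c i p * c i q * c i v)) \<le> C" if "p \<in> P" "q \<in> P" "v \<in> P" for p q v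
    proof (rule sum_w)
      have "(\<Sum>i=1..n. \<bar>X n i \<omega> (snd p) * X n i \<omega> (snd q) * X n i \<omega> (snd v) * Mf n (X n i \<omega>) (U n i \<omega>) (y n i \<omega>)\<bar> * K (t i))
          \<le> real n * H * C"
        using good' that by (auto simp: P_def)
      moreover have "\<bar>X n i \<omega> (snd p) * X n i \<omega> (snd q) * X n i \<omega> (snd v) * Mf n (X n i \<omega>) (U n i \<omega>) (y n i \<omega>)\<bar>
          = Mv i * c i p * c i q * c i v" if "i \<in> {1..n}" for i
        using Mf[OF that] by (simp add: curv_lipschitz_def Mv_def c_def abs_mult)
      ultimately show "(\<Sum>i=1..n. Mv i * c i p * c i q * c i v * K (t i)) \<le> real n * H * C" by simp
    qed
    show "2 * max l1 l2 / min l1 l2 + 2 \<le> \<kappa>" using bnd by (simp add: \<kappa>_def)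
    show "\<rho> \<le> (\<Sum>i=1..n. w i * (- f2 i (r i) * (\<Sum>p\<in>P. v p * z i p)\<^sup>2))"
      if v: "L2_set v P = 1" "(\<Sum>p\<in>P. \<bar>v p\<bar>) \<le> \<kappa> * (\<Sum>p\<in>S. \<bar>v p\<bar>)" for v
    proof -
      have "(\<lambda>r j. v (r, j)) \<in> Omega0 (d n) s b"
        using v unfolding Omega0_def P_def S_def \<kappa>_def sum_times_12 by (simp add: sum.distrib case_prod_beta)
      with restr u have "\<rho> \<le> neg_hess_form K (h n) n (d n) (\<lambda>i. U n i \<omega>) (\<lambda>i. X n i \<omega>) (\<lambda>i. Q2 n i \<omega>) u (\<lambda>r j. v (r, j))"
        unfolding hess_ge_def by blast
      then show ?thesis
        unfolding neg_hess_form_eq by (simp add: w_def f2_def r_def z_def t_def P_def Q2 u_def H_def)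
    qed
    show "g + B * C * D * real (card S) + B * C * D\<^sup>2 * (real (card S))\<^sup>2 \<le> min l1 l2 / 2"
      unfolding cardS by (rule grad_small)
  qed (use w0 l B Ca(2) C g \<rho> in \<open>auto simp: c_def lam_def D_def\<close>)
  have obj: "lik (mk \<alpha> \<beta>) - pen (mk \<alpha> \<beta>) = penalised_loglik ell ginv K (h n) l1 l2 n (d n)
         (\<lambda>i. U n i \<omega>) (\<lambda>i. X n i \<omega>) (\<lambda>i. y n i \<omega>) k \<alpha> \<beta>" for \<alpha> \<beta>
  proof -
    have "lik (mk \<alpha> \<beta>) = local_loglik ell ginv K (h n) n (d n) (\<lambda>i. U n i \<omega>) (\<lambda>i. X n i \<omega>) (\<lambda>i. y n i \<omega>) k \<alpha> \<beta>"
      unfolding lik_def lp_mk local_loglik_def f_def w_def u_def H_def by (simp add: sum_divide_distrib mult_ac)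
    moreover have "pen (mk \<alpha> \<beta>) = l1 * (\<Sum>j=1..d n. \<bar>\<alpha> j\<bar>) + l2 * (\<Sum>j=1..d n. h n * \<bar>\<beta> j\<bar>)"
    proof -
      have "pen (mk \<alpha> \<beta>) = (\<Sum>p\<in>P. lam p * \<bar>mk \<alpha> \<beta> p\<bar>)" by (rule pen_def)
      then show ?thesis
        unfolding P_def sum_times_12 using H by (simp add: lam_def mk_def abs_mult sum_distrib_left H_def)
    qed
    ultimately show ?thesis by (simp add: penalised_loglik_def)
  qed
  have "lik \<theta> - pen \<theta> \<le> lik (mk \<alpha>h \<beta>h) - pen (mk \<alpha>h \<beta>h)"
    using max unfolding \<theta>_def obj maximiser_def is_arg_max_def by (auto simp: not_less)
  from maximiser_error_le[OF R this, unfolded cardS, OF small large]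
  have E: "L2_set (\<lambda>p. mk \<alpha>h \<beta>h p - \<theta> p) P \<le> R" .
  have 1: "L2_set (\<lambda>j. mk \<alpha>h \<beta>h (1, j) - \<theta> (1, j)) {1..d n} \<le> L2_set (\<lambda>p. mk \<alpha>h \<beta>h p - \<theta> p) P"
    by (rule L2_set_component_le[where i="Pair 1"]) (auto simp: P_def inj_on_def)
  have 2: "L2_set (\<lambda>j. mk \<alpha>h \<beta>h (2, j) - \<theta> (2, j)) {1..d n} \<le> L2_set (\<lambda>p. mk \<alpha>h \<beta>h p - \<theta> p) P"
    by (rule L2_set_component_le[where i="Pair 2"]) (auto simp: P_def inj_on_def)
  show ?thesis
    using order_trans[OF 1 E] order_trans[OF 2 E]
    by (simp add: mk_def \<theta>_def u_def H_def right_diff_distrib)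
qed

end

text \<open>A set whose \<open>measure\<close> is positive is automatically measurable, because the
  value is 0 on non-measurable sets. Thus the eigenvalue hypothesis can be used although it does not
  assert measurability of its event.\<close>

lemma (in prob_space) holds_off_of_measure_ge:
  assumes "1 - \<epsilon> \<le> measure M {\<omega> \<in> space M. P \<omega>}" "\<epsilon> < 1"
  shows "holds_off M \<epsilon> P"
proof -
  have sets: "{\<omega> \<in> space M. P \<omega>} \<in> sets M"
  proof (rule ccontr)
    assume "{\<omega> \<in> space M. P \<omega>} \<notin> sets M"
    then show False using assms by (simp add: measure_notin_sets)
  qed
  show ?thesis unfolding holds_off_def
    by (rule bexI[of _ "space M - {\<omega> \<in> space M. P \<omega>}"]) (use assms sets in \<open>auto simp: prob_compl\<close>)
qed

lemma smallo_sumD: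
  fixes f g lam :: "nat \<Rightarrow> real"
  assumes "(\<lambda>n. f n + g n) \<in> o(lam)" "\<And>n. 0 \<le> f n" "\<And>n. 0 \<le> g n" "\<And>n. 0 < lam n" "0 < c"
  shows "\<forall>\<^sub>F n in sequentially. f n \<le> c * lam n" "\<forall>\<^sub>F n in sequentially. g n \<le> c * lam n"
proof -
  have "\<forall>\<^sub>F n in sequentially. norm (f n + g n) \<le> c * norm (lam n)" by (rule landau_o.smallD[OF assms(1,5)])
  then show "\<forall>\<^sub>F n in sequentially. f n \<le> c * lam n" "\<forall>\<^sub>F n in sequentially. g n \<le> c * lam n"
    by (eventually_elim, use assms(2-4) in \<open>smt (verit) real_norm_def\<close>)+
qed

lemma Max_nonneg_le:
  fixes F :: "nat \<Rightarrow> real"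
  assumes "1 \<le> n" "\<And>k. k \<in> {1..n} \<Longrightarrow> 0 \<le> F k" "\<And>k. k \<in> {1..n} \<Longrightarrow> F k \<le> R"
  shows "0 \<le> (MAX k\<in>{1..n}. F k)" "(MAX k\<in>{1..n}. F k) \<le> R"
proof -
  have ne: "{1..n} \<noteq> {}" using assms(1) by auto
  have "F 1 \<le> (MAX k\<in>{1..n}. F k)" using assms(1) by (intro Max_ge) auto
  moreover have "0 \<le> F 1" using assms(1) by (intro assms(2)) auto
  ultimately show "0 \<le> (MAX k\<in>{1..n}. F k)" by (rule order_trans[rotated])
  show "(MAX k\<in>{1..n}. F k) \<le> R" using ne assms(3) by (subst Max_le_iff) auto
qed

section \<open>From the deterministic estimate to the rate in probability\<close>

context svc_model
begin

text \<open>Constants are fixed first; the deterministic inequalities then hold for all large n,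
  because s h^2 = o(lam1) makes the bias negligible and s^2 lam1 = o(1) the cubic remainder.\<close>

lemma error_rate_of_good:
  fixes s2 :: "nat \<Rightarrow> nat" and a' a'' :: "nat \<Rightarrow> nat \<Rightarrow> real \<Rightarrow> real" and lam1 lam2 e :: "nat \<Rightarrow> real"
    and \<delta> \<rho>1 \<rho>2 B :: real and atil btil :: "nat \<Rightarrow> nat \<Rightarrow> 'a \<Rightarrow> nat \<Rightarrow> real" and err :: "nat \<Rightarrow> 'a \<Rightarrow> real"
  assumes K: "\<And>t. 0 \<le> K t" "\<And>t. B < \<bar>t\<bar> \<Longrightarrow> K t = 0" and B: "1 \<le> B"
    and good: "\<exists>C\<ge>0. \<forall>\<epsilon>>0. \<forall>\<eta>>0. \<forall>\<^sub>F n in sequentially. holds_off (M n) \<epsilon> (good K n C (\<eta> * lam1 n))"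
    and s2: "\<And>n. 1 \<le> s2 n" "\<And>n. s2 n \<le> d n"
    and a_zero: "\<And>n j u. j \<in> {s2 n + 1..d n} \<Longrightarrow> u \<in> {0..1} \<Longrightarrow> a n j u = 0"
    and tuning: "\<And>n. 0 < lam1 n" "\<And>n. 0 < lam2 n"
    and est_max: "\<And>n k. k \<in> {1..n} \<Longrightarrow>
      AE \<omega> in M n. maximiser K (lam1 n) (lam2 n) n k \<omega> (atil n k \<omega>, btil n k \<omega>)"
    and err: "err = (\<lambda>n \<omega>.
                (MAX k\<in>{1..n}. L2_set (\<lambda>j. atil n k \<omega> j - a n j (U n k \<omega>)) {1..d n}) +
                (MAX k\<in>{1..n}. L2_set (\<lambda>j. h n * (btil n k \<omega> j - a' n j (U n k \<omega>))) {1..d n}))"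
    and q2_neg: "\<And>s t. t \<in> \<Y> \<Longrightarrow> q2 ell ginv s t < 0"
    and Mf_lip: "\<And>n i. i \<in> {1..n} \<Longrightarrow> AE \<omega> in M n. curv_lipschitz n i \<omega>"
    and rho: "0 < \<rho>1" and delta: "0 < \<delta>"
    and restr_eigen: "(\<lambda>n. let b = max (lam1 n / lam2 n) (lam2 n / lam1 n) + \<delta>;
                              quad = (\<lambda>\<omega> u v. ereal (neg_hess_form K (h n) n (d n)
                                (\<lambda>i. U n i \<omega>) (\<lambda>i. X n i \<omega>) (\<lambda>i. Q2 n i \<omega>) u v))
                          in measure (M n) {\<omega> \<in> space (M n).
                               ereal \<rho>1 \<le> (INF u\<in>{0..1}. INF v\<in>Omega0 (d n) (s2 n) b. quad \<omega> u v) \<and>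
                               (SUP u\<in>{0..1}. SUP v\<in>Omega0 (d n) (s2 n) b. quad \<omega> u v) \<le> ereal \<rho>2})
                      \<longlonglongrightarrow> 1"
    and a_C2: "\<And>n j. j \<in> {1..d n} \<Longrightarrow> C2_unit_interval (a n j) (a' n j) (a'' n j)"
    and a''_bdd: "\<exists>C. \<forall>n. \<forall>j\<in>{1..d n}. \<forall>u\<in>{0..1}. \<bar>a'' n j u\<bar> \<le> C"
    and e: "\<And>n. 0 \<le> e n" and small: "(\<lambda>n. real (s2 n) * (h n)\<^sup>2 + e n) \<in> o(lam1)"
    and lam12: "propto lam1 lam2"
    and s_small: "(\<lambda>n. real (s2 n) * (lam1 n)\<^sup>2 / (h n)\<^sup>2 + (real (s2 n))\<^sup>2 * lam1 n) \<in> o(\<lambda>_. 1)"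
  shows "bigO_P M err (\<lambda>n. sqrt (real (s2 n)) * lam1 n)"
proof -
  obtain C where C: "0 \<le> C" and good': "\<And>\<epsilon> \<eta>. 0 < \<epsilon> \<Longrightarrow> 0 < \<eta> \<Longrightarrow>
      \<forall>\<^sub>F n in sequentially. holds_off (M n) \<epsilon> (good K n C (\<eta> * lam1 n))"
    using good by blast
  obtain Ca0 where Ca0: "\<And>n j u. j \<in> {1..d n} \<Longrightarrow> u \<in> {0..1} \<Longrightarrow> \<bar>a'' n j u\<bar> \<le> Ca0" using a''_bdd by blast
  define Ca where "Ca = max 0 Ca0"
  have Ca: "0 \<le> Ca" "\<And>n j u. j \<in> {1..d n} \<Longrightarrow> u \<in> {0..1} \<Longrightarrow> \<bar>a'' n j u\<bar> \<le> Ca"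
    using Ca0 by (auto simp: Ca_def intro: order_trans[OF Ca0])
  obtain c1 c2 where c: "0 < c1" "c1 \<le> c2"
    and lr: "\<forall>\<^sub>F n in sequentially. c1 * lam2 n \<le> lam1 n \<and> lam1 n \<le> c2 * lam2 n"
    using lam12 unfolding propto_def by blast
  have c2: "0 < c2" using c by simp
  define b where "b n = max (lam1 n / lam2 n) (lam2 n / lam1 n) + \<delta>" for n
  \<comment> \<open>A bound for the cone constant that does not depend on n, available because the
    ratio of the tuning parameters is bounded from both sides.\<close>
  define b0 where "b0 = max c2 (1 / c1) + \<delta>"
  \<comment> \<open>\<open>cm\<close> and \<open>cM\<close> compare the smaller and the larger
    tuning parameter with \<open>lam1\<close>.\<close>
  define cm where "cm = min 1 (1 / c2)"
  define cM where "cM = max 1 (1 / c1)"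
  define \<kappa> where "\<kappa> = 2 * (1 + b0)"
  have cm: "0 < cm" "0 < cM" using c c2 by (auto simp: cm_def cM_def)
  have b0: "0 < b0" using c2 delta by (simp add: b0_def less_max_iff_disj add_pos_pos)
  have \<kappa>: "0 < \<kappa>" using b0 by (simp add: \<kappa>_def)
  \<comment> \<open>The radius has to exceed 6 max (l1, l2) \<kappa> sqrt (2 s) / \<rho>1; the
    summand 1 makes this strict.\<close>
  define Cr where "Cr = 6 * cM * \<kappa> * sqrt 2 / \<rho>1 + 1"
  have Cr: "0 < Cr" using cm \<kappa> rho by (simp add: Cr_def add_pos_pos)
  \<comment> \<open>The allowed size of D s relative to \<open>lam1\<close>. The two bias terms of
    the gradient together cost at most 6 B C D s, for which cm / 4 is reserved; the score gets
    another cm / 4.\<close>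
  define \<zeta> where "\<zeta> = min 1 (cm / (4 * (6 * B * C + 1)))"
  have BC: "0 \<le> B * C" using B C by simp
  have \<zeta>: "0 < \<zeta>" "\<zeta> \<le> 1" "6 * B * C * \<zeta> \<le> cm / 4"
  proof -
    show "0 < \<zeta>" "\<zeta> \<le> 1" using cm BC by (auto simp: \<zeta>_def)
    have "(6 * B * C + 1) * \<zeta> \<le> (6 * B * C + 1) * (cm / (4 * (6 * B * C + 1)))"
      using BC by (intro mult_left_mono) (auto simp: \<zeta>_def)
    also have "\<dots> = cm / 4" using BC by (simp add: field_simps)
    finally show "6 * B * C * \<zeta> \<le> cm / 4" using \<open>0 < \<zeta>\<close> by (simp add: algebra_simps)
  qed
  define D where "D n = Ca * (B * h n)\<^sup>2" for n
  define R where "R n = Cr * (sqrt (real (s2 n)) * lam1 n)" for n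
  have D: "0 \<le> D n" for n using Ca by (simp add: D_def)
  have R: "0 < R n" for n using Cr tuning[of n] s2(1)[of n] by (simp add: R_def)
  have ss: "\<forall>\<^sub>F n in sequentially. (real (s2 n))\<^sup>2 * lam1 n \<le> x" if "0 < x" for x :: real
    using smallo_sumD(2)[OF s_small _ _ _ that] tuning by (simp add: less_imp_le)
  have Ds: "\<forall>\<^sub>F n in sequentially. D n * real (s2 n) \<le> \<zeta> * lam1 n"
  proof -
    have pos: "0 < \<zeta> / (Ca * B\<^sup>2 + 1)" using \<zeta> Ca by (simp add: add_nonneg_pos)
    have "\<forall>\<^sub>F n in sequentially. real (s2 n) * (h n)\<^sup>2 \<le> \<zeta> / (Ca * B\<^sup>2 + 1) * lam1 n"
      by (rule smallo_sumD(1)[OF small _ e tuning(1) pos]) simp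
    then show ?thesis
    proof eventually_elim
      case (elim n)
      have "D n * real (s2 n) = Ca * B\<^sup>2 * (real (s2 n) * (h n)\<^sup>2)" by (simp add: D_def power_mult_distrib mult_ac)
      also have "\<dots> \<le> (Ca * B\<^sup>2 + 1) * (real (s2 n) * (h n)\<^sup>2)" by (intro mult_right_mono) auto
      also have "\<dots> \<le> (Ca * B\<^sup>2 + 1) * (\<zeta> / (Ca * B\<^sup>2 + 1) * lam1 n)" using elim Ca by (intro mult_left_mono) auto
      also have "\<dots> = \<zeta> * lam1 n"
      proof -
        have "Ca * B\<^sup>2 + 1 \<noteq> 0" using mult_nonneg_nonneg[OF Ca(1) zero_le_power2[of B]] by linarith
        then show ?thesis by simp
      qed
      finally show ?case .
    qed
  qed
  \<comment> \<open>Collects the constants of the cubic remainder, whose size will turn out to be A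
    s^2 lam1.\<close>
  define A where "A = C * B\<^sup>2 * (\<kappa>\<^sup>2 * 2) * (2 + B * \<kappa> * sqrt 2 * Cr)"
  have A: "0 \<le> A" using C B \<kappa> Cr by (simp add: A_def)
  show ?thesis unfolding bigO_P_def
  proof (intro allI impI exI conjI)
    \<comment> \<open>Level and slope errors contribute \<open>Cr\<close> each.\<close>
    show "0 < 2 * Cr" using Cr by simp
    fix \<epsilon> :: real assume \<epsilon>: "0 < \<epsilon>"
    \<comment> \<open>One half of \<epsilon> for the kernel sums and one for the eigenvalue event;
      staying below 1 is what forces the latter to be measurable.\<close>
    define \<epsilon>' where "\<epsilon>' = min \<epsilon> 1 / 2"
    have \<epsilon>': "0 < \<epsilon>'" "\<epsilon>' < 1" "\<epsilon>' + \<epsilon>' \<le> \<epsilon>" using \<epsilon> by (auto simp: \<epsilon>'_def min_def)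
    have re: "\<forall>\<^sub>F n in sequentially. holds_off (M n) \<epsilon>' (hess_ge K \<rho>1 (b n) (s2 n) n)"
    proof -
      have "\<forall>\<^sub>F n in sequentially. 1 - \<epsilon>' < measure (M n) {\<omega> \<in> space (M n).
          ereal \<rho>1 \<le> (INF u\<in>{0..1}. INF v\<in>Omega0 (d n) (s2 n) (b n).
            ereal (neg_hess_form K (h n) n (d n) (\<lambda>i. U n i \<omega>) (\<lambda>i. X n i \<omega>) (\<lambda>i. Q2 n i \<omega>) u v)) \<and>
          (SUP u\<in>{0..1}. SUP v\<in>Omega0 (d n) (s2 n) (b n).
            ereal (neg_hess_form K (h n) n (d n) (\<lambda>i. U n i \<omega>) (\<lambda>i. X n i \<omega>) (\<lambda>i. Q2 n i \<omega>) u v)) \<le> ereal \<rho>2}"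
        using order_tendstoD(1)[OF restr_eigen, of "1 - \<epsilon>'"] \<epsilon>' by (simp add: b_def Let_def)
      then show ?thesis
      proof eventually_elim
        case (elim n)
        interpret prob_space "M n" by (rule prob)
        show ?case
          by (rule holds_off_mono[OF holds_off_of_measure_ge[OF less_imp_le[OF elim] \<epsilon>'(2)] order_refl])
            (simp add: hess_ge_def le_INF_iff)
      qed
    qed
    have half: "0 < cm / 4" using cm by simp
    have A1: "0 < \<rho>1 / (2 * (A + 1))" using rho A by simp
    show "\<forall>\<^sub>F n in sequentially. measure (M n) {\<omega> \<in> space (M n). \<bar>err n \<omega>\<bar> > 2 * Cr * (sqrt (real (s2 n)) * lam1 n)} \<le> \<epsilon>"
      using good'[OF \<epsilon>'(1) half] re lr Ds ss[OF A1] ss[OF zero_less_one] eventually_ge_at_top[of 1]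
    proof eventually_elim
      case (elim n)
      interpret prob_space "M n" by (rule prob)
      define s where "s = real (s2 n)"
      have s: "1 \<le> s" using s2(1)[of n] by (simp add: s_def)
      define l1 where "l1 = lam1 n"
      define l2 where "l2 = lam2 n"
      have l: "0 < l1" "0 < l2" using tuning by (auto simp: l1_def l2_def)
      have pr: "c1 * l2 \<le> l1" "l1 \<le> c2 * l2" using elim(3) by (auto simp: l1_def l2_def)
      have bn: "b n \<le> b0" "max (l1 / l2) (l2 / l1) \<le> b n"
      proof -
        have "l1 / l2 \<le> c2" "l2 / l1 \<le> 1 / c1" using pr l c by (auto simp: field_simps)
        then show "b n \<le> b0" by (auto simp: b_def b0_def l1_def l2_def max_def)
        show "max (l1 / l2) (l2 / l1) \<le> b n" using delta by (simp add: b_def l1_def l2_def)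
      qed
      have bpos: "0 < b n"
        using bn(2) l by (auto intro: less_le_trans[of 0 "max (l1 / l2) (l2 / l1)"] simp: less_max_iff_disj)
      define kn where "kn = 2 * (1 + b n)"
      have kn: "0 < kn" "kn \<le> \<kappa>" using bn bpos by (auto simp: kn_def \<kappa>_def)
      have lmin: "cm * l1 \<le> min l1 l2"
      proof (rule min.boundedI)
        have "cm * l1 \<le> 1 * l1" using l by (intro mult_right_mono) (auto simp: cm_def)
        then show "cm * l1 \<le> l1" by simp
        have "cm * l1 \<le> 1 / c2 * l1" using l by (intro mult_right_mono) (auto simp: cm_def)
        also have "\<dots> \<le> l2" using pr c2 by (simp add: field_simps)
        finally show "cm * l1 \<le> l2" .
      qed
      have lmax: "max l1 l2 \<le> cM * l1"
      proof (rule max.boundedI)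
        have "1 * l1 \<le> cM * l1" using l by (intro mult_right_mono) (auto simp: cM_def)
        then show "l1 \<le> cM * l1" by simp
        have "l2 \<le> 1 / c1 * l1" using pr c by (simp add: field_simps)
        also have "\<dots> \<le> cM * l1" using l by (intro mult_right_mono) (auto simp: cM_def)
        finally show "l2 \<le> cM * l1" .
      qed
      have Dsn: "D n * s \<le> \<zeta> * l1" using elim(4) by (simp add: s_def l1_def)
      have Ds0: "0 \<le> D n * s" using D[of n] s by simp
      have l1_le: "l1 \<le> 1"
      proof -
        have "1 * l1 \<le> s\<^sup>2 * l1" using s l by (intro mult_right_mono) auto
        then show ?thesis using elim(6) by (simp add: s_def l1_def)
      qed
      have grad: "cm / 4 * l1 + B * C * D n * (2 * s) + B * C * (D n)\<^sup>2 * (2 * s)\<^sup>2 \<le> min l1 l2 / 2"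
      proof -
        \<comment> \<open>D s is at most \<zeta> l1 and so at most 1, and the quadratic bias term is
          dominated by the linear one: 2 D s + 4 (D s)^2 \<le> 6 D s.\<close>
        have "(D n * s)\<^sup>2 \<le> D n * s * 1"
          unfolding power2_eq_square using Dsn Ds0 \<zeta> l l1_le mult_mono[of \<zeta> 1 l1 1] by (intro mult_left_mono) auto
        then have "B * C * (D n * s)\<^sup>2 \<le> B * C * (D n * s)" using BC by (intro mult_left_mono) auto
        then have "B * C * D n * (2 * s) + B * C * (D n)\<^sup>2 * (2 * s)\<^sup>2 \<le> 6 * B * C * (D n * s)"
          by (simp add: power_mult_distrib mult_ac)
        also have "\<dots> \<le> 6 * B * C * (\<zeta> * l1)" using Dsn BC by (intro mult_left_mono) auto
        also have "\<dots> \<le> cm / 4 * l1" using mult_right_mono[OF \<zeta>(3), of l1] l by (simp add: mult_ac)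
        finally show ?thesis using lmin by linarith
      qed
      have sq: "sqrt (2 * s) = sqrt 2 * sqrt s" "sqrt s * sqrt s = s" using s by (auto simp: real_sqrt_mult)
      have sR: "sqrt s * R n = Cr * (s * l1)"
      proof -
        have "sqrt s * R n = Cr * ((sqrt s * sqrt s) * l1)" by (simp add: R_def s_def l1_def mult_ac)
        then show ?thesis using sq(2) by simp
      qed
      have small_ineq: "C * B\<^sup>2 * (kn\<^sup>2 * (2 * s)) * (D n * (2 * s) + B * (kn * sqrt (2 * s) * R n)) \<le> \<rho>1 / 2"
      proof -
        have "D n * (2 * s) + B * (kn * sqrt (2 * s) * R n) = 2 * (D n * s) + B * kn * sqrt 2 * (sqrt s * R n)"
          unfolding sq(1) by (simp only: mult_ac)
        also have "\<dots> \<le> 2 * (1 * l1) + B * \<kappa> * sqrt 2 * (Cr * (s * l1))"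
        proof (intro add_mono mult_left_mono)
          show "D n * s \<le> 1 * l1" using Dsn \<zeta>(2) l mult_right_mono[of \<zeta> 1 l1] by linarith
          show "B * kn * sqrt 2 * (sqrt s * R n) \<le> B * \<kappa> * sqrt 2 * (Cr * (s * l1))"
            unfolding sR using B kn Cr s l by (intro mult_right_mono mult_left_mono) auto
        qed auto
        \<comment> \<open>As s \<ge> 1, the bias is absorbed into the order s l1 of the other
          term.\<close>
        also have "\<dots> \<le> 2 * (s * l1) + B * \<kappa> * sqrt 2 * (Cr * (s * l1))"
          using s l by (intro add_right_mono mult_left_mono mult_right_mono) auto
        also have "\<dots> = (2 + B * \<kappa> * sqrt 2 * Cr) * (s * l1)" by (simp add: algebra_simps)
        finally have 1: "D n * (2 * s) + B * (kn * sqrt (2 * s) * R n) \<le> (2 + B * \<kappa> * sqrt 2 * Cr) * (s * l1)" .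
        have 2: "C * B\<^sup>2 * (kn\<^sup>2 * (2 * s)) \<le> C * B\<^sup>2 * (\<kappa>\<^sup>2 * (2 * s))"
          using C kn s by (intro mult_left_mono mult_right_mono power_mono) auto
        have "C * B\<^sup>2 * (kn\<^sup>2 * (2 * s)) * (D n * (2 * s) + B * (kn * sqrt (2 * s) * R n))
            \<le> C * B\<^sup>2 * (\<kappa>\<^sup>2 * (2 * s)) * ((2 + B * \<kappa> * sqrt 2 * Cr) * (s * l1))"
          by (rule mult_mono[OF 2 1]) (use C s D[of n] B kn R[of n] in \<open>auto intro!: add_nonneg_nonneg mult_nonneg_nonneg simp: less_imp_le\<close>)
        also have "\<dots> = A * (s\<^sup>2 * l1)" by (simp add: A_def power2_eq_square mult_ac)
        also have "\<dots> \<le> A * (\<rho>1 / (2 * (A + 1)))" using elim(5) A by (intro mult_left_mono) (auto simp: s_def l1_def)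
        also have "\<dots> \<le> \<rho>1 / 2"
        proof -
          have "A * \<rho>1 \<le> (A + 1) * \<rho>1" using rho by (intro mult_right_mono) auto
          then show ?thesis using A by (simp add: field_simps)
        qed
        finally show ?thesis .
      qed
      have large: "6 * max l1 l2 * kn * sqrt (2 * s) < \<rho>1 * R n"
      proof -
        have "6 * max l1 l2 * kn * sqrt (2 * s) \<le> 6 * (cM * l1) * \<kappa> * sqrt (2 * s)"
          using lmax kn l s cm by (intro mult_right_mono mult_mono) auto
        also have "\<dots> = (6 * cM * \<kappa> * sqrt 2) * (sqrt s * l1)" unfolding sq(1) by (simp only: mult_ac)
        also have "\<dots> < (\<rho>1 * Cr) * (sqrt s * l1)"
        proof (rule mult_strict_right_mono)
          show "6 * cM * \<kappa> * sqrt 2 < \<rho>1 * Cr" using rho by (simp add: Cr_def field_simps)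
          show "0 < sqrt s * l1" using s l by simp
        qed
        also have "\<dots> = \<rho>1 * R n" by (simp add: R_def s_def l1_def mult_ac)
        finally show ?thesis .
      qed
      have ae1: "AE \<omega> in M n. \<forall>k\<in>{1..n}. maximiser K l1 l2 n k \<omega> (atil n k \<omega>, btil n k \<omega>)"
        unfolding l1_def l2_def by (rule AE_finite_allI) (use est_max in auto)
      have ae2: "AE \<omega> in M n. \<forall>i\<in>{1..n}. curv_lipschitz n i \<omega>"
        by (rule AE_finite_allI) (use Mf_lip in auto)
      note off = holds_off_conj[OF holds_off_conj[OF elim(1,2)]
          holds_off_conj[OF holds_off_AE[OF ae1] holds_off_AE[OF ae2]]]
      show ?case
      proof (rule holds_off_measure_le[OF holds_off_mono[OF off, where Q="\<lambda>\<omega>. \<bar>err n \<omega>\<bar> \<le> 2 * Cr * (sqrt (real (s2 n)) * lam1 n)"]])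
        show "\<epsilon>' + \<epsilon>' + (0 + 0) \<le> \<epsilon>" using \<epsilon>' by simp
        fix \<omega> assume \<omega>: "\<omega> \<in> space (M n)"
          and H: "(good K n C (cm / 4 * lam1 n) \<omega> \<and> hess_ge K \<rho>1 (b n) (s2 n) n \<omega>) \<and>
            (\<forall>k\<in>{1..n}. maximiser K l1 l2 n k \<omega> (atil n k \<omega>, btil n k \<omega>)) \<and> (\<forall>i\<in>{1..n}. curv_lipschitz n i \<omega>)"
        have est: "L2_set (\<lambda>j. atil n k \<omega> j - a n j (U n k \<omega>)) {1..d n} \<le> R n \<and>
          L2_set (\<lambda>j. h n * (btil n k \<omega> j - a' n j (U n k \<omega>))) {1..d n} \<le> R n" if k: "k \<in> {1..n}" for k
        proof (rule estimator_error[OF \<omega> k s2(2) K B, where Ca=Ca and b="b n" and \<rho>=\<rho>1 and a''="a'' n"])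
          show "good K n C (cm / 4 * l1) \<omega>" using H by (simp add: l1_def)
          show "0 \<le> cm / 4 * l1" using cm l by simp
          show "cm / 4 * l1 + B * C * (Ca * (B * h n)\<^sup>2) * (2 * real (s2 n)) + B * C * (Ca * (B * h n)\<^sup>2)\<^sup>2 * (2 * real (s2 n))\<^sup>2
              \<le> min l1 l2 / 2"
            by (rule grad[unfolded D_def s_def])
          show "C * B\<^sup>2 * ((2 * (1 + b n))\<^sup>2 * (2 * real (s2 n))) *
              (Ca * (B * h n)\<^sup>2 * (2 * real (s2 n)) + B * (2 * (1 + b n) * sqrt (2 * real (s2 n)) * R n)) \<le> \<rho>1 / 2"
            by (rule small_ineq[unfolded D_def s_def kn_def])
          show "6 * max l1 l2 * (2 * (1 + b n)) * sqrt (2 * real (s2 n)) < \<rho>1 * R n"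
            by (rule large[unfolded s_def kn_def])
          show "maximiser K l1 l2 n k \<omega> (atil n k \<omega>, btil n k \<omega>)" "hess_ge K \<rho>1 (b n) (s2 n) n \<omega>"
            using H k by auto
          show "curv_lipschitz n i \<omega>" if "i \<in> {1..n}" for i
            using H that by blast
        qed (assumption | rule C q2_neg a_C2 Ca a_zero l bn(2) rho R)+
        have "0 \<le> err n \<omega>" "err n \<omega> \<le> R n + R n"
          using Max_nonneg_le[OF elim(7), of "\<lambda>k. L2_set (\<lambda>j. atil n k \<omega> j - a n j (U n k \<omega>)) {1..d n}" "R n"]
            Max_nonneg_le[OF elim(7), of "\<lambda>k. L2_set (\<lambda>j. h n * (btil n k \<omega> j - a' n j (U n k \<omega>))) {1..d n}" "R n"] est
          by (simp_all add: err L2_set_nonneg)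
        then show "\<bar>err n \<omega>\<bar> \<le> 2 * Cr * (sqrt (real (s2 n)) * lam1 n)" by (simp add: R_def mult_ac)
      qed (use \<epsilon> in auto)
    qed
  qed
qed

end

lemma emeasure_near_le:
  fixes V :: "'a \<Rightarrow> real"
  assumes V: "distributed M lborel V (\<lambda>u. ennreal (f u * indicator {0..1} u))"
    and f: "\<And>u. u \<in> {0..1} \<Longrightarrow> f u \<le> C" and C: "0 \<le> C" and r: "0 \<le> r"
  shows "(\<integral>\<^sup>+\<omega>. indicator {\<omega>. \<bar>V \<omega> - u\<bar> \<le> r} \<omega> \<partial>M) \<le> ennreal (2 * C * r)"
proof -
  have "(\<integral>\<^sup>+\<omega>. indicator {\<omega>. \<bar>V \<omega> - u\<bar> \<le> r} \<omega> \<partial>M) = (\<integral>\<^sup>+\<omega>. indicator {u - r..u + r} (V \<omega>) \<partial>M)"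
    by (intro nn_integral_cong) (auto simp: indicator_def abs_le_iff)
  also have "\<dots> = (\<integral>\<^sup>+x. ennreal (f x * indicator {0..1} x) * indicator {u - r..u + r} x \<partial>lborel)"
    by (rule distributed_nn_integral[OF V, symmetric]) simp
  also have "\<dots> \<le> (\<integral>\<^sup>+x. ennreal C * indicator {u - r..u + r} x \<partial>lborel)"
    using f C by (intro nn_integral_mono) (auto simp: indicator_def intro: ennreal_leI)
  also have "\<dots> = ennreal C * ennreal (2 * r)"
    using r by (simp add: nn_integral_cmult_indicator)
  also have "\<dots> = ennreal (2 * C * r)" using C r by (simp add: ennreal_mult[symmetric] mult_ac)
  finally show ?thesis .
qed

section \<open>The two moment regimes combined\<close>

theorem proposition3p1:
  fixes M :: "nat \<Rightarrow> 'a measure"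
    and U y :: "nat \<Rightarrow> nat \<Rightarrow> 'a \<Rightarrow> real"
    and X :: "nat \<Rightarrow> nat \<Rightarrow> 'a \<Rightarrow> nat \<Rightarrow> real"
    and d s1 s2 :: "nat \<Rightarrow> nat"
    and a a' a'' :: "nat \<Rightarrow> nat \<Rightarrow> real \<Rightarrow> real"
    and \<nu> :: "real measure" and \<Y> D :: "real set"
    and ell :: "real \<Rightarrow> real \<Rightarrow> real" and g ginv :: "real \<Rightarrow> real"
    and m :: "nat \<Rightarrow> real \<Rightarrow> (nat \<Rightarrow> real) \<Rightarrow> real"
    and Mf :: "nat \<Rightarrow> (nat \<Rightarrow> real) \<Rightarrow> real \<Rightarrow> real \<Rightarrow> real"
    and Q1 Q2 :: "nat \<Rightarrow> nat \<Rightarrow> 'a \<Rightarrow> real"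
    and K fU fU' fU'' :: "real \<Rightarrow> real"
    and h lam1 lam2 :: "nat \<Rightarrow> real"
    and \<delta> \<rho>1 \<rho>2 :: real
    and atil btil :: "nat \<Rightarrow> nat \<Rightarrow> 'a \<Rightarrow> nat \<Rightarrow> real"
    and err :: "nat \<Rightarrow> 'a \<Rightarrow> real"
  assumes
    \<comment> \<open>the sample\<close>
    prob: "\<And>n. prob_space (M n)"
    and indep: "\<And>n. prob_space.indep_vars (M n) (\<lambda>i. obs_space (d n))
                  (\<lambda>i \<omega>. (U n i \<omega>, X n i \<omega>, y n i \<omega>)) {1..n}"
    and ident: "\<And>n i i'. i \<in> {1..n} \<Longrightarrow> i' \<in> {1..n} \<Longrightarrow>
                  distr (M n) (obs_space (d n)) (\<lambda>\<omega>. (U n i \<omega>, X n i \<omega>, y n i \<omega>)) =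
                  distr (M n) (obs_space (d n)) (\<lambda>\<omega>. (U n i' \<omega>, X n i' \<omega>, y n i' \<omega>))"
    and U_range: "\<And>n i \<omega>. i \<in> {1..n} \<Longrightarrow> \<omega> \<in> space (M n) \<Longrightarrow> U n i \<omega> \<in> {0..1}"
    and y_range: "\<And>n i \<omega>. i \<in> {1..n} \<Longrightarrow> \<omega> \<in> space (M n) \<Longrightarrow> y n i \<omega> \<in> \<Y>"
    and Y_meas: "\<Y> \<in> sets borel"
    \<comment> \<open>the model for the response\<close>
    and nu: "sigma_finite_measure \<nu>" "sets \<nu> = sets borel"
    and link: "bij_betw g D UNIV"
    and ginv: "ginv = inv_into D g"
    and lik_meas: "(\<lambda>(s, t). ell (ginv s) t) \<in> borel_measurable (borel \<Otimes>\<^sub>M borel)"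
    and lik_diff1: "\<And>s t. t \<in> \<Y> \<Longrightarrow> (\<lambda>s. ell (ginv s) t) differentiable at s"
    and lik_diff2: "\<And>s t. t \<in> \<Y> \<Longrightarrow> (\<lambda>s. q1 ell ginv s t) differentiable at s"
    and mean_link: "\<And>n u x. u \<in> {0..1} \<Longrightarrow> m n u x \<in> D \<and> g (m n u x) = lin_pred (d n) (a n) u x"
    and y_int: "\<And>n i. i \<in> {1..n} \<Longrightarrow> integrable (M n) (y n i)"
    and mean_y: "\<And>n i. i \<in> {1..n} \<Longrightarrow>
                  AE \<omega> in M n. cond_exp (M n) (cov_space (d n)) (\<lambda>\<omega>. (U n i \<omega>, X n i \<omega>)) (y n i) \<omega>
                    = m n (U n i \<omega>) (X n i \<omega>)"
    and cond_density: "\<And>n i. i \<in> {1..n} \<Longrightarrow>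
                  distributed (M n)
                    (distr (M n) (cov_space (d n)) (\<lambda>\<omega>. (U n i \<omega>, X n i \<omega>)) \<Otimes>\<^sub>M \<nu>)
                    (\<lambda>\<omega>. ((U n i \<omega>, X n i \<omega>), y n i \<omega>))
                    (\<lambda>((u, x), t). ennreal (exp (ell (m n u x) t)))"
    \<comment> \<open>sparsity structure of the functional coefficients\<close>
    and sizes: "\<And>n. 1 \<le> s1 n \<and> s1 n < s2 n \<and> s2 n < d n"
    and d_lim: "filterlim d at_top sequentially"
    and s2_small: "(\<lambda>n. real (s2 n)) \<in> o(\<lambda>n. real n)" "(\<lambda>n. real (s2 n)) \<in> o(\<lambda>n. real (d n))"
    and a_nonconst: "\<And>n j. j \<in> {1..s1 n} \<Longrightarrow> \<not> a n j constant_on {0..1}"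
    and a_const: "\<And>n j. j \<in> {s1 n + 1..s2 n} \<Longrightarrow> \<exists>c. c \<noteq> 0 \<and> (\<forall>u\<in>{0..1}. a n j u = c)"
    and a_zero: "\<And>n j u. j \<in> {s2 n + 1..d n} \<Longrightarrow> u \<in> {0..1} \<Longrightarrow> a n j u = 0"
    \<comment> \<open>derivatives of the log-likelihood at the true linear predictor\<close>
    and Q1: "Q1 = (\<lambda>n i \<omega>. q1 ell ginv (lin_pred (d n) (a n) (U n i \<omega>) (X n i \<omega>)) (y n i \<omega>))"
    and Q2: "Q2 = (\<lambda>n i \<omega>. q2 ell ginv (lin_pred (d n) (a n) (U n i \<omega>) (X n i \<omega>)) (y n i \<omega>))"
    \<comment> \<open>bandwidth and tuning parameters; the preliminary estimators\<close>
    and tuning: "\<And>n. 0 < h n" "\<And>n. 0 < lam1 n" "\<And>n. 0 < lam2 n"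
    and est_meas: "\<And>n k j. k \<in> {1..n} \<Longrightarrow> j \<in> {1..d n} \<Longrightarrow>
                    (\<lambda>\<omega>. atil n k \<omega> j) \<in> borel_measurable (M n) \<and>
                    (\<lambda>\<omega>. btil n k \<omega> j) \<in> borel_measurable (M n)"
    and est_max: "\<And>n k. k \<in> {1..n} \<Longrightarrow>
                    AE \<omega> in M n. is_arg_max
                      (\<lambda>(\<alpha>, \<beta>). penalised_loglik ell ginv K (h n) (lam1 n) (lam2 n) n (d n)
                         (\<lambda>i. U n i \<omega>) (\<lambda>i. X n i \<omega>) (\<lambda>i. y n i \<omega>) k \<alpha> \<beta>)
                      (\<lambda>_. True) (atil n k \<omega>, btil n k \<omega>)"
    and err: "err = (\<lambda>n \<omega>.
                (MAX k\<in>{1..n}. L2_set (\<lambda>j. atil n k \<omega> j - a n j (U n k \<omega>)) {1..d n}) +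
                (MAX k\<in>{1..n}. L2_set (\<lambda>j. h n * (btil n k \<omega> j - a' n j (U n k \<omega>))) {1..d n}))"
    \<comment> \<open>(1)\<close>
    and K_cont: "continuous_on UNIV K"
    and K_sym: "\<And>t. K (- t) = K t"
    and K_dens: "\<And>t. 0 \<le> K t" "(K has_integral 1) UNIV"
    and K_supp: "compact (closure {t. K t \<noteq> 0})"
    \<comment> \<open>(2a)\<close>
    and Q1_int: "\<And>n i. i \<in> {1..n} \<Longrightarrow> integrable (M n) (Q1 n i)"
                "\<And>n i. i \<in> {1..n} \<Longrightarrow> integrable (M n) (\<lambda>\<omega>. (Q1 n i \<omega>)\<^sup>2)"
    and Q1_mean: "\<And>n i. i \<in> {1..n} \<Longrightarrow>
                    AE \<omega> in M n. cond_exp (M n) (cov_space (d n)) (\<lambda>\<omega>. (U n i \<omega>, X n i \<omega>)) (Q1 n i) \<omega> = 0"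
    and Q1_var: "\<And>n. \<exists>\<phi>. continuous_on {0..1} \<phi> \<and>
                    (\<forall>i\<in>{1..n}. AE \<omega> in M n.
                       cond_exp (M n) borel (U n i) (\<lambda>\<omega>. (Q1 n i \<omega>)\<^sup>2) \<omega> = \<phi> (U n i \<omega>))"
    \<comment> \<open>(2b)\<close>
    and q2_neg: "\<And>s t. t \<in> \<Y> \<Longrightarrow> q2 ell ginv s t < 0"
    and Mf_meas: "\<And>n. (\<lambda>(x, u, t). Mf n x u t) \<in>
                    borel_measurable ((\<Pi>\<^sub>M j\<in>{1..d n}. borel) \<Otimes>\<^sub>M (borel \<Otimes>\<^sub>M borel))"
    and Mf_lip: "\<And>n i. i \<in> {1..n} \<Longrightarrow>
                   AE \<omega> in M n. 0 < Mf n (X n i \<omega>) (U n i \<omega>) (y n i \<omega>) \<and>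
                     (\<forall>\<delta>'. \<bar>q2 ell ginv (lin_pred (d n) (a n) (U n i \<omega>) (X n i \<omega>) + \<delta>') (y n i \<omega>)
                            - q2 ell ginv (lin_pred (d n) (a n) (U n i \<omega>) (X n i \<omega>)) (y n i \<omega>)\<bar>
                          \<le> Mf n (X n i \<omega>) (U n i \<omega>) (y n i \<omega>) * \<bar>\<delta>'\<bar>)"
    \<comment> \<open>(2c)\<close>
    and rho: "0 < \<rho>1" "\<rho>1 \<le> \<rho>2" and delta: "0 < \<delta>"
    and restr_eigen: "(\<lambda>n. let b = max (lam1 n / lam2 n) (lam2 n / lam1 n) + \<delta>;
                              quad = (\<lambda>\<omega> u v. ereal (neg_hess_form K (h n) n (d n)
                                (\<lambda>i. U n i \<omega>) (\<lambda>i. X n i \<omega>) (\<lambda>i. Q2 n i \<omega>) u v))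
                          in measure (M n) {\<omega> \<in> space (M n).
                               ereal \<rho>1 \<le> (INF u\<in>{0..1}. INF v\<in>Omega0 (d n) (s2 n) b. quad \<omega> u v) \<and>
                               (SUP u\<in>{0..1}. SUP v\<in>Omega0 (d n) (s2 n) b. quad \<omega> u v) \<le> ereal \<rho>2})
                      \<longlonglongrightarrow> 1"
    \<comment> \<open>(3)\<close>
    and fU_dens: "\<And>n i. i \<in> {1..n} \<Longrightarrow>
                   distributed (M n) lborel (U n i) (\<lambda>u. ennreal (fU u * indicator {0..1} u))"
    and fU_C2: "C2_unit_interval fU fU' fU''"
    and fU_bdd: "\<exists>c C. 0 < c \<and> (\<forall>u\<in>{0..1}. c \<le> fU u \<and> fU u \<le> C)"
    \<comment> \<open>(4), uniformly over the triangular array\<close>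
    and a_C2: "\<And>n j. j \<in> {1..d n} \<Longrightarrow> C2_unit_interval (a n j) (a' n j) (a'' n j)"
    and a''_bdd: "\<exists>C. \<forall>n. \<forall>j\<in>{1..d n}. \<forall>u\<in>{0..1}. \<bar>a'' n j u\<bar> \<le> C"
  shows
    \<comment> \<open>(i)\<close>
    "(\<forall>m0 \<tau>1 \<delta>1 :: real.
        2 < m0 \<and>
        (\<exists>C::real. \<forall>n. \<forall>i\<in>{1..n}. AE \<omega> in M n.
           (MAX j\<in>{1..d n}. nn_cond_exp_given (M n) borel (U n i)
              (\<lambda>\<omega>. \<bar>Q1 n i \<omega> * X n i \<omega> j\<bar> powr m0) \<omega>) +
           (MAX (j, k)\<in>{1..d n} \<times> {1..d n}. nn_cond_exp_given (M n) borel (U n i)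
              (\<lambda>\<omega>. \<bar>Q2 n i \<omega> * X n i \<omega> j * X n i \<omega> k\<bar> powr m0) \<omega>) \<le> ennreal C) \<and>
        (\<exists>C::real. \<forall>n. \<forall>i\<in>{1..n}. AE \<omega> in M n.
           (MAX (j, k, l)\<in>{1..d n} \<times> {1..d n} \<times> {1..d n}. nn_cond_exp_given (M n) borel (U n i)
              (\<lambda>\<omega>. \<bar>X n i \<omega> j * X n i \<omega> k * X n i \<omega> l *
                     Mf n (X n i \<omega>) (U n i \<omega>) (y n i \<omega>)\<bar> powr m0) \<omega>) \<le> ennreal C) \<and>
        0 \<le> \<tau>1 \<and> propto (\<lambda>n. real (d n)) (\<lambda>n. real n powr \<tau>1) \<and>
        filterlim (\<lambda>n. real n * h n / ((real n * real (d n) ^ 3) powr (2 / m0) * ln (inverse (h n))))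
          at_top sequentially \<and>
        0 < \<delta>1 \<and> \<delta>1 < 1 \<and> propto h (\<lambda>n. real n powr (- \<delta>1)) \<and>
        (\<lambda>n. real (s2 n) * (h n)\<^sup>2 + (ln (inverse (h n)) / (real n * h n)) powr (1 / 2)) \<in> o(lam1) \<and>
        propto lam1 lam2 \<and>
        (\<lambda>n. real (s2 n) * (lam1 n)\<^sup>2 / (h n)\<^sup>2 + (real (s2 n))\<^sup>2 * lam1 n) \<in> o(\<lambda>_. 1)
      \<longrightarrow> bigO_P M err (\<lambda>n. sqrt (real (s2 n)) * lam1 n))
     \<and>
     (\<forall>M0 M1 \<tau>2 \<tau>3 \<delta>1 :: real.
        0 < M0 \<and> 0 < M1 \<and>
        (\<forall>q::nat\<ge>2. \<forall>n. \<forall>i\<in>{1..n}. AE \<omega> in M n.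
           (MAX j\<in>{1..d n}. nn_cond_exp_given (M n) borel (U n i)
              (\<lambda>\<omega>. \<bar>Q1 n i \<omega> * X n i \<omega> j\<bar> ^ q) \<omega>) +
           (MAX (j, k)\<in>{1..d n} \<times> {1..d n}. nn_cond_exp_given (M n) borel (U n i)
              (\<lambda>\<omega>. \<bar>Q2 n i \<omega> * X n i \<omega> j * X n i \<omega> k\<bar> ^ q) \<omega>) \<le> ennreal (M0 * fact q / 2)) \<and>
        (\<forall>q::nat\<ge>2. \<forall>n. \<forall>i\<in>{1..n}. AE \<omega> in M n.
           (MAX (j, k, l)\<in>{1..d n} \<times> {1..d n} \<times> {1..d n}. nn_cond_exp_given (M n) borel (U n i)
              (\<lambda>\<omega>. \<bar>X n i \<omega> j * X n i \<omega> k * X n i \<omega> l *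
                     Mf n (X n i \<omega>) (U n i \<omega>) (y n i \<omega>)\<bar> ^ q) \<omega>) < ennreal (M1 * fact q / 2)) \<and>
        0 \<le> \<tau>2 \<and> \<tau>2 < 1 - \<tau>3 \<and> 0 < \<tau>3 \<and> \<tau>3 < 1 \<and>
        propto (\<lambda>n. real (d n)) (\<lambda>n. exp ((real n * h n) powr \<tau>2)) \<and>
        0 < \<delta>1 \<and> \<delta>1 < 1 \<and> propto h (\<lambda>n. real n powr (- \<delta>1)) \<and>
        (\<lambda>n. real (s2 n) * (h n)\<^sup>2 + (ln (inverse (h n)) / (real n * h n)) powr (\<tau>3 / 2)) \<in> o(lam1) \<and>
        propto lam1 lam2 \<and>
        (\<lambda>n. real (s2 n) * (lam1 n)\<^sup>2 / (h n)\<^sup>2 + (real (s2 n))\<^sup>2 * lam1 n) \<in> o(\<lambda>_. 1)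
      \<longrightarrow> bigO_P M err (\<lambda>n. sqrt (real (s2 n)) * lam1 n))"
proof -
  obtain B KC where B: "1 \<le> B" and KC: "1 \<le> KC" "\<And>t. \<bar>K t\<bar> \<le> KC" and K0: "\<And>t. B < \<bar>t\<bar> \<Longrightarrow> K t = 0"
    using compact_support_bound[OF K_cont K_supp] by blast
  \<comment> \<open>Dominates both K and t K(t) on the support, since B \<ge> 1.\<close>
  define W where "W = B * KC"
  have W: "KC \<le> W" "0 < W" using mult_right_mono[OF B, of KC] KC(1) by (auto simp: W_def)
  have Km: "K \<in> borel_measurable borel" using K_cont by (rule borel_measurable_continuous_onI)
  have KW: "\<bar>K t\<bar> \<le> W * indicator {-B..B} t" "\<bar>t * K t\<bar> \<le> W * indicator {-B..B} t" for t
  proof -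
    have "\<bar>K t\<bar> \<le> W * indicator {-B..B} t \<and> \<bar>t * K t\<bar> \<le> W * indicator {-B..B} t"
    proof (cases "B < \<bar>t\<bar>")
      case True
      then show ?thesis using K0[OF True] W by simp
    next
      case False
      have "\<bar>t\<bar> * \<bar>K t\<bar> \<le> B * KC" using False KC(2)[of t] B by (intro mult_mono) auto
      moreover have "t \<in> {-B..B}" using False by auto
      ultimately show ?thesis using KC(2)[of t] W by (simp add: abs_mult W_def)
    qed
    then show "\<bar>K t\<bar> \<le> W * indicator {-B..B} t" "\<bar>t * K t\<bar> \<le> W * indicator {-B..B} t" by auto
  qed
  obtain cf Cf where cf: "0 < cf" "\<And>u. u \<in> {0..1} \<Longrightarrow> cf \<le> fU u \<and> fU u \<le> Cf" using fU_bdd by blast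
  have Cf: "0 < Cf" using cf(1) cf(2)[of 0] by auto
  have d1: "1 \<le> d n" "1 \<le> s2 n" "s2 n \<le> d n" for n using sizes[of n] by auto
  \<comment> \<open>An interval of radius r has length 2 r and the density is at most
    \<open>Cf\<close>, hence the constant \<open>2 * Cf\<close>.\<close>
  interpret svc_model M U y X d a \<Y> ell ginv Mf h "2 * Cf" Q1 Q2
  proof (rule svc_model.intro[OF prob indep U_range y_range Y_meas lik_meas lik_diff1 lik_diff2 d1(1) Q1 Q2
        tuning(1) _ Q1_int(1) Q1_mean Mf_meas])
    show "0 < 2 * Cf" using Cf by simp
    show "(\<integral>\<^sup>+\<omega>. indicator {\<omega>. \<bar>U n i \<omega> - u\<bar> \<le> r} \<omega> \<partial>M n) \<le> ennreal (2 * Cf * r)"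
      if "i \<in> {1..n}" "0 \<le> r" for n i u r
      by (rule emeasure_near_le[OF fU_dens[OF that(1)] _ _ that(2)]) (use cf Cf in auto)
    show "continuous_on {0..1} (a n j)" if "j \<in> {1..d n}" for n j
      using a_C2[OF that] by (auto simp: C2_unit_interval_def intro!: DERIV_continuous_on)
  qed
  have hs0: "0 \<le> real (s2 n) * (h n)\<^sup>2" for n by simp
  \<comment> \<open>Because s \<ge> 1, the condition on s^2 lam1 already forces \<open>lam1\<close>
    to 0.\<close>
  have lam0: "lam1 \<longlonglongrightarrow> 0"
    if sm: "(\<lambda>n. real (s2 n) * (lam1 n)\<^sup>2 / (h n)\<^sup>2 + (real (s2 n))\<^sup>2 * lam1 n) \<in> o(\<lambda>_. 1)"
  proof (rule tendstoI)
    fix \<epsilon> :: real assume \<epsilon>: "0 < \<epsilon>"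
    have "\<forall>\<^sub>F n in sequentially. (real (s2 n))\<^sup>2 * lam1 n \<le> \<epsilon> / 2 * 1"
      by (rule smallo_sumD(2)[OF sm]) (use tuning(2) \<epsilon> in \<open>auto simp: less_imp_le\<close>)
    then show "\<forall>\<^sub>F n in sequentially. dist (lam1 n) 0 < \<epsilon>"
    proof eventually_elim
      case (elim n)
      have "1 * lam1 n \<le> (real (s2 n))\<^sup>2 * lam1 n"
        using d1(2)[of n] tuning(2)[of n] by (intro mult_right_mono) auto
      moreover have "dist (lam1 n) 0 = lam1 n" using tuning(2)[of n] by simp
      ultimately show ?case using elim \<epsilon> by linarith
    qed
  qed
  interpret svc_kernel M U y X d a \<Y> ell ginv Mf h "2 * Cf" Q1 Q2 K W B
    by unfold_locales (use Km KW W(2) B in auto)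
  \<comment> \<open>The moment conditions enter only through \<open>good\<close>; \<open>e\<close>
    stands for the stochastic error term of the respective case.\<close>
  have rate: "bigO_P M err (\<lambda>n. sqrt (real (s2 n)) * lam1 n)"
    if good: "\<exists>C\<ge>0. \<forall>\<epsilon>>0. \<forall>\<eta>>0. \<forall>\<^sub>F n in sequentially. holds_off (M n) \<epsilon> (good K n C (\<eta> * lam1 n))"
      and e: "\<And>n. 0 \<le> e n" and small: "(\<lambda>n. real (s2 n) * (h n)\<^sup>2 + e n) \<in> o(lam1)"
      and lp: "propto lam1 lam2"
      and sm: "(\<lambda>n. real (s2 n) * (lam1 n)\<^sup>2 / (h n)\<^sup>2 + (real (s2 n))\<^sup>2 * lam1 n) \<in> o(\<lambda>_. 1)" for e
    by (rule error_rate_of_good[OF K_dens(1) _ B good d1(2,3) _ tuning(2,3) _ err _ _ rho(1) delta restr_eigen _ a''_bdd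
        e small lp sm]) (assumption | rule K0 a_zero est_max[folded maximiser_def] q2_neg Mf_lip[folded curv_lipschitz_def] a_C2)+
  show ?thesis
  proof ((intro conjI allI impI; elim conjE exE), goal_cases)
    case (1 m0 \<tau>1 \<delta>1 C D)
    note m0 = 1(1) and \<tau>1 = 1(2) and dp = 1(3) and q = 1(4) and \<delta>1 = 1(5,6)
      and hp = 1(7) and small = 1(8) and lp = 1(9) and sm = 1(10) and mom1 = 1(11) and mom2 = 1(12)
    note rates = poly_rates[of d h lam1 "\<lambda>n. real (s2 n) * (h n)\<^sup>2", OF d1(1) tuning(1,2) hs0 \<delta>1 hp lam0[OF sm] m0 \<tau>1 dp q small]
    show ?case
      by (rule rate[OF good_poly[OF m0 mom1 mom2 tuning(2) rates] powr_ge_zero small lp sm])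
  next
    case (2 M0 M1 \<tau>2 \<tau>3 \<delta>1)
    note mom1 = 2(3) and mom2 = 2(4) and \<tau> = 2(5,6,7) and dp = 2(9) and \<delta>1 = 2(10,11)
      and hp = 2(12) and small = 2(13) and lp = 2(14) and sm = 2(15)
    note rates = exp_rates[of d h lam1 "\<lambda>n. real (s2 n) * (h n)\<^sup>2", OF d1(1) tuning(1,2) hs0 \<delta>1 hp lam0[OF sm] \<tau> dp small]
    show ?case
      by (rule rate[OF good_exp[OF mom1 mom2 tuning(2) lam0[OF sm] rates] powr_ge_zero small lp sm])
  qed
qed

end
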